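(* Let $\Bbbk$ be a field of characteristic zero, let $U(3)$ be the universal associative conformal envelope of the Virasoro Lie conformal algebra relative to the locality bound $N=3$, and let $\Bbbk$ also denote the trivial one-dimensional conformal $U(3)$-bimodule. Then the conformal Hochschild cohomology groups satisfy $$\mathrm{H}^n(U(3),\Bbbk)=0\quad\text{for all } n\ge 4 .$$
   Context: A conformal algebra over $\Bbbk$ is a $\Bbbk[\partial]$-module $C$ with a bilinear $\lambda$-product $(\cdot{}_{(\lambda)}\cdot):C\otimes C\to C[\lambda]$ satisfying $(\partial a{}_{(\lambda)}b)=-\lambda(a{}_{(\lambda)}b)$ and $(a{}_{(\lambda)}\partial b)=(\partial+\lambda)(a{}_{(\lambda)}b)$. Write $(a{}_{(\lambda)}b)=\sum_{n\ge0}\frac{\lambda^n}{n!}(a{}_{(n)}b)$. It is associative if $(a{}_{(\lambda)}(b{}_{(\mu)}c))=((a{}_{(\lambda)}b){}_{(\lambda+\mu)}c)$. $U(3)$ is the associative conformal algebra generated by one element $v$ with defining relations $v{}_{(n)}v=0$ for $n\ge3$ and $2\,v{}_{(1)}v-\partial(v{}_{(2)}v)=2v$ (the latter is equivalent to $[v{}_{(\lambda)}v]=(\partial+2\lambda)v$, where $[a{}_{(\lambda)}b]=(a{}_{(\lambda)}b)-(b{}_{(-\partial-\lambda)}a)$). Thus it is universal: for every associative conformal algebra $C$ and $c\in C$ satisfying these relations there is a unique homomorphism $U(3)\to C$ of conformal algebras with $v\mapsto c$. The trivial bimodule $\Bbbk$ is one-dimensional, with $\partial$ acting by $0$ and zero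 left and right $\lambda$-actions. The (reduced) Hochschild complex $\mathrm{C}^\bullet(C,\Bbbk)$ has, for $n\ge1$, $\mathrm{C}^n(C,\Bbbk)$ equal to the space of linear maps $\varphi_{\lambda_1,\dots,\lambda_{n-1}}:C^{\otimes n}\to\Bbbk[\lambda_1,\dots,\lambda_{n-1}]$ such that $\varphi(a_1,\dots,\partial a_i,\dots,a_n)=-\lambda_i\varphi(a_1,\dots,a_n)$ for $1\le i\le n-1$ and $\varphi(a_1,\dots,\partial a_n)=(\lambda_1+\dots+\lambda_{n-1})\varphi(a_1,\dots,a_n)$. The differential $\mathrm{C}^n\to\mathrm{C}^{n+1}$ is $$(\mathrm d\varphi)_{\lambda_1,\dots,\lambda_n}(a_1,\dots,a_{n+1})=\sum_{i=1}^{n}(-1)^i\varphi_{\bar\lambda_i}(a_1,\dots,a_i{}_{(\lambda_i)}a_{i+1},\dots,a_{n+1}),$$ where $\bar\lambda_i=(\lambda_1,\dots,\lambda_i+\lambda_{i+1},\dots,\lambda_n)$ for $i<n$ and $\bar\lambda_n=(\lambda_1,\dots,\lambda_{n-1})$ (the two outer terms of the Hochschild differential vanish since the bimodule is trivial). Also $\mathrm{C}^0(C,\Bbbk)=\Bbbk$ with zero differential into $\mathrm{C}^1$. $\mathrm{H}^n(C,\Bbbk)$ is the $n$-th cohomology of this complex. *)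

theory Defs
  imports
    "HOL-Computational_Algebra.Polynomial"
    "HOL-Library.Poly_Mapping"
    "HOL.Vector_Spaces"
begin

section \<open>Conformal algebras\<close>

text \<open>
  An element of \<open>C[\<lambda>]\<close> is a \<^typ>\<open>'c poly\<close>, and an element of \<open>C[\<lambda>,\<mu>]\<close> is a
  \<^typ>\<open>'c poly poly\<close> whose inner variable is \<open>\<lambda>\<close> and whose outer variable is \<open>\<mu>\<close>.
  Hence \<open>pCons 0\<close> is multiplication by \<open>\<lambda>\<close> on \<open>C[\<lambda>]\<close>; on \<open>C[\<lambda>,\<mu>]\<close> multiplication by
  \<open>\<lambda>\<close> is \<open>map_poly (pCons 0)\<close> and multiplication by \<open>\<mu>\<close> is \<open>pCons 0\<close>.
\<close>

definition times_lam_plus_mu :: "'c::ab_group_add poly poly \<Rightarrow> 'c poly poly" where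
  "times_lam_plus_mu q = map_poly (pCons 0) q + pCons 0 q"

text \<open>The value \<open>p(\<lambda> + \<mu>)\<close> of \<open>p \<in> C[x]\<close>.\<close>

definition subst_lam_plus_mu :: "'c::ab_group_add poly \<Rightarrow> 'c poly poly" where
  "subst_lam_plus_mu p = (\<Sum>m\<le>degree p. (times_lam_plus_mu ^^ m) [:[:coeff p m:]:])"

locale conformal_algebra = vector_space scale
  for scale :: "'k::field_char_0 \<Rightarrow> 'c::ab_group_add \<Rightarrow> 'c" +
  fixes del :: "'c \<Rightarrow> 'c"
    and lprod :: "'c \<Rightarrow> 'c \<Rightarrow> 'c poly"
  assumes linear_del: "Vector_Spaces.linear scale scale del"
    and lprod_add_left: "lprod (a + b) c = lprod a c + lprod b c"
    and lprod_add_right: "lprod a (b + c) = lprod a b + lprod a c"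
    and lprod_scale_left: "lprod (scale r a) b = map_poly (scale r) (lprod a b)"
    and lprod_scale_right: "lprod a (scale r b) = map_poly (scale r) (lprod a b)"
    and lprod_del_left: "lprod (del a) b = - pCons 0 (lprod a b)"
    and lprod_del_right: "lprod a (del b) = map_poly del (lprod a b) + pCons 0 (lprod a b)"
begin

text \<open>The \<open>n\<close>-products: \<open>a\<^sub>(\<^sub>\<lambda>\<^sub>)b = \<Sum>\<^sub>n (\<lambda>\<^sup>n / n!) a\<^sub>(\<^sub>n\<^sub>)b\<close>.\<close>

definition nprod :: "nat \<Rightarrow> 'c \<Rightarrow> 'c \<Rightarrow> 'c" where
  "nprod n a b = scale (fact n) (coeff (lprod a b) n)"

definition U3_relations :: "'c \<Rightarrow> bool" where
  "U3_relations v \<longleftrightarrow>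
     (\<forall>n\<ge>3. nprod n v v = 0) \<and>
     scale 2 (nprod 1 v v) - del (nprod 2 v v) = scale 2 v"

end

text \<open>
  Associativity is \<open>a\<^sub>(\<^sub>\<lambda>\<^sub>)(b\<^sub>(\<^sub>\<mu>\<^sub>)c) = (a\<^sub>(\<^sub>\<lambda>\<^sub>)b)\<^sub>(\<^sub>\<lambda>\<^sub>+\<^sub>\<mu>\<^sub>)c\<close>: with \<open>a\<^sub>(\<^sub>\<lambda>\<^sub>)b = \<Sum>\<^sub>i \<lambda>\<^sup>i y\<^sub>i\<close>,
  the right-hand side is \<open>\<Sum>\<^sub>i \<lambda>\<^sup>i (y\<^sub>i \<^sub>(\<^sub>\<lambda>\<^sub>+\<^sub>\<mu>\<^sub>)c)\<close>.
\<close>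

locale assoc_conformal_algebra = conformal_algebra scale del lprod
  for scale :: "'k::field_char_0 \<Rightarrow> 'c::ab_group_add \<Rightarrow> 'c" and del lprod +
  assumes lprod_assoc:
    "map_poly (lprod a) (lprod b c) =
     (\<Sum>i\<le>degree (lprod a b).
        (map_poly (pCons 0) ^^ i) (subst_lam_plus_mu (lprod (coeff (lprod a b) i) c)))"

definition conformal_hom ::
    "('k::field_char_0 \<Rightarrow> 'c::ab_group_add \<Rightarrow> 'c) \<Rightarrow> ('c \<Rightarrow> 'c) \<Rightarrow> ('c \<Rightarrow> 'c \<Rightarrow> 'c poly) \<Rightarrow>
     ('k \<Rightarrow> 'd::ab_group_add \<Rightarrow> 'd) \<Rightarrow> ('d \<Rightarrow> 'd) \<Rightarrow> ('d \<Rightarrow> 'd \<Rightarrow> 'd poly) \<Rightarrow> ('c \<Rightarrow> 'd) \<Rightarrow> bool" where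
  "conformal_hom s1 del1 lprod1 s2 del2 lprod2 f \<longleftrightarrow>
     Vector_Spaces.linear s1 s2 f \<and>
     (\<forall>a. f (del1 a) = del2 (f a)) \<and>
     (\<forall>a b. lprod2 (f a) (f b) = map_poly f (lprod1 a b))"


subsection \<open>Coefficients and \<open>n\<close>-products\<close>

lemma coeff_times_lam_plus_mu:
  "coeff (coeff (times_lam_plus_mu q) s) r =
     (if r = 0 then 0 else coeff (coeff q s) (r - 1)) +
     (if s = 0 then 0 else coeff (coeff q (s - 1)) r)"
  by (cases r; cases s) (auto simp: times_lam_plus_mu_def coeff_map_poly)

context vector_space
begin

lemma coeff_times_lam_plus_mu_power:
  "coeff (coeff ((times_lam_plus_mu ^^ m) [:[:x:]:]) s) r =
     (if r + s = m then scale (of_nat (m choose s)) x else 0)"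
proof (induction m arbitrary: r s)
  case 0
  then show ?case by (auto simp: coeff_pCons split: nat.splits)
next
  case (Suc m)
  show ?case
    by (cases r; cases s)
      (auto simp: coeff_times_lam_plus_mu Suc.IH scale_left_distrib[symmetric] add.commute binomial_eq_0
            simp del: of_nat_Suc)
qed

lemma coeff_subst_lam_plus_mu:
  "coeff (coeff (subst_lam_plus_mu p) s) r = scale (of_nat ((r + s) choose s)) (coeff p (r + s))"
proof -
  have "coeff (coeff (subst_lam_plus_mu p) s) r =
      (\<Sum>m\<le>degree p. if r + s = m then scale (of_nat (m choose s)) (coeff p m) else 0)"
    by (simp add: subst_lam_plus_mu_def coeff_sum coeff_times_lam_plus_mu_power)
  also have "\<dots> = (if r + s \<le> degree p then scale (of_nat ((r + s) choose s)) (coeff p (r + s)) else 0)"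
    by (subst sum.delta') auto
  also have "\<dots> = scale (of_nat ((r + s) choose s)) (coeff p (r + s))"
    by (auto simp: coeff_eq_0)
  finally show ?thesis .
qed

end

lemma coeff_times_lam_power:
  "coeff (coeff ((map_poly (pCons 0) ^^ i) q) s) r = (if i \<le> r then coeff (coeff q s) (r - i) else 0)"
proof (induction i arbitrary: r)
  case 0
  then show ?case by simp
next
  case (Suc i)
  then show ?case by (cases r) (auto simp: coeff_map_poly)
qed

context vector_space
begin

lemma coeff_assoc_rhs:
  assumes "\<And>c. f 0 c = (0 :: 'b poly)"
  shows "coeff (coeff (\<Sum>i\<le>degree p. (map_poly (pCons 0) ^^ i)
            (subst_lam_plus_mu (f (coeff p i) c))) s) r =
         (\<Sum>i\<le>r. scale (of_nat ((r + s - i) choose s)) (coeff (f (coeff p i) c) (r + s - i)))"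
proof -
  let ?g = "\<lambda>i. if i \<le> r then scale (of_nat ((r - i + s) choose s)) (coeff (f (coeff p i) c) (r - i + s)) else 0"
  have "coeff (coeff (\<Sum>i\<le>degree p. (map_poly (pCons 0) ^^ i)
            (subst_lam_plus_mu (f (coeff p i) c))) s) r = (\<Sum>i\<le>degree p. ?g i)"
    by (simp add: coeff_sum coeff_times_lam_power coeff_subst_lam_plus_mu cong: if_cong)
  also have "\<dots> = (\<Sum>i\<le>max r (degree p). ?g i)"
    by (rule sum.mono_neutral_left) (auto simp: coeff_eq_0 assms)
  also have "\<dots> = (\<Sum>i\<le>r. ?g i)"
    by (rule sum.mono_neutral_right) auto
  also have "\<dots> = (\<Sum>i\<le>r. scale (of_nat ((r + s - i) choose s)) (coeff (f (coeff p i) c) (r + s - i)))"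
    by (rule sum.cong) auto
  finally show ?thesis .
qed

end

context conformal_algebra
begin

lemma del_simps [simp]: "del 0 = 0" "del (a + b) = del a + del b" "del (scale r a) = scale r (del a)"
  "del (- a) = - del a" "del (a - b) = del a - del b"
proof -
  have hom: "module_hom scale scale del"
    using linear_del by (simp add: Vector_Spaces.linear_iff_module_hom)
  show "del 0 = 0" "del (a + b) = del a + del b" "del (scale r a) = scale r (del a)"
    "del (- a) = - del a" "del (a - b) = del a - del b"
    by (rule module_hom.zero[OF hom] module_hom.add[OF hom] module_hom.scale[OF hom]
        module_hom.neg[OF hom] module_hom.diff[OF hom])+
qed

lemma lprod_0 [simp]: "lprod 0 b = 0" "lprod a 0 = 0"
  using lprod_add_left[of 0 0 b] lprod_add_right[of a 0 0] by auto

lemma coeff_lprod: "coeff (lprod a b) n = scale (1 / fact n) (nprod n a b)"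
  by (simp add: nprod_def)

lemma nprod_local: "\<exists>N. \<forall>n\<ge>N. nprod n a b = 0"
  by (rule exI[of _ "Suc (degree (lprod a b))"]) (auto simp: nprod_def coeff_eq_0)

lemma nprod_add_left: "nprod n (a + b) c = nprod n a c + nprod n b c"
  by (simp add: nprod_def lprod_add_left scale_right_distrib)

lemma nprod_add_right: "nprod n a (b + c) = nprod n a b + nprod n a c"
  by (simp add: nprod_def lprod_add_right scale_right_distrib)

lemma nprod_scale_left: "nprod n (scale r a) b = scale r (nprod n a b)"
  by (simp add: nprod_def lprod_scale_left coeff_map_poly mult.commute)

lemma nprod_scale_right: "nprod n a (scale r b) = scale r (nprod n a b)"
  by (simp add: nprod_def lprod_scale_right coeff_map_poly mult.commute)

lemma nprod_0 [simp]: "nprod n 0 b = 0" "nprod n a 0 = 0"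
  by (simp_all add: nprod_def)

lemma nprod_del_left_0: "nprod 0 (del a) b = 0"
  by (simp add: nprod_def lprod_del_left)

lemma nprod_del_left_Suc: "nprod (Suc n) (del a) b = scale (- of_nat (Suc n)) (nprod n a b)"
  by (simp add: nprod_def lprod_del_left algebra_simps del: of_nat_Suc)

lemma nprod_del_right_0: "nprod 0 a (del b) = del (nprod 0 a b)"
  by (simp add: nprod_def lprod_del_right coeff_map_poly)

lemma nprod_del_right_Suc:
  "nprod (Suc n) a (del b) = del (nprod (Suc n) a b) + scale (of_nat (Suc n)) (nprod n a b)"
  by (simp add: nprod_def lprod_del_right coeff_map_poly scale_right_distrib algebra_simps del: of_nat_Suc)

end

context assoc_conformal_algebra
begin

lemma coeff_lprod_assoc:
  "coeff (lprod a (coeff (lprod b c) s)) r =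
     (\<Sum>i\<le>r. scale (of_nat ((r + s - i) choose s)) (coeff (lprod (coeff (lprod a b) i) c) (r + s - i)))"
proof -
  have "coeff (lprod a (coeff (lprod b c) s)) r = coeff (coeff (map_poly (lprod a) (lprod b c)) s) r"
    by (simp add: coeff_map_poly)
  also have "\<dots> = (\<Sum>i\<le>r. scale (of_nat ((r + s - i) choose s))
      (coeff (lprod (coeff (lprod a b) i) c) (r + s - i)))"
    unfolding lprod_assoc by (rule coeff_assoc_rhs) simp
  finally show ?thesis .
qed

lemma nprod_assoc:
  "nprod m a (nprod n b c) = (\<Sum>i\<le>m. scale (of_nat (m choose i)) (nprod (m + n - i) (nprod i a b) c))"
proof -
  have "nprod m a (nprod n b c) = scale (fact m * fact n) (coeff (lprod a (coeff (lprod b c) n)) m)"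
    by (simp add: nprod_def[of n b c] nprod_scale_right nprod_def[of m] mult.commute)
  also have "\<dots> = (\<Sum>i\<le>m. scale (fact m * fact n * of_nat ((m + n - i) choose n))
      (coeff (lprod (coeff (lprod a b) i) c) (m + n - i)))"
    by (simp add: coeff_lprod_assoc scale_sum_right)
  also have "\<dots> = (\<Sum>i\<le>m. scale (of_nat (m choose i)) (nprod (m + n - i) (nprod i a b) c))"
  proof (rule sum.cong)
    fix i assume "i \<in> {..m}"
    then have i: "i \<le> m" by simp
    have "m + n - i - n = m - i" using i by simp
    then have "(fact m * fact n * of_nat ((m + n - i) choose n) :: 'k) =
          of_nat (m choose i) * fact i * fact (m + n - i)"
      using i by (simp add: binomial_fact)
    then show "scale (fact m * fact n * of_nat ((m + n - i) choose n))
      (coeff (lprod (coeff (lprod a b) i) c) (m + n - i)) =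
      scale (of_nat (m choose i)) (nprod (m + n - i) (nprod i a b) c)"
      by (simp add: nprod_def[of i] nprod_scale_left nprod_def[of "m + n - i"] mult.assoc)
  qed simp
  finally show ?thesis .
qed

end


section \<open>Hochschild cohomology with trivial coefficients\<close>

subsection \<open>Polynomials in several variables\<close>

type_synonym 'k mpoly = "(nat \<Rightarrow>\<^sub>0 nat) \<Rightarrow>\<^sub>0 'k"

definition mconst :: "'k::comm_ring_1 \<Rightarrow> 'k mpoly" where
  "mconst r = Poly_Mapping.single 0 r"

definition mvar :: "nat \<Rightarrow> 'k::comm_ring_1 mpoly" where
  "mvar i = Poly_Mapping.single (Poly_Mapping.single i 1) 1"

definition mvars :: "'k::zero mpoly \<Rightarrow> nat set" where
  "mvars p = (\<Union>m\<in>Poly_Mapping.keys p. Poly_Mapping.keys m)"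

text \<open>\<^term>\<open>msubst f p\<close> substitutes \<^term>\<open>f k\<close> for the variable \<^term>\<open>mvar k\<close> in \<^term>\<open>p\<close>.\<close>

definition msubst :: "(nat \<Rightarrow> 'k::comm_ring_1 mpoly) \<Rightarrow> 'k mpoly \<Rightarrow> 'k mpoly" where
  "msubst f p = (\<Sum>m\<in>Poly_Mapping.keys p. mconst (Poly_Mapping.lookup p m) *
     (\<Prod>k\<in>Poly_Mapping.keys m. f k ^ Poly_Mapping.lookup m k))"

definition mmono :: "(nat \<Rightarrow> 'k::comm_ring_1 mpoly) \<Rightarrow> (nat \<Rightarrow>\<^sub>0 nat) \<Rightarrow> 'k mpoly" where
  "mmono f m = (\<Prod>k\<in>Poly_Mapping.keys m. f k ^ Poly_Mapping.lookup m k)"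

lemma mconst_simps [simp]: "mconst 0 = 0" "mconst 1 = 1" "mconst (r + s) = mconst r + mconst s"
  "mconst (r * s) = mconst r * mconst s"
  by (simp_all add: mconst_def single_add mult_single)

lemma mmono_superset:
  assumes "finite A" "Poly_Mapping.keys m \<subseteq> A"
  shows "mmono f m = (\<Prod>k\<in>A. f k ^ Poly_Mapping.lookup m k)"
  unfolding mmono_def using assms by (intro prod.mono_neutral_left) (auto simp: in_keys_iff)

lemma mmono_add: "mmono f (m + m') = mmono f m * mmono f m'"
proof -
  let ?A = "Poly_Mapping.keys m \<union> Poly_Mapping.keys m'"
  have "mmono f (m + m') = (\<Prod>k\<in>?A. f k ^ Poly_Mapping.lookup (m + m') k)"
    by (rule mmono_superset) (use Poly_Mapping.keys_add[of m m'] in auto)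
  also have "\<dots> = (\<Prod>k\<in>?A. f k ^ Poly_Mapping.lookup m k) * (\<Prod>k\<in>?A. f k ^ Poly_Mapping.lookup m' k)"
    by (simp add: lookup_add power_add prod.distrib)
  also have "\<dots> = mmono f m * mmono f m'"
    by (simp add: mmono_superset[of ?A])
  finally show ?thesis .
qed

lemma msubst_superset:
  assumes "finite A" "Poly_Mapping.keys p \<subseteq> A"
  shows "msubst f p = (\<Sum>m\<in>A. mconst (Poly_Mapping.lookup p m) * mmono f m)"
  unfolding msubst_def mmono_def[symmetric] using assms
  by (intro sum.mono_neutral_left) (auto simp: in_keys_iff)

lemma msubst_0 [simp]: "msubst f 0 = 0"
  by (simp add: msubst_def)

lemma msubst_add [simp]: "msubst f (p + q) = msubst f p + msubst f q"
proof -
  let ?A = "Poly_Mapping.keys p \<union> Poly_Mapping.keys q"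
  have "Poly_Mapping.keys (p + q) \<subseteq> ?A" by (rule Poly_Mapping.keys_add)
  then show ?thesis
    by (simp add: msubst_superset[of ?A] lookup_add distrib_right sum.distrib)
qed

lemma msubst_sum [simp]: "msubst f (sum g A) = (\<Sum>a\<in>A. msubst f (g a))"
  by (induction A rule: infinite_finite_induct) auto

lemma msubst_single: "msubst f (Poly_Mapping.single m c) = mconst c * mmono f m"
  by (cases "c = 0") (simp_all add: msubst_def mmono_def)

lemma mpoly_expand:
  "(p :: 'k::comm_ring_1 mpoly) = (\<Sum>m\<in>Poly_Mapping.keys p. Poly_Mapping.single m (Poly_Mapping.lookup p m))"
  by (rule poly_mapping_eqI)
    (auto simp: lookup_sum lookup_single when_def in_keys_iff sum.delta)

lemma msubst_mult [simp]: "msubst f (p * q) = msubst f p * msubst f q"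
proof -
  have single: "msubst f (Poly_Mapping.single m c * Poly_Mapping.single m' c') =
      msubst f (Poly_Mapping.single m c) * msubst f (Poly_Mapping.single m' c')" for m c m' c'
    by (simp add: mult_single msubst_single mmono_add ac_simps)
  have "msubst f (p * q) = msubst f
     ((\<Sum>m\<in>Poly_Mapping.keys p. Poly_Mapping.single m (Poly_Mapping.lookup p m)) *
      (\<Sum>m\<in>Poly_Mapping.keys q. Poly_Mapping.single m (Poly_Mapping.lookup q m)))"
    using mpoly_expand[of p] mpoly_expand[of q] by simp
  also have "\<dots> = msubst f (\<Sum>m\<in>Poly_Mapping.keys p. Poly_Mapping.single m (Poly_Mapping.lookup p m)) *
      msubst f (\<Sum>m\<in>Poly_Mapping.keys q. Poly_Mapping.single m (Poly_Mapping.lookup q m))"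
    by (simp only: sum_product msubst_sum single)
  finally show ?thesis
    using mpoly_expand[of p] mpoly_expand[of q] by simp
qed

lemma msubst_mconst [simp]: "msubst f (mconst c) = mconst c"
  by (simp add: mconst_def msubst_single mmono_def)

lemma msubst_1 [simp]: "msubst f 1 = 1"
  using msubst_mconst[of f 1] by simp

lemma msubst_mvar [simp]: "msubst f (mvar i) = f i"
  by (simp add: mvar_def msubst_single mmono_def)

lemma msubst_uminus [simp]: "msubst f (- p) = - msubst f p"
  by (metis add.right_inverse msubst_0 msubst_add neg_eq_iff_add_eq_0)

lemma msubst_power [simp]: "msubst f (p ^ n) = msubst f p ^ n"
  by (induction n) simp_all

lemma msubst_prod: "msubst f (prod g A) = (\<Prod>a\<in>A. msubst f (g a))"
  by (induction A rule: infinite_finite_induct) auto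

lemma msubst_msubst: "msubst g (msubst f p) = msubst (\<lambda>k. msubst g (f k)) p"
  by (simp add: msubst_def[of f] msubst_def[of "\<lambda>k. msubst g (f k)"] msubst_prod)

lemma mvars_0 [simp]: "mvars 0 = {}"
  by (simp add: mvars_def)

lemma mvars_1 [simp]: "mvars (1 :: 'k::comm_ring_1 mpoly) = {}"
  by (auto simp: mvars_def dest!: Poly_Mapping.keys_one[THEN equalityD1, THEN subsetD] split: if_splits)

lemma mvars_mconst [simp]: "mvars (mconst c) = {}"
  by (simp add: mvars_def mconst_def)

lemma mvars_mvar: "mvars (mvar i) \<subseteq> {i}"
  by (auto simp: mvars_def mvar_def split: if_splits)

lemma mvars_add: "mvars (p + q) \<subseteq> mvars p \<union> mvars q"
  unfolding mvars_def using Poly_Mapping.keys_add[of p q] by blast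

lemma mvars_uminus [simp]: "mvars (- p) = mvars (p :: 'k::comm_ring_1 mpoly)"
  by (auto simp: mvars_def in_keys_iff)

lemma mvars_mult: "mvars (p * q) \<subseteq> mvars p \<union> mvars (q :: 'k::comm_ring_1 mpoly)"
proof
  fix k assume "k \<in> mvars (p * q)"
  then obtain m where "m \<in> Poly_Mapping.keys (p * q)" and k: "k \<in> Poly_Mapping.keys m"
    by (auto simp: mvars_def)
  then obtain a b where "a \<in> Poly_Mapping.keys p" "b \<in> Poly_Mapping.keys q" "m = a + b"
    using Poly_Mapping.keys_mult[of p q] by blast
  then show "k \<in> mvars p \<union> mvars q"
    using k Poly_Mapping.keys_add[of a b] by (auto simp: mvars_def)
qed

lemma mvars_sum_le: "(\<And>a. a \<in> A \<Longrightarrow> mvars (g a) \<subseteq> V) \<Longrightarrow> mvars (sum g A) \<subseteq> V"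
proof (induction A rule: infinite_finite_induct)
  case (insert x F)
  then have "mvars (g x) \<subseteq> V" "mvars (sum g F) \<subseteq> V" by auto
  then show ?case using insert(1,2) mvars_add[of "g x" "sum g F"] by auto
qed auto

lemma mvars_mult_le: "mvars p \<subseteq> V \<Longrightarrow> mvars q \<subseteq> V \<Longrightarrow> mvars (p * q :: 'k::comm_ring_1 mpoly) \<subseteq> V"
  using mvars_mult[of p q] by blast

lemma mvars_power_le: "mvars p \<subseteq> V \<Longrightarrow> mvars (p ^ n :: 'k::comm_ring_1 mpoly) \<subseteq> V"
  by (induction n) (simp_all add: mvars_mult_le)

lemma mvars_prod_le:
  "(\<And>a. a \<in> A \<Longrightarrow> mvars (g a) \<subseteq> V) \<Longrightarrow> mvars (prod g A :: 'k::comm_ring_1 mpoly) \<subseteq> V"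
  by (induction A rule: infinite_finite_induct) (simp_all add: mvars_mult_le)

lemma mvars_msubst_le:
  assumes "\<And>k. k \<in> mvars p \<Longrightarrow> mvars (f k) \<subseteq> V"
  shows "mvars (msubst f p) \<subseteq> V"
  unfolding msubst_def
  by (intro mvars_sum_le mvars_mult_le mvars_prod_le mvars_power_le)
    (use assms in \<open>auto simp: mvars_def mconst_def split: if_splits\<close>)

lemma msubst_cong: "(\<And>k. k \<in> mvars p \<Longrightarrow> f k = g k) \<Longrightarrow> msubst f p = msubst g p"
  unfolding msubst_def by (intro sum.cong prod.cong refl arg_cong2[where f = "(*)"]) (fastforce simp: mvars_def)


subsection \<open>The complex\<close>

text \<open>
  Indices start from \<open>0\<close>: an element \<open>a\<^sub>1 \<otimes> \<dots> \<otimes> a\<^sub>n\<close> is a list whose entry \<open>i\<close> is \<open>a\<^sub>i\<^sub>+\<^sub>1\<close>, and the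
  variable \<open>\<lambda>\<^sub>i\<^sub>+\<^sub>1\<close> is \<^term>\<open>mvar i\<close>. A linear map on \<open>C\<^sup>\<otimes>\<^sup>n\<close> is given as a multilinear function on
  lists of length \<open>n\<close>, extended by \<open>0\<close> to lists of other lengths.
\<close>

text \<open>
  The tuple \<open>(\<lambda>\<^sub>1,\<dots>,\<lambda>\<^sub>i + \<lambda>\<^sub>i\<^sub>+\<^sub>1,\<dots>,\<lambda>\<^sub>n)\<close>. For \<open>i = n\<close> the cochain depends on the
  first \<open>n - 1\<close> variables only, all of which are left unchanged, as required.
\<close>

definition merge_vars :: "nat \<Rightarrow> nat \<Rightarrow> 'k::comm_ring_1 mpoly" where
  "merge_vars i k = (if k < i then mvar k else if k = i then mvar i + mvar (Suc i) else mvar (Suc k))"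

definition merge_args :: "nat \<Rightarrow> 'c \<Rightarrow> 'c list \<Rightarrow> 'c list" where
  "merge_args i x xs = take i xs @ x # drop (i + 2) xs"

text \<open>For \<open>p = \<Sum>\<^sub>j \<lambda>\<^sup>j x\<^sub>j \<in> C[\<lambda>]\<close>, the value \<open>\<Sum>\<^sub>j z\<^sup>j F(x\<^sub>j)\<close> of the extension of \<open>F\<close> to \<open>C[\<lambda>]\<close> at \<open>\<lambda> = z\<close>.\<close>

definition extend_eval :: "('c::zero \<Rightarrow> 'r::comm_ring_1) \<Rightarrow> 'r \<Rightarrow> 'c poly \<Rightarrow> 'r" where
  "extend_eval F z p = (\<Sum>j\<le>degree p. z ^ j * F (coeff p j))"

context conformal_algebra
begin

definition cochains :: "nat \<Rightarrow> ('c list \<Rightarrow> 'k mpoly) set" where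
  "cochains n = {\<phi>.
     (\<forall>xs. length xs \<noteq> n \<longrightarrow> \<phi> xs = 0) \<and>
     (\<forall>xs. mvars (\<phi> xs) \<subseteq> {..<n - 1}) \<and>
     (\<forall>xs i x y. length xs = n \<and> i < n \<longrightarrow>
        \<phi> (xs[i := x + y]) = \<phi> (xs[i := x]) + \<phi> (xs[i := y])) \<and>
     (\<forall>xs i r x. length xs = n \<and> i < n \<longrightarrow>
        \<phi> (xs[i := scale r x]) = mconst r * \<phi> (xs[i := x])) \<and>
     (\<forall>xs i x. length xs = n \<and> i + 1 < n \<longrightarrow>
        \<phi> (xs[i := del x]) = - mvar i * \<phi> (xs[i := x])) \<and>
     (\<forall>xs i x. length xs = n \<and> i + 1 = n \<longrightarrow>
        \<phi> (xs[i := del x]) = (\<Sum>j<n - 1. mvar j) * \<phi> (xs[i := x]))}"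

definition coface :: "nat \<Rightarrow> ('c list \<Rightarrow> 'k mpoly) \<Rightarrow> 'c list \<Rightarrow> 'k mpoly" where
  "coface i \<phi> xs = extend_eval (\<lambda>x. msubst (merge_vars i) (\<phi> (merge_args i x xs))) (mvar i)
     (lprod (xs ! i) (xs ! Suc i))"

text \<open>The differential \<open>C\<^sup>n \<rightarrow> C\<^sup>n\<^sup>+\<^sup>1\<close>; the sign is \<open>(-1)\<^sup>i\<close> for \<open>i\<close> counted from \<open>1\<close>. It is zero on \<open>C\<^sup>0\<close>.\<close>

definition differential :: "nat \<Rightarrow> ('c list \<Rightarrow> 'k mpoly) \<Rightarrow> 'c list \<Rightarrow> 'k mpoly" where
  "differential n \<phi> xs =
     (if length xs = Suc n then \<Sum>i<n. (-1) ^ Suc i * coface i \<phi> xs else 0)"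

definition cocycles :: "nat \<Rightarrow> ('c list \<Rightarrow> 'k mpoly) set" where
  "cocycles n = {\<phi> \<in> cochains n. differential n \<phi> = (\<lambda>_. 0)}"

definition coboundaries :: "nat \<Rightarrow> ('c list \<Rightarrow> 'k mpoly) set" where
  "coboundaries n = (case n of 0 \<Rightarrow> {\<lambda>_. 0} | Suc m \<Rightarrow> differential m ` cochains m)"

definition cohomologous :: "nat \<Rightarrow> (('c list \<Rightarrow> 'k mpoly) \<times> ('c list \<Rightarrow> 'k mpoly)) set" where
  "cohomologous n = {(\<phi>, \<psi>). \<phi> \<in> cocycles n \<and> \<psi> \<in> cocycles n \<and> (\<lambda>xs. \<phi> xs - \<psi> xs) \<in> coboundaries n}"

text \<open>
  \<open>H\<^sup>n\<close> is the set of cosets of \<open>B\<^sup>n\<close> in \<open>Z\<^sup>n\<close>. Its zero is the coset \<open>B\<^sup>n\<close> itself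
  (lemma \<open>zero_class\<close> below), so \<open>H\<^sup>n = 0\<close> reads \<^term>\<open>cohomology n = {coboundaries n}\<close>.
\<close>

definition cohomology :: "nat \<Rightarrow> ('c list \<Rightarrow> 'k mpoly) set set" where
  "cohomology n = cocycles n // cohomologous n"

end


subsection \<open>The complex is well defined\<close>

lemma extend_eval_superset:
  assumes "F 0 = 0" "degree p \<le> N"
  shows "extend_eval F z p = (\<Sum>j\<le>N. z ^ j * F (coeff p j))"
  unfolding extend_eval_def using assms
  by (intro sum.mono_neutral_left) (auto simp: coeff_eq_0)

lemma extend_eval_0 [simp]: "F 0 = 0 \<Longrightarrow> extend_eval F z 0 = 0"
  by (simp add: extend_eval_def)

lemma extend_eval_add:
  fixes F :: "'c::ab_group_add \<Rightarrow> 'r::comm_ring_1"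
  assumes "\<And>x y. F (x + y) = F x + F y"
  shows "extend_eval F z (p + q) = extend_eval F z p + extend_eval F z q"
proof -
  have F0: "F 0 = 0" using assms[of 0 0] by simp
  let ?N = "max (degree p) (degree q)"
  have "degree (p + q) \<le> ?N" by (rule degree_add_le_max)
  then show ?thesis
    by (simp add: extend_eval_superset[where N = ?N and F = F, OF F0] assms distrib_left sum.distrib)
qed

lemma extend_eval_uminus:
  fixes F :: "'c::ab_group_add \<Rightarrow> 'r::comm_ring_1"
  assumes "\<And>x y. F (x + y) = F x + F y"
  shows "extend_eval F z (- p) = - extend_eval F z p"
  using extend_eval_add[of F z p "- p"] assms assms[of 0 0]
  by (simp add: add_eq_0_iff)

lemma extend_eval_map_poly:
  assumes "F 0 = 0" "g 0 = 0"
  shows "extend_eval F z (map_poly g p) = extend_eval (\<lambda>x. F (g x)) z p"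
proof -
  have "degree (map_poly g p) \<le> degree p"
    by (rule degree_le) (simp add: coeff_map_poly assms coeff_eq_0)
  then have "extend_eval F z (map_poly g p) = (\<Sum>j\<le>degree p. z ^ j * F (coeff (map_poly g p) j))"
    by (rule extend_eval_superset[where F = F, OF assms(1)])
  then show ?thesis by (simp add: extend_eval_def coeff_map_poly assms)
qed

lemma extend_eval_pCons:
  assumes "F 0 = 0"
  shows "extend_eval F z (pCons a p) = F a + z * extend_eval F z p"
proof -
  have "extend_eval F z (pCons a p) = (\<Sum>j\<le>Suc (degree p). z ^ j * F (coeff (pCons a p) j))"
    by (rule extend_eval_superset[where F = F, OF assms]) (rule degree_pCons_le)
  also have "\<dots> = F a + (\<Sum>j\<le>degree p. z ^ Suc j * F (coeff p j))"
    by (subst sum.atMost_Suc_shift) simp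
  finally show ?thesis by (simp add: extend_eval_def sum_distrib_left mult.assoc)
qed

lemma extend_eval_mult: "extend_eval (\<lambda>x. c * F x) z p = c * extend_eval F z p"
  by (simp add: extend_eval_def sum_distrib_left mult.left_commute)

lemma extend_eval_plus:
  "extend_eval (\<lambda>x. F x + G x) z p = extend_eval F z p + extend_eval G z p"
  by (simp add: extend_eval_def distrib_left sum.distrib)

lemma extend_eval_sum: "extend_eval (\<lambda>x. \<Sum>k\<in>A. F k x) z p = (\<Sum>k\<in>A. extend_eval (F k) z p)"
  by (simp add: extend_eval_def sum_distrib_left sum.swap[of _ A])

lemma extend_eval_swap:
  "extend_eval (\<lambda>x. extend_eval (\<lambda>y. G x y) w q) z p = extend_eval (\<lambda>y. extend_eval (\<lambda>x. G x y) z p) w q"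
proof -
  have "extend_eval (\<lambda>x. extend_eval (\<lambda>y. G x y) w q) z p =
      (\<Sum>j\<le>degree p. \<Sum>l\<le>degree q. z ^ j * (w ^ l * G (coeff p j) (coeff q l)))"
    by (simp add: extend_eval_def sum_distrib_left)
  also have "\<dots> = (\<Sum>l\<le>degree q. \<Sum>j\<le>degree p. w ^ l * (z ^ j * G (coeff p j) (coeff q l)))"
    by (subst sum.swap) (simp add: mult.left_commute)
  finally show ?thesis by (simp add: extend_eval_def sum_distrib_left)
qed

lemma msubst_extend_eval:
  "msubst f (extend_eval F z p) = extend_eval (\<lambda>x. msubst f (F x)) (msubst f z) p"
  by (simp add: extend_eval_def)

lemma mvars_extend_eval_le:
  assumes "mvars z \<subseteq> V" "\<And>x. mvars (F x) \<subseteq> V"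
  shows "mvars (extend_eval F z p) \<subseteq> V"
  unfolding extend_eval_def using assms by (intro mvars_sum_le mvars_mult_le mvars_power_le) auto

context
  fixes F :: "'c::ab_group_add \<Rightarrow> 'r::comm_ring_1"
  assumes F_add: "F (x + y) = F x + F y"
begin

lemma additive_0: "F 0 = 0"
  using F_add[of 0 0] by simp

lemma extend_eval2_add:
  "extend_eval (extend_eval F z) w (p + q) = extend_eval (extend_eval F z) w p + extend_eval (extend_eval F z) w q"
  by (rule extend_eval_add) (rule extend_eval_add, rule F_add)

lemma extend_eval2_sum:
  "extend_eval (extend_eval F z) w (sum f A) = (\<Sum>a\<in>A. extend_eval (extend_eval F z) w (f a))"
  by (induction A rule: infinite_finite_induct) (simp_all add: extend_eval2_add additive_0)

lemma extend_eval2_times_lam: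
  "extend_eval (extend_eval F z) w (map_poly (pCons 0) q) = z * extend_eval (extend_eval F z) w q"
  by (simp add: extend_eval_map_poly additive_0 extend_eval_pCons extend_eval_mult)

lemma extend_eval2_times_lam_power:
  "extend_eval (extend_eval F z) w ((map_poly (pCons 0) ^^ i) q) = z ^ i * extend_eval (extend_eval F z) w q"
  by (induction i) (simp_all add: extend_eval2_times_lam mult.assoc)

lemma extend_eval2_times_lam_plus_mu:
  "extend_eval (extend_eval F z) w (times_lam_plus_mu q) = (z + w) * extend_eval (extend_eval F z) w q"
  by (simp add: times_lam_plus_mu_def extend_eval2_add extend_eval2_times_lam extend_eval_pCons additive_0 distrib_right)

lemma extend_eval2_times_lam_plus_mu_power:
  "extend_eval (extend_eval F z) w ((times_lam_plus_mu ^^ m) q) = (z + w) ^ m * extend_eval (extend_eval F z) w q"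
  by (induction m) (simp_all add: extend_eval2_times_lam_plus_mu mult.assoc)

lemma extend_eval2_subst:
  "extend_eval (extend_eval F z) w (subst_lam_plus_mu p) = extend_eval F (z + w) p"
  by (simp add: subst_lam_plus_mu_def extend_eval2_sum extend_eval2_times_lam_plus_mu_power
      extend_eval_pCons additive_0 extend_eval_def[of F "z + w"])

end

lemma (in assoc_conformal_algebra) extend_eval_assoc:
  fixes F :: "'c \<Rightarrow> 'r::comm_ring_1"
  assumes "\<And>x y. F (x + y) = F x + F y"
  shows "extend_eval (\<lambda>x. extend_eval F z (lprod a x)) w (lprod b c) =
         extend_eval (\<lambda>x. extend_eval F (z + w) (lprod x c)) z (lprod a b)"
proof -
  have F0: "F 0 = 0" using assms[of 0 0] by simp
  have "extend_eval (\<lambda>x. extend_eval F z (lprod a x)) w (lprod b c) =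
      extend_eval (extend_eval F z) w (map_poly (lprod a) (lprod b c))"
    by (simp add: extend_eval_map_poly F0)
  also have "\<dots> = extend_eval (\<lambda>x. extend_eval F (z + w) (lprod x c)) z (lprod a b)"
    by (simp add: lprod_assoc extend_eval2_sum[OF assms] extend_eval2_times_lam_power[OF assms]
        extend_eval2_subst[OF assms] extend_eval_def[of _ _ "lprod a b"])
  finally show ?thesis .
qed

lemma length_merge_args [simp]: "Suc i < length xs \<Longrightarrow> length (merge_args i x xs) = length xs - 1"
  by (simp add: merge_args_def)

lemma nth_merge_args:
  assumes "Suc i < length xs" "m < length xs - 1"
  shows "merge_args i x xs ! m = (if m < i then xs ! m else if m = i then x else xs ! Suc m)"
proof (cases "m \<le> i")
  case True
  then show ?thesis using assms by (auto simp: merge_args_def nth_append)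
next
  case False
  then obtain d where "m = Suc (i + d)" by (auto simp: not_le less_iff_Suc_add)
  then show ?thesis using assms by (simp add: merge_args_def nth_append min_def)
qed

lemma merge_args_update:
  assumes "Suc i < length xs" "p < length xs"
  shows "merge_args i x (xs[p := y]) =
    (if p < i then (merge_args i x xs)[p := y]
     else if p \<le> Suc i then merge_args i x xs
     else (merge_args i x xs)[p - 1 := y])"
  by (rule nth_equalityI) (use assms in \<open>auto simp: nth_merge_args nth_list_update\<close>)

lemma merge_args_value:
  assumes "Suc i < length xs"
  shows "merge_args i x xs = (merge_args i 0 xs)[i := x]"
  by (rule nth_equalityI) (use assms in \<open>auto simp: nth_merge_args nth_list_update\<close>)

lemma merge_args_merge_args:
  assumes "i < k" "Suc (Suc k) < length xs"
  shows "merge_args k y (merge_args i x xs) = merge_args i x (merge_args (Suc k) y xs)"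
  by (rule nth_equalityI) (use assms in \<open>auto simp: nth_merge_args\<close>)

lemma merge_args_merge_args_same:
  assumes "Suc (Suc i) < length xs"
  shows "merge_args i y (merge_args i x xs) = take i xs @ y # drop (i + 3) xs"
    "merge_args i y (merge_args (Suc i) x xs) = take i xs @ y # drop (i + 3) xs"
  using assms by (simp_all add: merge_args_def min_def numeral_3_eq_3 take_Suc_conv_app_nth)

lemma merge_vars_merge_vars:
  assumes "i \<le> k"
  shows "msubst (merge_vars i) (msubst (merge_vars k) p) =
    msubst (merge_vars (Suc k)) (msubst (merge_vars i) p)"
  unfolding msubst_msubst
  by (rule msubst_cong) (use assms in \<open>auto simp: merge_vars_def add.assoc\<close>)

lemma sum_merge_vars:
  "(\<Sum>j<m. merge_vars i j) = (if i < m then \<Sum>j<Suc m. mvar j else \<Sum>j<m. mvar j)"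
  by (induction m) (auto simp: merge_vars_def less_Suc_eq)

lemma mvars_merge_vars:
  assumes "i < n" "k < n - 1"
  shows "mvars (merge_vars i k :: 'k::comm_ring_1 mpoly) \<subseteq> {..<n}"
proof -
  have "mvars (mvar j :: 'k mpoly) \<subseteq> {..<n}" if "j < n" for j
    using mvars_mvar[of j, where 'a = 'k] that by auto
  moreover from this[of k] this[of "Suc k"] have "mvars (mvar k + mvar (Suc k) :: 'k mpoly) \<subseteq> {..<n}"
    using mvars_add[of "mvar k :: 'k mpoly" "mvar (Suc k)"] assms
    by (intro order.trans[OF mvars_add] Un_least) simp_all
  ultimately show ?thesis using assms by (cases "k = i") (simp_all add: merge_vars_def)
qed

context conformal_algebra
begin

lemma
  assumes "\<phi> \<in> cochains n"
  shows cochain_length: "length xs \<noteq> n \<Longrightarrow> \<phi> xs = 0"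
    and cochain_mvars: "mvars (\<phi> xs) \<subseteq> {..<n - 1}"
    and cochain_add: "length xs = n \<Longrightarrow> i < n \<Longrightarrow> \<phi> (xs[i := x + y]) = \<phi> (xs[i := x]) + \<phi> (xs[i := y])"
    and cochain_scale: "length xs = n \<Longrightarrow> i < n \<Longrightarrow> \<phi> (xs[i := scale r x]) = mconst r * \<phi> (xs[i := x])"
    and cochain_del: "length xs = n \<Longrightarrow> Suc i < n \<Longrightarrow> \<phi> (xs[i := del x]) = - mvar i * \<phi> (xs[i := x])"
    and cochain_del_last: "length xs = n \<Longrightarrow> Suc i = n \<Longrightarrow>
      \<phi> (xs[i := del x]) = (\<Sum>j<n - 1. mvar j) * \<phi> (xs[i := x])"
  using assms by (simp_all add: cochains_def)

definition del_factor :: "nat \<Rightarrow> nat \<Rightarrow> 'k mpoly" where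
  "del_factor n i = (if Suc i < n then - mvar i else \<Sum>j<n - 1. mvar j)"

lemma cochain_del_factor:
  "\<phi> \<in> cochains n \<Longrightarrow> length xs = n \<Longrightarrow> i < n \<Longrightarrow> \<phi> (xs[i := del x]) = del_factor n i * \<phi> (xs[i := x])"
  by (cases "Suc i < n") (auto simp: del_factor_def cochain_del cochain_del_last)

lemma cochainsI:
  assumes "\<And>xs. length xs \<noteq> n \<Longrightarrow> \<phi> xs = 0"
    and "\<And>xs. length xs = n \<Longrightarrow> mvars (\<phi> xs) \<subseteq> {..<n - 1}"
    and "\<And>xs i x y. length xs = n \<Longrightarrow> i < n \<Longrightarrow> \<phi> (xs[i := x + y]) = \<phi> (xs[i := x]) + \<phi> (xs[i := y])"
    and "\<And>xs i r x. length xs = n \<Longrightarrow> i < n \<Longrightarrow> \<phi> (xs[i := scale r x]) = mconst r * \<phi> (xs[i := x])"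
    and "\<And>xs i x. length xs = n \<Longrightarrow> i < n \<Longrightarrow> \<phi> (xs[i := del x]) = del_factor n i * \<phi> (xs[i := x])"
  shows "\<phi> \<in> cochains n"
proof -
  have "mvars (\<phi> xs) \<subseteq> {..<n - 1}" for xs
    using assms(1,2)[of xs] by (cases "length xs = n") auto
  then show ?thesis
    using assms(1,3,4) assms(5) by (auto simp: cochains_def del_factor_def)
qed

lemma coface_sum:
  "coface i (\<lambda>xs. \<Sum>k\<in>A. mconst (c k) * \<psi> k xs) xs = (\<Sum>k\<in>A. mconst (c k) * coface i (\<psi> k) xs)"
  by (simp add: coface_def extend_eval_sum extend_eval_mult)

lemma coface_arg:
  assumes "\<phi> \<in> cochains n" "length xs = Suc n" "i < n"
  defines "F \<equiv> \<lambda>x. msubst (merge_vars i) (\<phi> (merge_args i x xs))"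
  shows "F (x + y) = F x + F y" "F (scale r x) = mconst r * F x"
    "F (del x) = msubst (merge_vars i) (del_factor n i) * F x"
proof -
  have len: "length (merge_args i 0 xs) = n" and i: "Suc i < length xs" using assms by auto
  note val = merge_args_value[OF i]
  show "F (x + y) = F x + F y" unfolding F_def
    by (subst (1 2 3) val) (simp add: cochain_add[OF assms(1) len assms(3)])
  show "F (scale r x) = mconst r * F x" unfolding F_def
    by (subst (1 2) val) (simp add: cochain_scale[OF assms(1) len assms(3)])
  show "F (del x) = msubst (merge_vars i) (del_factor n i) * F x" unfolding F_def
    by (subst (1 2) val) (simp add: cochain_del_factor[OF assms(1) len assms(3)])
qed

lemma coface_update_before:
  assumes "length xs = Suc n" "i < n" "p < i"
  shows "coface i \<phi> (xs[p := y]) = extend_eval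
    (\<lambda>x. msubst (merge_vars i) (\<phi> ((merge_args i x xs)[p := y]))) (mvar i) (lprod (xs ! i) (xs ! Suc i))"
  using assms by (simp add: coface_def merge_args_update)

lemma coface_update_after:
  assumes "length xs = Suc n" "i < n" "p > Suc i" "p < Suc n"
  shows "coface i \<phi> (xs[p := y]) = extend_eval
    (\<lambda>x. msubst (merge_vars i) (\<phi> ((merge_args i x xs)[p - 1 := y]))) (mvar i) (lprod (xs ! i) (xs ! Suc i))"
  using assms by (simp add: coface_def merge_args_update)

lemma coface_update_left:
  assumes "length xs = Suc n" "i < n"
  shows "coface i \<phi> (xs[i := y]) = extend_eval
    (\<lambda>x. msubst (merge_vars i) (\<phi> (merge_args i x xs))) (mvar i) (lprod y (xs ! Suc i))"
  using assms by (simp add: coface_def merge_args_update)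

lemma coface_update_right:
  assumes "length xs = Suc n" "i < n"
  shows "coface i \<phi> (xs[Suc i := y]) = extend_eval
    (\<lambda>x. msubst (merge_vars i) (\<phi> (merge_args i x xs))) (mvar i) (lprod (xs ! i) y)"
  using assms by (simp add: coface_def merge_args_update)

lemma coface_cochain_props:
  assumes \<phi>: "\<phi> \<in> cochains n" and len: "length xs = Suc n" and i: "i < n"
  shows coface_mvars: "mvars (coface i \<phi> xs) \<subseteq> {..<n}"
    and coface_add: "p < Suc n \<Longrightarrow>
      coface i \<phi> (xs[p := x + y]) = coface i \<phi> (xs[p := x]) + coface i \<phi> (xs[p := y])"
    and coface_scale: "p < Suc n \<Longrightarrow> coface i \<phi> (xs[p := scale r x]) = mconst r * coface i \<phi> (xs[p := x])"
    and coface_del: "p < Suc n \<Longrightarrow>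
      coface i \<phi> (xs[p := del x]) = del_factor (Suc n) p * coface i \<phi> (xs[p := x])"
proof -
  define F where "F = (\<lambda>x. msubst (merge_vars i) (\<phi> (merge_args i x xs)))"
  have F: "F (x + y) = F x + F y" "F (scale r x) = mconst r * F x"
    "F (del x) = msubst (merge_vars i) (del_factor n i) * F x" for x y r
    unfolding F_def by (rule coface_arg[OF \<phi> len i])+
  have F0: "F 0 = 0" using F(1)[of 0 0] by simp
  have left: "coface i \<phi> (xs[i := y]) = extend_eval F (mvar i) (lprod y (xs ! Suc i))" for y
    unfolding F_def by (rule coface_update_left[OF len i])
  have right: "coface i \<phi> (xs[Suc i := y]) = extend_eval F (mvar i) (lprod (xs ! i) y)" for y
    unfolding F_def by (rule coface_update_right[OF len i])
  have mlen: "length (merge_args i z xs) = n" for z using len i by simp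
  show "mvars (coface i \<phi> xs) \<subseteq> {..<n}"
    unfolding coface_def
  proof (intro mvars_extend_eval_le mvars_msubst_le)
    show "mvars (mvar i :: 'k mpoly) \<subseteq> {..<n}" using mvars_mvar[of i] i by auto
  next
    fix x k assume "k \<in> mvars (\<phi> (merge_args i x xs))"
    then have "k < n - 1" using cochain_mvars[OF \<phi>] by blast
    then show "mvars (merge_vars i k :: 'k mpoly) \<subseteq> {..<n}" by (rule mvars_merge_vars[OF i])
  qed
  assume p: "p < Suc n"
  consider "p < i" | "p = i" | "p = Suc i" | "p > Suc i" by linarith
  note cases = this
  show "coface i \<phi> (xs[p := x + y]) = coface i \<phi> (xs[p := x]) + coface i \<phi> (xs[p := y])"
    using cases
  proof cases
    case 1
    then have "p < n" using i by simp
    with 1 show ?thesis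
      by (simp add: coface_update_before[OF len i] cochain_add[OF \<phi> mlen] extend_eval_plus)
  next
    case 2
    then show ?thesis by (simp add: left lprod_add_left extend_eval_add F(1))
  next
    case 3
    then show ?thesis by (simp add: right lprod_add_right extend_eval_add F(1))
  next
    case 4
    then have "p - 1 < n" using p by simp
    with 4 show ?thesis
      by (simp add: coface_update_after[OF len i _ p] cochain_add[OF \<phi> mlen] extend_eval_plus)
  qed
  show "coface i \<phi> (xs[p := scale r x]) = mconst r * coface i \<phi> (xs[p := x])"
    using cases
  proof cases
    case 1
    then have "p < n" using i by simp
    with 1 show ?thesis
      by (simp add: coface_update_before[OF len i] cochain_scale[OF \<phi> mlen] extend_eval_mult)
  next
    case 2
    then show ?thesis by (simp add: left lprod_scale_left extend_eval_map_poly F0 F(2) extend_eval_mult)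
  next
    case 3
    then show ?thesis by (simp add: right lprod_scale_right extend_eval_map_poly F0 F(2) extend_eval_mult)
  next
    case 4
    then have "p - 1 < n" using p by simp
    with 4 show ?thesis
      by (simp add: coface_update_after[OF len i _ p] cochain_scale[OF \<phi> mlen] extend_eval_mult)
  qed
  show "coface i \<phi> (xs[p := del x]) = del_factor (Suc n) p * coface i \<phi> (xs[p := x])"
    using cases
  proof cases
    case 1
    then have pn: "p < n" using i by simp
    have "msubst (merge_vars i) (del_factor n p) = del_factor (Suc n) p"
      using 1 i by (simp add: del_factor_def merge_vars_def)
    with 1 pn show ?thesis
      by (simp add: coface_update_before[OF len i] cochain_del_factor[OF \<phi> mlen] extend_eval_mult)
  next
    case 2
    then show ?thesis using i
      by (simp add: left lprod_del_left extend_eval_uminus F(1) extend_eval_pCons F0 del_factor_def)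
  next
    case 3
    have "msubst (merge_vars i) (del_factor n i) + mvar i = del_factor (Suc n) (Suc i)"
    proof (cases "Suc i < n")
      case True
      then show ?thesis by (simp add: del_factor_def merge_vars_def)
    next
      case False
      then have "n = Suc i" using i by simp
      then show ?thesis by (simp add: del_factor_def sum_merge_vars)
    qed
    moreover have "coface i \<phi> (xs[p := del x]) =
        (msubst (merge_vars i) (del_factor n i) + mvar i) * coface i \<phi> (xs[p := x])"
      using 3 by (simp add: right lprod_del_right extend_eval_add F extend_eval_map_poly F0
          extend_eval_mult extend_eval_pCons distrib_right)
    ultimately show ?thesis using 3 by simp
  next
    case 4
    then have pn: "p - 1 < n" using p by simp
    have "msubst (merge_vars i) (del_factor n (p - 1)) = del_factor (Suc n) p"
    proof (cases "p < n")
      case True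
      moreover obtain q where "p = Suc q" using 4 by (cases p) auto
      ultimately show ?thesis using 4 by (simp add: del_factor_def merge_vars_def)
    next
      case False
      then have "p = n" using p by simp
      then show ?thesis using 4 by (simp add: del_factor_def sum_merge_vars less_diff_conv)
    qed
    with 4 pn show ?thesis
      by (simp add: coface_update_after[OF len i _ p] cochain_del_factor[OF \<phi> mlen] extend_eval_mult)
  qed
qed

lemma differential_mconst:
  "differential n \<phi> xs = (if length xs = Suc n then \<Sum>i<n. mconst ((-1) ^ Suc i) * coface i \<phi> xs else 0)"
proof -
  have "(-1) ^ i = mconst ((-1) ^ i :: 'k)" for i
  proof (induction i)
    case (Suc i)
    have "mconst (-1 :: 'k) = -1" by (simp add: mconst_def single_uminus)
    then show ?case using Suc by (simp only: power_Suc mconst_simps)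
  qed simp
  then show ?thesis by (simp only: differential_def)
qed

theorem differential_cochain:
  assumes \<phi>: "\<phi> \<in> cochains n"
  shows "differential n \<phi> \<in> cochains (Suc n)"
proof (rule cochainsI)
  fix xs :: "'c list" assume "length xs \<noteq> Suc n"
  then show "differential n \<phi> xs = 0" by (simp add: differential_def)
next
  fix xs :: "'c list" assume "length xs = Suc n"
  then show "mvars (differential n \<phi> xs) \<subseteq> {..<Suc n - 1}"
    by (simp add: differential_mconst del: power_Suc)
      (intro mvars_sum_le mvars_mult_le coface_mvars[OF \<phi>]; simp del: power_Suc)
qed (simp_all add: differential_mconst coface_add[OF \<phi>] coface_scale[OF \<phi>] coface_del[OF \<phi>]
    distrib_left sum.distrib sum_distrib_left mult.left_commute del: power_Suc)

end

context assoc_conformal_algebra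
begin

lemma coface_coface:
  assumes \<phi>: "\<phi> \<in> cochains n" and len: "length xs = Suc (Suc n)" and k: "k < n" and ik: "i \<le> k"
  shows "coface i (coface k \<phi>) xs = coface (Suc k) (coface i \<phi>) xs"
proof (cases "i = k")
  case False
  then have ik: "i < k" using ik by simp
  have nths: "merge_args i x xs ! k = xs ! Suc k" "merge_args i x xs ! Suc k = xs ! Suc (Suc k)"
    "merge_args (Suc k) x xs ! i = xs ! i" "merge_args (Suc k) x xs ! Suc i = xs ! Suc i" for x
    using ik k len by (auto simp: nth_merge_args)
  have args: "merge_args k y (merge_args i x xs) = merge_args i x (merge_args (Suc k) y xs)" for x y
    by (rule merge_args_merge_args) (use ik k len in auto)
  have vars: "merge_vars i k = (mvar (Suc k) :: 'k mpoly)" "merge_vars (Suc k) i = (mvar i :: 'k mpoly)"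
    using ik by (auto simp: merge_vars_def)
  show ?thesis
    unfolding coface_def msubst_extend_eval nths args msubst_mvar vars
      merge_vars_merge_vars[OF less_imp_le[OF ik]]
    by (rule extend_eval_swap)
next
  case True
  have nths: "merge_args i x xs ! i = x" "merge_args i x xs ! Suc i = xs ! Suc (Suc i)"
    "merge_args (Suc i) x xs ! i = xs ! i" "merge_args (Suc i) x xs ! Suc i = x" for x
    using True k len by (auto simp: nth_merge_args)
  have len': "Suc (Suc i) < length xs" using True k len by simp
  note args = merge_args_merge_args_same[OF len']
  define F where "F y = msubst (merge_vars (Suc i)) (msubst (merge_vars i) (\<phi> (take i xs @ y # drop (i + 3) xs)))"
    for y
  have mlen: "length (merge_args (Suc i) 0 xs) = Suc n" and i_less: "i < n" using True k len by simp_all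
  have F_add: "F (x + y) = F x + F y" for x y
    using coface_arg(1)[OF \<phi> mlen i_less, of x y] by (simp add: F_def args)
  have vars: "merge_vars i i = (mvar i + mvar (Suc i) :: 'k mpoly)" "merge_vars (Suc i) i = (mvar i :: 'k mpoly)"
    by (auto simp: merge_vars_def)
  show ?thesis
    unfolding True[symmetric] coface_def msubst_extend_eval nths args msubst_mvar vars
      merge_vars_merge_vars[OF order.refl] F_def[symmetric]
    by (rule extend_eval_assoc[symmetric]) (rule F_add)
qed

theorem differential_differential:
  assumes \<phi>: "\<phi> \<in> cochains n"
  shows "differential (Suc n) (differential n \<phi>) = (\<lambda>_. 0)"
proof
  fix xs :: "'c list"
  show "differential (Suc n) (differential n \<phi>) xs = 0"
  proof (cases "length xs = Suc (Suc n)")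
    case len: True
    define g where "g i k = mconst ((-1) ^ Suc i) * (mconst ((-1) ^ Suc k) * coface i (coface k \<phi>) xs)" for i k
    have inner: "coface i (differential n \<phi>) xs = (\<Sum>k<n. mconst ((-1) ^ Suc k) * coface i (coface k \<phi>) xs)"
      if "i < Suc n" for i
    proof -
      have "coface i (differential n \<phi>) xs = coface i (\<lambda>xs. \<Sum>k<n. mconst ((-1) ^ Suc k) * coface k \<phi> xs) xs"
        using that len by (simp add: coface_def[of i] differential_mconst del: power_Suc)
      then show ?thesis by (simp only: coface_sum)
    qed
    have "differential (Suc n) (differential n \<phi>) xs = (\<Sum>i<Suc n. \<Sum>k<n. g i k)"
      using len by (simp add: differential_mconst[of "Suc n"] inner g_def sum_distrib_left
          del: power_Suc sum.lessThan_Suc)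
    also have "\<dots> = (\<Sum>(i, k)\<in>{..<Suc n} \<times> {..<n}. g i k)"
      by (rule sum.cartesian_product)
    also have "{..<Suc n} \<times> {..<n} = {(i, k). i \<le> k \<and> k < n} \<union> {(i, k). k < i \<and> i < Suc n}"
      by auto
    also have "(\<Sum>(i, k)\<in>\<dots>. g i k) =
        (\<Sum>(i, k)\<in>{(i, k). i \<le> k \<and> k < n}. g i k) + (\<Sum>(i, k)\<in>{(i, k). k < i \<and> i < Suc n}. g i k)"
    proof (rule sum.union_disjoint)
      show "finite {(i, k). i \<le> k \<and> k < n}"
        by (rule finite_subset[of _ "{..n} \<times> {..n}"]) auto
      show "finite {(i, k). k < i \<and> i < Suc n}"
        by (rule finite_subset[of _ "{..n} \<times> {..n}"]) auto
    qed auto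
    also have "(\<Sum>(i, k)\<in>{(i, k). k < i \<and> i < Suc n}. g i k) = (\<Sum>(i, k)\<in>{(i, k). i \<le> k \<and> k < n}. g (Suc k) i)"
      by (rule sum.reindex_bij_witness[of _ "\<lambda>(i, k). (Suc k, i)" "\<lambda>(i, k). (k, i - 1)"]) auto
    also have "\<dots> = (\<Sum>z\<in>{(i, k). i \<le> k \<and> k < n}. - (case z of (i, k) \<Rightarrow> g i k))"
    proof (rule sum.cong)
      fix z assume z: "z \<in> {(i, k). i \<le> k \<and> k < n}"
      obtain i k where ik: "z = (i, k)" by force
      have neg: "mconst (- r) = - mconst r" for r :: 'k by (simp add: mconst_def single_uminus)
      have "coface i (coface k \<phi>) xs = coface (Suc k) (coface i \<phi>) xs"
        by (rule coface_coface[OF \<phi> len]) (use z ik in auto)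
      then show "(case z of (i, k) \<Rightarrow> g (Suc k) i) = - (case z of (i, k) \<Rightarrow> g i k)"
        by (simp add: ik g_def neg)
    qed simp
    finally show ?thesis by (simp only: sum_negf add.right_inverse)
  qed (simp add: differential_def)
qed

end

context conformal_algebra
begin

lemma zero_cochain: "(\<lambda>_. 0) \<in> cochains n"
  by (simp add: cochains_def)

lemma cochain_diff:
  assumes "\<phi> \<in> cochains n" "\<psi> \<in> cochains n"
  shows "(\<lambda>xs. \<phi> xs - \<psi> xs) \<in> cochains n"
proof (rule cochainsI)
  fix xs :: "'c list"
  show "mvars (\<phi> xs - \<psi> xs) \<subseteq> {..<n - 1}"
    using mvars_add[of "\<phi> xs" "- \<psi> xs"] cochain_mvars[OF assms(1), of xs] cochain_mvars[OF assms(2), of xs]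
    by auto
qed (simp_all add: cochain_length[OF assms(1)] cochain_length[OF assms(2)] cochain_add[OF assms(1)]
    cochain_add[OF assms(2)] cochain_scale[OF assms(1)] cochain_scale[OF assms(2)]
    cochain_del_factor[OF assms(1)] cochain_del_factor[OF assms(2)] right_diff_distrib)

lemma differential_diff:
  "differential n (\<lambda>xs. \<phi> xs - \<psi> xs) = (\<lambda>xs. differential n \<phi> xs - differential n \<psi> xs)"
proof
  have "coface i (\<lambda>xs. \<phi> xs - \<psi> xs) xs = coface i \<phi> xs - coface i \<psi> xs" for i xs
  proof -
    have "msubst f (p - q) = msubst f p - msubst f q" for f :: "nat \<Rightarrow> 'k mpoly" and p q
      using msubst_add[of f p "- q"] by simp
    then show ?thesis by (simp add: coface_def extend_eval_def right_diff_distrib sum_subtractf)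
  qed
  then show "differential n (\<lambda>xs. \<phi> xs - \<psi> xs) xs = differential n \<phi> xs - differential n \<psi> xs" for xs
    by (simp add: differential_def right_diff_distrib sum_subtractf del: power_Suc)
qed

lemma zero_coboundary: "(\<lambda>_. 0) \<in> coboundaries n"
proof (cases n)
  case (Suc m)
  have "(\<lambda>_. 0) = differential m (\<lambda>_. 0)"
    using differential_diff[of m "\<lambda>_. 0" "\<lambda>_. 0"] by simp
  then show ?thesis using Suc zero_cochain[of m] by (auto simp: coboundaries_def)
qed (simp add: coboundaries_def)

lemma coboundary_diff:
  assumes "\<phi> \<in> coboundaries n" "\<psi> \<in> coboundaries n"
  shows "(\<lambda>xs. \<phi> xs - \<psi> xs) \<in> coboundaries n"
proof (cases n)
  case 0
  then show ?thesis using assms by (simp add: coboundaries_def)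
next
  case (Suc m)
  then obtain \<alpha> \<beta> where ab: "\<alpha> \<in> cochains m" "\<beta> \<in> cochains m"
    and eq: "\<phi> = differential m \<alpha>" "\<psi> = differential m \<beta>"
    using assms by (auto simp: coboundaries_def)
  have "differential m (\<lambda>xs. \<alpha> xs - \<beta> xs) \<in> coboundaries n"
    using Suc cochain_diff[OF ab] by (simp add: coboundaries_def)
  then show ?thesis by (simp only: differential_diff eq)
qed

end

context assoc_conformal_algebra
begin

lemma coboundary_cocycle: "coboundaries n \<subseteq> cocycles n"
proof (cases n)
  case 0
  have "differential 0 (\<lambda>_. 0) = (\<lambda>_. 0)" by (auto simp: differential_def)
  then show ?thesis using 0 by (simp add: coboundaries_def cocycles_def zero_cochain)
next
  case (Suc m)
  then show ?thesis
    by (auto simp: coboundaries_def cocycles_def differential_cochain differential_differential)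
qed

lemma cocycle_diff:
  assumes "\<phi> \<in> cocycles n" "\<psi> \<in> cocycles n"
  shows "(\<lambda>xs. \<phi> xs - \<psi> xs) \<in> cocycles n"
  using assms by (simp add: cocycles_def cochain_diff differential_diff)

lemma equiv_cohomologous:
  "equiv (cocycles n) (cohomologous n)"
  unfolding cohomologous_def
proof (rule equivI)
  show "refl_on (cocycles n)
     {(\<phi>, \<psi>). \<phi> \<in> cocycles n \<and> \<psi> \<in> cocycles n \<and> (\<lambda>xs. \<phi> xs - \<psi> xs) \<in> coboundaries n}"
    by (auto simp: refl_on_def zero_coboundary)
  show "sym {(\<phi>, \<psi>). \<phi> \<in> cocycles n \<and> \<psi> \<in> cocycles n \<and> (\<lambda>xs. \<phi> xs - \<psi> xs) \<in> coboundaries n}"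
    using coboundary_diff[OF zero_coboundary] by (fastforce simp: sym_def)
  have "(\<lambda>xs. \<phi> xs - \<chi> xs) \<in> coboundaries n"
    if "(\<lambda>xs. \<phi> xs - \<psi> xs) \<in> coboundaries n" "(\<lambda>xs. \<psi> xs - \<chi> xs) \<in> coboundaries n" for \<phi> \<psi> \<chi>
    using coboundary_diff[OF that(1) coboundary_diff[OF zero_coboundary that(2)]] by simp
  then show "trans {(\<phi>, \<psi>). \<phi> \<in> cocycles n \<and> \<psi> \<in> cocycles n \<and> (\<lambda>xs. \<phi> xs - \<psi> xs) \<in> coboundaries n}"
    by (auto simp: trans_def)
qed auto

lemma zero_class:
  "cohomologous n `` {\<lambda>_. 0} = coboundaries n"
proof -
  have "(\<lambda>_. 0) \<in> cocycles n" using zero_coboundary coboundary_cocycle by blast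
  moreover have "\<psi> \<in> coboundaries n \<longleftrightarrow> (\<lambda>xs. - \<psi> xs) \<in> coboundaries n" for \<psi>
    using coboundary_diff[OF zero_coboundary, of \<psi>] coboundary_diff[OF zero_coboundary, of "\<lambda>xs. - \<psi> xs"]
    by auto
  ultimately show ?thesis using coboundary_cocycle[of n] by (auto simp: cohomologous_def)
qed

lemma cohomology_zero_iff: "cohomology n = {coboundaries n} \<longleftrightarrow> cocycles n \<subseteq> coboundaries n"
proof
  assume H: "cohomology n = {coboundaries n}"
  show "cocycles n \<subseteq> coboundaries n"
    using Union_quotient[OF equiv_cohomologous[of n]] H by (simp add: cohomology_def)
next
  assume sub: "cocycles n \<subseteq> coboundaries n"
  then have eq: "cocycles n = coboundaries n" using coboundary_cocycle by blast
  have zero: "(\<lambda>_. 0) \<in> cocycles n" using zero_coboundary coboundary_cocycle by blast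
  have "cohomologous n `` {\<phi>} = coboundaries n" if "\<phi> \<in> cocycles n" for \<phi>
  proof -
    have "((\<lambda>_. 0), \<phi>) \<in> cohomologous n" using cocycle_diff[OF zero that] zero that eq by (simp add: cohomologous_def)
    then have "cohomologous n `` {\<lambda>_. 0} = cohomologous n `` {\<phi>}" by (rule equiv_class_eq[OF equiv_cohomologous])
    then show ?thesis using zero_class[of n] by simp
  qed
  then show "cohomology n = {coboundaries n}"
    unfolding cohomology_def quotient_def using zero by auto
qed

end


section \<open>The algebra \<open>U(3)\<close>\<close>

text \<open>
  \<open>U(3)\<close> is presented by one generator: its elements are the expressions in the operations of an
  associative conformal algebra, modulo the congruence generated by the identities of such algebras,
  written with \<open>n\<close>-products, and by the defining relations. Locality of arbitrary pairs of elements
  is not imposed; it follows from locality of the generator with itself.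
\<close>

datatype 'k U3_term =
    Gen
  | Zero
  | Add "'k U3_term" "'k U3_term"
  | Scale 'k "'k U3_term"
  | Del "'k U3_term"
  | NProd nat "'k U3_term" "'k U3_term"

fun sum_term :: "(nat \<Rightarrow> 'k U3_term) \<Rightarrow> nat \<Rightarrow> 'k U3_term" where
  "sum_term f 0 = Zero"
| "sum_term f (Suc n) = Add (sum_term f n) (f n)"

inductive U3_cong :: "'k::field_char_0 U3_term \<Rightarrow> 'k U3_term \<Rightarrow> bool" where
  refl: "U3_cong a a"
| sym: "U3_cong a b \<Longrightarrow> U3_cong b a"
| trans: "U3_cong a b \<Longrightarrow> U3_cong b c \<Longrightarrow> U3_cong a c"
| cong_add: "U3_cong a a' \<Longrightarrow> U3_cong b b' \<Longrightarrow> U3_cong (Add a b) (Add a' b')"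
| cong_scale: "U3_cong a a' \<Longrightarrow> U3_cong (Scale r a) (Scale r a')"
| cong_del: "U3_cong a a' \<Longrightarrow> U3_cong (Del a) (Del a')"
| cong_nprod: "U3_cong a a' \<Longrightarrow> U3_cong b b' \<Longrightarrow> U3_cong (NProd n a b) (NProd n a' b')"
| add_assoc: "U3_cong (Add (Add a b) c) (Add a (Add b c))"
| add_commute: "U3_cong (Add a b) (Add b a)"
| add_zero: "U3_cong (Add Zero a) a"
| add_neg: "U3_cong (Add (Scale (-1) a) a) Zero"
| scale_add_right: "U3_cong (Scale r (Add a b)) (Add (Scale r a) (Scale r b))"
| scale_add_left: "U3_cong (Scale (r + s) a) (Add (Scale r a) (Scale s a))"
| scale_scale: "U3_cong (Scale r (Scale s a)) (Scale (r * s) a)"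
| scale_one: "U3_cong (Scale 1 a) a"
| del_add: "U3_cong (Del (Add a b)) (Add (Del a) (Del b))"
| del_scale: "U3_cong (Del (Scale r a)) (Scale r (Del a))"
| nprod_add_left: "U3_cong (NProd n (Add a b) c) (Add (NProd n a c) (NProd n b c))"
| nprod_add_right: "U3_cong (NProd n a (Add b c)) (Add (NProd n a b) (NProd n a c))"
| nprod_scale_left: "U3_cong (NProd n (Scale r a) b) (Scale r (NProd n a b))"
| nprod_scale_right: "U3_cong (NProd n a (Scale r b)) (Scale r (NProd n a b))"
| nprod_del_left_0: "U3_cong (NProd 0 (Del a) b) Zero"
| nprod_del_left_Suc:
    "U3_cong (NProd (Suc n) (Del a) b) (Scale (- of_nat (Suc n)) (NProd n a b))"
| nprod_del_right_0: "U3_cong (NProd 0 a (Del b)) (Del (NProd 0 a b))"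
| nprod_del_right_Suc:
    "U3_cong (NProd (Suc n) a (Del b))
       (Add (Del (NProd (Suc n) a b)) (Scale (of_nat (Suc n)) (NProd n a b)))"
| nprod_assoc:
    "U3_cong (NProd m a (NProd n b c))
       (sum_term (\<lambda>i. Scale (of_nat (m choose i)) (NProd (m + n - i) (NProd i a b) c)) (Suc m))"
| gen_local: "n \<ge> 3 \<Longrightarrow> U3_cong (NProd n Gen Gen) Zero"
| gen_relation:
    "U3_cong (Add (Scale 2 (NProd 1 Gen Gen)) (Scale (-1) (Del (NProd 2 Gen Gen)))) (Scale 2 Gen)"

quotient_type (overloaded) 'k U3 = "'k::field_char_0 U3_term" / U3_cong
  by (rule equivpI) (auto simp: reflp_def symp_def transp_def intro: U3_cong.intros(1-3))

instantiation U3 :: (field_char_0) ab_group_add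
begin

lift_definition zero_U3 :: "'a U3" is Zero .
lift_definition plus_U3 :: "'a U3 \<Rightarrow> 'a U3 \<Rightarrow> 'a U3" is Add
  by (rule U3_cong.cong_add)
lift_definition uminus_U3 :: "'a U3 \<Rightarrow> 'a U3" is "Scale (-1)"
  by (rule U3_cong.cong_scale)
lift_definition minus_U3 :: "'a U3 \<Rightarrow> 'a U3 \<Rightarrow> 'a U3" is "\<lambda>a b. Add a (Scale (-1) b)"
  by (intro U3_cong.cong_add U3_cong.cong_scale)

instance
proof
  fix a b c :: "'a U3"
  show "a + b + c = a + (b + c)" by transfer (rule U3_cong.add_assoc)
  show "a + b = b + a" by transfer (rule U3_cong.add_commute)
  show "0 + a = a" by transfer (rule U3_cong.add_zero)
  show "- a + a = 0" by transfer (rule U3_cong.add_neg)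
  show "a - b = a + - b" by transfer (rule U3_cong.refl)
qed

end

lift_definition U3_gen :: "'k::field_char_0 U3" is Gen .

lift_definition U3_scale :: "'k::field_char_0 \<Rightarrow> 'k U3 \<Rightarrow> 'k U3" is Scale
  by (rule U3_cong.cong_scale)

lift_definition U3_del :: "'k::field_char_0 U3 \<Rightarrow> 'k U3" is Del
  by (rule U3_cong.cong_del)

lift_definition U3_nprod :: "nat \<Rightarrow> 'k::field_char_0 U3 \<Rightarrow> 'k U3 \<Rightarrow> 'k U3" is NProd
  by (rule U3_cong.cong_nprod)

interpretation U3_vs: vector_space "U3_scale :: 'k::field_char_0 \<Rightarrow> 'k U3 \<Rightarrow> 'k U3"
proof
  fix r s :: 'k and a b :: "'k U3"
  show "U3_scale r (a + b) = U3_scale r a + U3_scale r b"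
    by transfer (rule U3_cong.scale_add_right)
  show "U3_scale (r + s) a = U3_scale r a + U3_scale s a"
    by transfer (rule U3_cong.scale_add_left)
  show "U3_scale r (U3_scale s a) = U3_scale (r * s) a"
    by transfer (rule U3_cong.scale_scale)
  show "U3_scale 1 a = a"
    by transfer (rule U3_cong.scale_one)
qed

lemma U3_del_add: "U3_del (a + b) = U3_del a + U3_del b"
  by transfer (rule U3_cong.del_add)

lemma U3_del_scale: "U3_del (U3_scale r a) = U3_scale r (U3_del a)"
  by transfer (rule U3_cong.del_scale)

lemma U3_del_linear: "Vector_Spaces.linear U3_scale U3_scale U3_del"
  by unfold_locales (simp_all add: U3_del_add U3_del_scale)

lemma U3_nprod_add_left: "U3_nprod n (a + b) c = U3_nprod n a c + U3_nprod n b c"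
  by transfer (rule U3_cong.nprod_add_left)

lemma U3_nprod_add_right: "U3_nprod n a (b + c) = U3_nprod n a b + U3_nprod n a c"
  by transfer (rule U3_cong.nprod_add_right)

lemma U3_nprod_scale_left: "U3_nprod n (U3_scale r a) b = U3_scale r (U3_nprod n a b)"
  by transfer (rule U3_cong.nprod_scale_left)

lemma U3_nprod_scale_right: "U3_nprod n a (U3_scale r b) = U3_scale r (U3_nprod n a b)"
  by transfer (rule U3_cong.nprod_scale_right)

lemma U3_nprod_0 [simp]: "U3_nprod n 0 b = 0" "U3_nprod n a 0 = 0"
  using U3_nprod_add_left[of n 0 0 b] U3_nprod_add_right[of n a 0 0] by auto

lemma U3_del_0 [simp]: "U3_del 0 = 0"
  using U3_del_add[of 0 0] by simp

lemma U3_nprod_del_left_0: "U3_nprod 0 (U3_del a) b = 0"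
  by transfer (rule U3_cong.nprod_del_left_0)

lemma U3_nprod_del_left_Suc:
  "U3_nprod (Suc n) (U3_del a) b = U3_scale (- of_nat (Suc n)) (U3_nprod n a b)"
  by transfer (rule U3_cong.nprod_del_left_Suc)

lemma U3_nprod_del_right_0: "U3_nprod 0 a (U3_del b) = U3_del (U3_nprod 0 a b)"
  by transfer (rule U3_cong.nprod_del_right_0)

lemma U3_nprod_del_right_Suc:
  "U3_nprod (Suc n) a (U3_del b) =
     U3_del (U3_nprod (Suc n) a b) + U3_scale (of_nat (Suc n)) (U3_nprod n a b)"
  by transfer (rule U3_cong.nprod_del_right_Suc)

lemma U3_sum_term: "abs_U3 (sum_term f n) = (\<Sum>i<n. abs_U3 (f i))"
  by (induction n) (simp_all add: zero_U3.abs_eq plus_U3.abs_eq[symmetric] add.commute)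

lemma U3_abs_surj: "\<exists>t. x = abs_U3 t"
  by (induction x rule: U3.abs_induct) auto

lemma U3_nprod_assoc:
  "U3_nprod m a (U3_nprod n b c) =
     (\<Sum>i\<le>m. U3_scale (of_nat (m choose i)) (U3_nprod (m + n - i) (U3_nprod i a b) c))"
proof -
  obtain a' b' c' where "a = abs_U3 a'" "b = abs_U3 b'" "c = abs_U3 c'"
    by (meson U3_abs_surj)
  then show ?thesis
    using U3_cong.nprod_assoc[of m a' n b' c', folded U3.abs_eq_iff]
    by (simp only: U3_sum_term lessThan_Suc_atMost U3_nprod.abs_eq U3_scale.abs_eq)
qed

lemma U3_gen_local: "n \<ge> 3 \<Longrightarrow> U3_nprod n U3_gen U3_gen = 0"
  by transfer (rule U3_cong.gen_local)

lemma U3_gen_relation: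
  "U3_scale 2 (U3_nprod 1 U3_gen U3_gen) - U3_del (U3_nprod 2 U3_gen U3_gen) = U3_scale 2 U3_gen"
  by transfer (rule U3_cong.gen_relation)

lemma U3_induct [case_names gen zero add scale del nprod]:
  assumes "P U3_gen" "P 0" "\<And>a b. P a \<Longrightarrow> P b \<Longrightarrow> P (a + b)" "\<And>r a. P a \<Longrightarrow> P (U3_scale r a)"
    "\<And>a. P a \<Longrightarrow> P (U3_del a)" "\<And>n a b. P a \<Longrightarrow> P b \<Longrightarrow> P (U3_nprod n a b)"
  shows "P x"
proof (induction x rule: U3.abs_induct)
  case (1 t)
  show ?case
  proof (induction t)
    case Gen
    then show ?case using assms(1) by (simp add: U3_gen.abs_eq)
  next
    case Zero
    then show ?case using assms(2) by (simp add: zero_U3.abs_eq)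
  next
    case (Add t1 t2)
    then show ?case using assms(3) by (metis plus_U3.abs_eq)
  next
    case (Scale r t)
    then show ?case using assms(4) by (metis U3_scale.abs_eq)
  next
    case (Del t)
    then show ?case using assms(5) by (metis U3_del.abs_eq)
  next
    case (NProd n t1 t2)
    then show ?case using assms(6) by (metis U3_nprod.abs_eq)
  qed
qed

subsection \<open>Locality and the \<open>\<lambda>\<close>-product\<close>

definition U3_mutually_local :: "'k::field_char_0 U3 \<Rightarrow> 'k U3 \<Rightarrow> bool" where
  "U3_mutually_local a b \<longleftrightarrow> (\<exists>N. \<forall>n\<ge>N. U3_nprod n a b = 0)"

lemma U3_local_zero: "U3_mutually_local 0 b" "U3_mutually_local a 0"
  by (auto simp: U3_mutually_local_def)

lemma U3_local_add_left:
  assumes "U3_mutually_local a c" "U3_mutually_local b c"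
  shows "U3_mutually_local (a + b) c"
proof -
  obtain M N where "\<forall>n\<ge>M. U3_nprod n a c = 0" "\<forall>n\<ge>N. U3_nprod n b c = 0"
    using assms by (auto simp: U3_mutually_local_def)
  then have "\<forall>n\<ge>max M N. U3_nprod n (a + b) c = 0" by (simp add: U3_nprod_add_left)
  then show ?thesis unfolding U3_mutually_local_def by blast
qed

lemma U3_local_add_right:
  assumes "U3_mutually_local a b" "U3_mutually_local a c"
  shows "U3_mutually_local a (b + c)"
proof -
  obtain M N where "\<forall>n\<ge>M. U3_nprod n a b = 0" "\<forall>n\<ge>N. U3_nprod n a c = 0"
    using assms by (auto simp: U3_mutually_local_def)
  then have "\<forall>n\<ge>max M N. U3_nprod n a (b + c) = 0" by (simp add: U3_nprod_add_right)
  then show ?thesis unfolding U3_mutually_local_def by blast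
qed

lemma U3_local_scale:
  "U3_mutually_local a b \<Longrightarrow> U3_mutually_local (U3_scale r a) b"
  "U3_mutually_local a b \<Longrightarrow> U3_mutually_local a (U3_scale r b)"
  by (auto simp: U3_mutually_local_def U3_nprod_scale_left U3_nprod_scale_right)

lemma U3_local_del_left:
  assumes "U3_mutually_local a b" shows "U3_mutually_local (U3_del a) b"
proof -
  obtain N where N: "\<forall>n\<ge>N. U3_nprod n a b = 0" using assms by (auto simp: U3_mutually_local_def)
  have "U3_nprod n (U3_del a) b = 0" if "n \<ge> Suc N" for n
    using N that by (cases n) (auto simp: U3_nprod_del_left_Suc)
  then show ?thesis unfolding U3_mutually_local_def by blast
qed

lemma U3_local_del_right:
  assumes "U3_mutually_local a b" shows "U3_mutually_local a (U3_del b)"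
proof -
  obtain N where N: "\<forall>n\<ge>N. U3_nprod n a b = 0" using assms by (auto simp: U3_mutually_local_def)
  have "U3_nprod n a (U3_del b) = 0" if "n \<ge> Suc N" for n
    using N that by (cases n) (auto simp: U3_nprod_del_right_Suc)
  then show ?thesis unfolding U3_mutually_local_def by blast
qed

lemma U3_local_nprod_left:
  assumes "U3_mutually_local b c" shows "U3_mutually_local (U3_nprod n a b) c"
proof -
  obtain N where N: "\<forall>n\<ge>N. U3_nprod n b c = 0" using assms by (auto simp: U3_mutually_local_def)
  have "\<forall>m\<ge>N. U3_nprod m (U3_nprod n a b) c = 0"
  proof (induction n rule: less_induct)
    case (less n)
    show ?case
    proof (intro allI impI)
      fix m assume m: "m \<ge> N"
      have "0 = U3_nprod n a (U3_nprod m b c)" using N m by simp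
      also have "\<dots> = (\<Sum>i\<le>n. U3_scale (of_nat (n choose i)) (U3_nprod (n + m - i) (U3_nprod i a b) c))"
        by (rule U3_nprod_assoc)
      also have "\<dots> = (\<Sum>i\<le>n. if i = n then U3_nprod m (U3_nprod n a b) c else 0)"
      proof (rule sum.cong)
        fix i assume "i \<in> {..n}"
        then show "U3_scale (of_nat (n choose i)) (U3_nprod (n + m - i) (U3_nprod i a b) c) =
            (if i = n then U3_nprod m (U3_nprod n a b) c else 0)"
          using less.IH[of i] m by auto
      qed simp
      finally show "U3_nprod m (U3_nprod n a b) c = 0" by simp
    qed
  qed
  then show ?thesis unfolding U3_mutually_local_def by blast
qed

lemma U3_local_nprod_right:
  assumes "U3_mutually_local a b" "U3_mutually_local b c"
  shows "U3_mutually_local a (U3_nprod n b c)"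
proof -
  obtain M where M: "\<forall>n\<ge>M. U3_nprod n a b = 0" using assms(1) by (auto simp: U3_mutually_local_def)
  have "\<forall>i. \<exists>N. \<forall>k\<ge>N. U3_nprod k (U3_nprod i a b) c = 0"
    using U3_local_nprod_left[OF assms(2)] by (simp add: U3_mutually_local_def)
  then have "\<exists>N. \<forall>i. \<forall>k\<ge>N i. U3_nprod k (U3_nprod i a b) c = 0"
    by (rule choice)
  then obtain N where N: "\<And>i k. k \<ge> N i \<Longrightarrow> U3_nprod k (U3_nprod i a b) c = 0" by blast
  define K where "K = M + (\<Sum>i<M. N i)"
  have "U3_nprod m a (U3_nprod n b c) = 0" if m: "m \<ge> K" for m
  proof -
    have "U3_nprod (m + n - i) (U3_nprod i a b) c = 0" if "i \<le> m" for i
    proof (cases "i < M")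
      case True
      then have "N i \<le> (\<Sum>i<M. N i)" by (simp add: member_le_sum)
      then show ?thesis using N m True by (simp add: K_def)
    qed (use M in simp)
    then show ?thesis by (simp add: U3_nprod_assoc)
  qed
  then show ?thesis unfolding U3_mutually_local_def by blast
qed

lemma U3_local:
  fixes a b :: "'k::field_char_0 U3"
  shows "U3_mutually_local a b"
proof -
  have local_gen: "U3_mutually_local x U3_gen" for x :: "'k U3"
  proof (induction x rule: U3_induct)
    case gen
    show ?case using U3_gen_local by (auto simp: U3_mutually_local_def)
  qed (simp_all add: U3_local_zero U3_local_add_left U3_local_scale U3_local_del_left U3_local_nprod_left)
  show ?thesis
  proof (induction b arbitrary: a rule: U3_induct)
    case gen
    show ?case by (rule local_gen)
  qed (simp_all add: U3_local_zero U3_local_add_right U3_local_scale U3_local_del_right U3_local_nprod_right)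
qed

definition U3_lprod :: "'k::field_char_0 U3 \<Rightarrow> 'k U3 \<Rightarrow> 'k U3 poly" where
  "U3_lprod a b = Abs_poly (\<lambda>n. U3_scale (1 / fact n) (U3_nprod n a b))"

lemma coeff_U3_lprod: "coeff (U3_lprod a b) n = U3_scale (1 / fact n) (U3_nprod n a b)"
proof -
  obtain N where N: "\<forall>n\<ge>N. U3_nprod n a b = 0"
    using U3_local[of a b] by (auto simp: U3_mutually_local_def)
  have "U3_scale (1 / fact i) (U3_nprod i a b) = 0" if "i > N" for i using N that by simp
  then show ?thesis
    unfolding U3_lprod_def by (subst coeff_Abs_poly[where n = N]) auto
qed

interpretation U3: assoc_conformal_algebra
  "U3_scale :: 'k::field_char_0 \<Rightarrow> 'k U3 \<Rightarrow> 'k U3" U3_del U3_lprod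
  rewrites "conformal_algebra.nprod U3_scale U3_lprod = (U3_nprod :: nat \<Rightarrow> 'k U3 \<Rightarrow> 'k U3 \<Rightarrow> 'k U3)"
proof -
  have conf: "conformal_algebra U3_scale U3_del (U3_lprod :: 'k U3 \<Rightarrow> 'k U3 \<Rightarrow> 'k U3 poly)"
  proof (intro conformal_algebra.intro conformal_algebra_axioms.intro
      U3_vs.vector_space_axioms U3_del_linear)
    fix a b c :: "'k U3" and r :: 'k
    show "U3_lprod (a + b) c = U3_lprod a c + U3_lprod b c"
      by (rule poly_eqI) (simp add: coeff_U3_lprod U3_nprod_add_left U3_vs.scale_right_distrib)
    show "U3_lprod a (b + c) = U3_lprod a b + U3_lprod a c"
      by (rule poly_eqI) (simp add: coeff_U3_lprod U3_nprod_add_right U3_vs.scale_right_distrib)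
    show "U3_lprod (U3_scale r a) b = map_poly (U3_scale r) (U3_lprod a b)"
      by (rule poly_eqI) (simp add: coeff_U3_lprod coeff_map_poly U3_nprod_scale_left mult.commute)
    show "U3_lprod a (U3_scale r b) = map_poly (U3_scale r) (U3_lprod a b)"
      by (rule poly_eqI) (simp add: coeff_U3_lprod coeff_map_poly U3_nprod_scale_right mult.commute)
    have scale_fact: "U3_scale (1 / fact (Suc n)) (U3_scale (of_nat (Suc n)) x) = U3_scale (1 / fact n) x"
      for n and x :: "'k U3"
    proof -
      have "1 / fact (Suc n) * of_nat (Suc n) = (1 / fact n :: 'k)"
        using of_nat_neq_0[where 'a = 'k, of n] by (simp only: fact_Suc) (simp del: of_nat_Suc)
      then show ?thesis by (simp only: U3_vs.scale_scale)
    qed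
    show "U3_lprod (U3_del a) b = - pCons 0 (U3_lprod a b)"
    proof (rule poly_eqI)
      fix n show "coeff (U3_lprod (U3_del a) b) n = coeff (- pCons 0 (U3_lprod a b)) n"
        by (cases n) (simp_all only: coeff_U3_lprod U3_nprod_del_left_0 U3_nprod_del_left_Suc
            coeff_minus coeff_pCons_0 coeff_pCons_Suc U3_vs.scale_zero_right minus_zero
            U3_vs.scale_minus_left U3_vs.scale_minus_right scale_fact)
    qed
    show "U3_lprod a (U3_del b) = map_poly U3_del (U3_lprod a b) + pCons 0 (U3_lprod a b)"
    proof (rule poly_eqI)
      fix n show "coeff (U3_lprod a (U3_del b)) n =
          coeff (map_poly U3_del (U3_lprod a b) + pCons 0 (U3_lprod a b)) n"
        by (cases n) (simp_all only: coeff_U3_lprod coeff_map_poly[where f = U3_del, OF U3_del_0]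
            U3_nprod_del_right_0 U3_nprod_del_right_Suc coeff_add coeff_pCons_0 coeff_pCons_Suc
            U3_del_scale U3_vs.scale_right_distrib add_0_right scale_fact)
    qed
  qed
  show "assoc_conformal_algebra U3_scale U3_del (U3_lprod :: 'k U3 \<Rightarrow> 'k U3 \<Rightarrow> 'k U3 poly)"
  proof (intro assoc_conformal_algebra.intro assoc_conformal_algebra_axioms.intro conf)
    fix a b c :: "'k U3"
    have zero: "U3_lprod a 0 = 0" for a :: "'k U3" by (rule poly_eqI) (simp add: coeff_U3_lprod)
    have zero': "U3_lprod 0 c = 0" for c :: "'k U3" by (rule poly_eqI) (simp add: coeff_U3_lprod)
    show "map_poly (U3_lprod a) (U3_lprod b c) =
     (\<Sum>i\<le>degree (U3_lprod a b).
        (map_poly (pCons 0) ^^ i) (subst_lam_plus_mu (U3_lprod (coeff (U3_lprod a b) i) c)))"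
    proof (intro poly_eqI, subst U3_vs.coeff_assoc_rhs[where f = U3_lprod, OF zero'])
      fix s r
      have "coeff (coeff (map_poly (U3_lprod a) (U3_lprod b c)) s) r =
          U3_scale (1 / (fact r * fact s)) (U3_nprod r a (U3_nprod s b c))"
        by (simp add: coeff_map_poly zero coeff_U3_lprod U3_nprod_scale_right mult.commute)
      also have "\<dots> = (\<Sum>i\<le>r. U3_scale (of_nat (r choose i) / (fact r * fact s))
          (U3_nprod (r + s - i) (U3_nprod i a b) c))"
        by (simp add: U3_nprod_assoc U3_vs.scale_sum_right)
      also have "\<dots> = (\<Sum>i\<le>r. U3_scale (of_nat ((r + s - i) choose s))
          (coeff (U3_lprod (coeff (U3_lprod a b) i) c) (r + s - i)))"
      proof (rule sum.cong)
        fix i assume "i \<in> {..r}"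
        then have i: "i \<le> r" by simp
        have "r + s - i - s = r - i" using i by simp
        then have "of_nat (r choose i) / (fact r * fact s) =
            (of_nat ((r + s - i) choose s) / (fact (r + s - i) * fact i) :: 'k)"
          using i by (simp add: binomial_fact)
        then show "U3_scale (of_nat (r choose i) / (fact r * fact s))
            (U3_nprod (r + s - i) (U3_nprod i a b) c) =
            U3_scale (of_nat ((r + s - i) choose s))
            (coeff (U3_lprod (coeff (U3_lprod a b) i) c) (r + s - i))"
          by (simp add: coeff_U3_lprod U3_nprod_scale_left)
      qed simp
      finally show "coeff (coeff (map_poly (U3_lprod a) (U3_lprod b c)) s) r =
        (\<Sum>i\<le>r. U3_scale (of_nat ((r + s - i) choose s))
          (coeff (U3_lprod (coeff (U3_lprod a b) i) c) (r + s - i)))" .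
    qed
  qed
  show "conformal_algebra.nprod U3_scale U3_lprod = (U3_nprod :: nat \<Rightarrow> 'k U3 \<Rightarrow> 'k U3 \<Rightarrow> 'k U3)"
    by (intro ext) (simp add: conformal_algebra.nprod_def[OF conf] coeff_U3_lprod)
qed

lemma U3_relations_gen: "U3.U3_relations U3_gen"
  using U3_gen_relation by (simp add: U3.U3_relations_def U3_gen_local)

subsection \<open>The universal property\<close>

context assoc_conformal_algebra
begin

primrec eval_term :: "'c \<Rightarrow> 'k U3_term \<Rightarrow> 'c" where
  "eval_term v Gen = v"
| "eval_term v Zero = 0"
| "eval_term v (Add a b) = eval_term v a + eval_term v b"
| "eval_term v (Scale r a) = scale r (eval_term v a)"
| "eval_term v (Del a) = del (eval_term v a)"
| "eval_term v (NProd n a b) = nprod n (eval_term v a) (eval_term v b)"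

lemma eval_sum_term: "eval_term v (sum_term f n) = (\<Sum>i<n. eval_term v (f i))"
  by (induction n) (simp_all add: add.commute)

lemma eval_term_cong:
  assumes "U3_relations v" "U3_cong s t"
  shows "eval_term v s = eval_term v t"
  using assms(2)
proof (induction rule: U3_cong.induct)
  case (nprod_assoc m a n b c)
  show ?case
    by (simp only: eval_sum_term eval_term.simps assoc_conformal_algebra.nprod_assoc[OF
        assoc_conformal_algebra_axioms] lessThan_Suc_atMost)
next
  case (scale_add_left r s a)
  then show ?case by (simp add: scale_left_distrib)
next
  case (gen_local n)
  then show ?case using assms(1) by (simp add: U3_relations_def)
next
  case gen_relation
  then show ?case using assms(1) by (simp add: U3_relations_def)
qed (simp_all add: scale_right_distrib ac_simps nprod_add_left nprod_add_right
    nprod_scale_left nprod_scale_right nprod_del_left_0 nprod_del_left_Suc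
    nprod_del_right_0 nprod_del_right_Suc del: of_nat_Suc)

theorem U3_universal:
  assumes "U3_relations v"
  shows "\<exists>!f. conformal_hom U3_scale U3_del U3_lprod scale del lprod f \<and> f U3_gen = v"
proof (rule ex_ex1I)
  define f where "f x = eval_term v (rep_U3 x)" for x
  have f_abs: "f (abs_U3 t) = eval_term v t" for t
    unfolding f_def by (rule eval_term_cong[OF assms]) (rule Quotient3_rep_abs[OF Quotient3_U3], rule U3_cong.refl)
  have f_gen: "f U3_gen = v" by (simp add: U3_gen.abs_eq f_abs)
  have f_add: "f (a + b) = f a + f b" for a b
    by (induction a rule: U3.abs_induct, induction b rule: U3.abs_induct) (simp add: plus_U3.abs_eq f_abs)
  have f_scale: "f (U3_scale r a) = scale r (f a)" for r a
    by (induction a rule: U3.abs_induct) (simp add: U3_scale.abs_eq f_abs)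
  have f_del: "f (U3_del a) = del (f a)" for a
    by (induction a rule: U3.abs_induct) (simp add: U3_del.abs_eq f_abs)
  have f_nprod: "f (U3_nprod n a b) = nprod n (f a) (f b)" for n a b
    by (induction a rule: U3.abs_induct, induction b rule: U3.abs_induct) (simp add: U3_nprod.abs_eq f_abs)
  have f_0: "f 0 = 0" using f_add[of 0 0] by simp
  have "Vector_Spaces.linear U3_scale scale f"
    by unfold_locales (simp_all add: f_add f_scale)
  moreover have "lprod (f a) (f b) = map_poly f (U3_lprod a b)" for a b
    by (rule poly_eqI) (simp add: coeff_map_poly f_0 coeff_lprod coeff_U3_lprod f_scale f_nprod)
  ultimately show "\<exists>f. conformal_hom U3_scale U3_del U3_lprod scale del lprod f \<and> f U3_gen = v"
    using f_del f_gen by (auto simp: conformal_hom_def)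
next
  fix f g
  assume f: "conformal_hom U3_scale U3_del U3_lprod scale del lprod f \<and> f U3_gen = v"
    and g: "conformal_hom U3_scale U3_del U3_lprod scale del lprod g \<and> g U3_gen = v"
  have props: "h 0 = 0" "h (a + b) = h a + h b" "h (U3_scale r a) = scale r (h a)"
      "h (U3_del a) = del (h a)" "h (U3_nprod n a b) = nprod n (h a) (h b)"
    if "conformal_hom U3_scale U3_del U3_lprod scale del lprod h" for h a b r n
  proof -
    have lin: "module_hom U3_scale scale h"
      using that by (simp add: conformal_hom_def Vector_Spaces.linear_iff_module_hom)
    show h0: "h 0 = 0" by (rule module_hom.zero[OF lin])
    show "h (a + b) = h a + h b" by (rule module_hom.add[OF lin])
    have hs: "h (U3_scale r a) = scale r (h a)" for r a by (rule module_hom.scale[OF lin])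
    then show "h (U3_scale r a) = scale r (h a)" .
    show "h (U3_del a) = del (h a)" using that by (simp add: conformal_hom_def)
    have "lprod (h a) (h b) = map_poly h (U3_lprod a b)" using that by (simp add: conformal_hom_def)
    then have "coeff (lprod (h a) (h b)) n = h (coeff (U3_lprod a b) n)"
      by (simp add: coeff_map_poly h0)
    then show "h (U3_nprod n a b) = nprod n (h a) (h b)"
      by (simp add: nprod_def coeff_U3_lprod hs)
  qed
  show "f = g"
  proof
    fix x show "f x = g x"
      by (induction x rule: U3_induct) (use f g in \<open>simp_all add: props\<close>)
  qed
qed

end

end

theory Submission
  imports Defs "HOL-Library.Product_Plus"
begin

text \<open>
  Sending \<open>v\<close> to \<open>x - \<Delta>\<partial>\<close> identifies \<open>U(3)\<close> with the polynomials
  \<open>P = (x - \<Delta>\<partial>) Q(\<partial>,x) + \<Delta>(\<Delta> - 1) R(\<partial>,x,\<Delta>)\<close> under the product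
  \<open>P \<^sub>(\<^sub>\<lambda>\<^sub>) P' = P(-\<lambda>,x,\<Delta>) P'(\<partial> + \<lambda>,x + \<lambda>,\<Delta>)\<close>. Such a formula defines the symbol of an element, and the relations
  of \<open>U(3)\<close> show that the elements needed to realise all \<open>Q\<close> and \<open>R\<close> span (\<open>spanned_all\<close>), so that the
  symbol determines everything. By sesquilinearity a cochain sees an argument \<open>a\<close> only through its symbol at
  \<open>\<partial> = -\<lambda>\<close>, that is, through a point \<open>(\<lambda>,(Q,R))\<close>. Points multiply associatively, and the
  reduced complex becomes the complex of a semigroup with trivial coefficients: functions of \<open>n\<close> points
  whose \<open>\<lambda>\<close> add up to zero, linear in the fibres and polynomial in the \<open>\<lambda>\<close> (\<open>meval_differential\<close>).

  The point of \<open>v\<close> at \<open>\<lambda> = 0\<close> multiplies symbols by \<open>x\<close>. A cochain that vanishes on it and on its multiples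
  in the first argument is a cochain with first argument in the right module \<open>D = k[\<Delta>]\<close>, on which a point acts by the
  value of its symbol at \<open>x = \<lambda>\<close>. Every cocycle can be brought into this form (\<open>cochain_mod_x\<close>), so
  cocycles of degree \<open>n\<close> reduce to cocycles of degree \<open>n - 1\<close> on \<open>D\<close>.

  Multiplication by \<open>\<Delta>\<close> is null-homotopic on \<open>D\<close> in degrees at least \<open>2\<close>: the element \<open>1\<close> over \<open>\<lambda> = 0\<close> is killed by
  \<open>x\<close> and generates \<open>\<Delta>D\<close> away from \<open>\<lambda> = 0\<close>, and evaluating a cocycle at this generator gives the homotopy
  (\<open>Delta_exact\<close>). On the quotient \<open>D/(\<Delta> - 1)\<close> multiplication by \<open>\<Delta>\<close> is the identity; hence a cocycle
  there is a coboundary on \<open>D\<close>, and a second use of the homotopy, one degree lower, makes the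
  primitive descend to the quotient (\<open>D1_exact\<close>). Finally a cocycle on \<open>D\<close> can be made to vanish on \<open>\<Delta>D\<close>
  and on the generator. It then has the form \<open>\<lambda> u(0) \<gamma>(\<lambda>)\<close>, and the factor \<open>\<lambda>\<close> turns the action at \<open>\<Delta> = 0\<close>
  into the action at \<open>\<Delta> = 1\<close>: \<open>u(1) \<gamma>(\<lambda>)\<close> is a cocycle on \<open>D/(\<Delta> - 1)\<close>, hence a coboundary (\<open>D_exact\<close>). The two
  uses of the homotopy need degree \<open>3\<close> on \<open>D\<close>, which is degree \<open>4\<close> for \<open>U(3)\<close>.
\<close>

section \<open>Polynomial families\<close>

text \<open>
  Polynomials in the \<open>\<lambda>\<close>-variables are handled as functions of parameters \<open>x 0, x 1, \<dots>\<close>, which loses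
  nothing over an infinite field and makes substitution the composition of functions. The values lie in
  \<open>k\<close>, \<open>k[x]\<close> or \<open>k[\<Delta>][x]\<close>, and \<open>\<iota>\<close> is the inclusion of the scalars.
\<close>

inductive polyfam :: "('k::field \<Rightarrow> 'r::comm_ring_1) \<Rightarrow> ((nat \<Rightarrow> 'k) \<Rightarrow> 'r) \<Rightarrow> bool" for \<iota> where
  const: "polyfam \<iota> (\<lambda>x. c)"
| coord: "polyfam \<iota> (\<lambda>x. \<iota> (x i))"
| add: "polyfam \<iota> f \<Longrightarrow> polyfam \<iota> g \<Longrightarrow> polyfam \<iota> (\<lambda>x. f x + g x)"
| mult: "polyfam \<iota> f \<Longrightarrow> polyfam \<iota> g \<Longrightarrow> polyfam \<iota> (\<lambda>x. f x * g x)"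

abbreviation polyfun :: "((nat \<Rightarrow> 'k::field) \<Rightarrow> 'k) \<Rightarrow> bool" where
  "polyfun \<equiv> polyfam (\<lambda>a. a)"

definition scalar_hom :: "('k::field \<Rightarrow> 'r::comm_ring_1) \<Rightarrow> bool" where
  "scalar_hom \<iota> \<longleftrightarrow> \<iota> 1 = 1 \<and> (\<forall>a b. \<iota> (a + b) = \<iota> a + \<iota> b) \<and> (\<forall>a b. \<iota> (a * b) = \<iota> a * \<iota> b)"

lemma scalar_homs [simp]: "scalar_hom (\<lambda>a. a)" "scalar_hom (\<lambda>a. [:a:])" "scalar_hom (\<lambda>a. [:[:a:]:])"
  by (auto simp: scalar_hom_def one_pCons)

lemma polyfun_coord [simp]: "polyfun (\<lambda>x. x i)"
  by (rule polyfam.coord)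

lemma polyfam_uminus: "polyfam \<iota> f \<Longrightarrow> polyfam \<iota> (\<lambda>x. - f x)"
  using polyfam.mult[OF polyfam.const[of \<iota> "-1"], of f] by simp

lemma polyfam_diff: "polyfam \<iota> f \<Longrightarrow> polyfam \<iota> g \<Longrightarrow> polyfam \<iota> (\<lambda>x. f x - g x)"
  using polyfam.add[OF _ polyfam_uminus, of \<iota> f g] by simp

lemma polyfam_sum: "(\<And>a. a \<in> A \<Longrightarrow> polyfam \<iota> (f a)) \<Longrightarrow> polyfam \<iota> (\<lambda>x. \<Sum>a\<in>A. f a x)"
  by (induction A rule: infinite_finite_induct) (auto intro: polyfam.const polyfam.add)

lemma polyfam_power: "polyfam \<iota> f \<Longrightarrow> polyfam \<iota> (\<lambda>x. f x ^ n)"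
  by (induction n) (auto intro: polyfam.const polyfam.mult)

lemma polyfam_prod: "(\<And>a. a \<in> A \<Longrightarrow> polyfam \<iota> (f a)) \<Longrightarrow> polyfam \<iota> (\<lambda>x. \<Prod>a\<in>A. f a x)"
  by (induction A rule: infinite_finite_induct) (auto intro: polyfam.const polyfam.mult)

lemmas polyfam_intros = polyfam.const polyfam.coord polyfun_coord polyfam.add polyfam.mult
  polyfam_uminus polyfam_diff polyfam_sum polyfam_power polyfam_prod

text \<open>
  The homomorphism may itself depend on the parameters: this covers evaluation at a moving point and
  substitutions such as \<open>x \<mapsto> x + \<lambda>\<close>.
\<close>

lemma polyfam_ring_hom:
  assumes Q: "polyfam \<iota> Q"
    and T: "\<And>c. polyfam \<iota>' (\<lambda>x. T x c)" "\<And>x r. T x (\<iota> r) = \<iota>' r"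
      "\<And>x a b. T x (a + b) = T x a + T x b" "\<And>x a b. T x (a * b) = T x a * T x b"
  shows "polyfam \<iota>' (\<lambda>x. T x (Q x))"
  using Q by induction (auto simp: T intro: polyfam_intros)

lemma polyfam_embed: "scalar_hom \<iota> \<Longrightarrow> polyfun g \<Longrightarrow> polyfam \<iota> (\<lambda>x. \<iota> (g x))"
  by (rule polyfam_ring_hom[where T = "\<lambda>x. \<iota>" and \<iota> = "\<lambda>a. a"]) (auto simp: scalar_hom_def intro: polyfam_intros)

lemma polyfam_subst:
  assumes "scalar_hom \<iota>" "polyfam \<iota> Q" "\<And>i. polyfun (\<sigma> i)"
  shows "polyfam \<iota> (\<lambda>y. Q (\<lambda>i. \<sigma> i y))"
  using assms(2) by induction (auto intro: polyfam_intros polyfam_embed assms)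

lemma sum_list_product:
  "(\<Sum>x\<leftarrow>xs. f x) * (\<Sum>y\<leftarrow>ys. g y) = (\<Sum>(x, y)\<leftarrow>List.product xs ys. f x * g y :: 'a::comm_ring_1)"
  by (induction xs) (simp_all add: distrib_right sum_list_const_mult comp_def)

text \<open>
  A polynomial family is a finite combination of fixed elements with polynomial coefficients. This
  is how linear maps are applied to families.
\<close>

lemma polyfam_expand:
  assumes "scalar_hom \<iota>" "polyfam \<iota> Q"
  shows "\<exists>gs. (\<forall>(g, c)\<in>set gs. polyfun g) \<and> (\<forall>x. Q x = (\<Sum>(g, c)\<leftarrow>gs. \<iota> (g x) * c))"
  using assms(2)
proof induction
  case (const c)
  show ?case by (rule exI[of _ "[(\<lambda>x. 1, c)]"]) (use assms(1) in \<open>auto simp: scalar_hom_def intro: polyfam_intros\<close>)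
next
  case (coord i)
  show ?case by (rule exI[of _ "[(\<lambda>x. x i, 1)]"]) (auto intro: polyfam_intros)
next
  case (add f g)
  then obtain as bs where "\<forall>(g, c)\<in>set as. polyfun g" "\<forall>x. f x = (\<Sum>(g, c)\<leftarrow>as. \<iota> (g x) * c)"
    "\<forall>(g, c)\<in>set bs. polyfun g" "\<forall>x. g x = (\<Sum>(g, c)\<leftarrow>bs. \<iota> (g x) * c)" by blast
  then show ?case by (intro exI[of _ "as @ bs"]) auto
next
  case (mult f g)
  then obtain as bs where as: "\<forall>(g, c)\<in>set as. polyfun g" "\<forall>x. f x = (\<Sum>(g, c)\<leftarrow>as. \<iota> (g x) * c)"
    and bs: "\<forall>(g, c)\<in>set bs. polyfun g" "\<forall>x. g x = (\<Sum>(g, c)\<leftarrow>bs. \<iota> (g x) * c)" by blast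
  let ?m = "\<lambda>(a, b). (\<lambda>x. fst a x * fst b x, snd a * snd b)"
  have "f x * g x = (\<Sum>(g, c)\<leftarrow>map ?m (List.product as bs). \<iota> (g x) * c)" for x
    using as(2) bs(2) assms(1)
    by (simp add: sum_list_product case_prod_unfold comp_def scalar_hom_def ac_simps)
  moreover have "\<forall>(g, c)\<in>set (map ?m (List.product as bs)). polyfun g"
    using as(1) bs(1) by (auto intro!: polyfam.mult)
  ultimately show ?case by blast
qed

lemma polyfam_linear:
  assumes "scalar_hom \<iota>" "scalar_hom \<iota>'" "polyfam \<iota> Q"
    and T: "\<And>a b. T (a + b) = T a + T b" "\<And>r a. T (\<iota> r * a) = \<iota>' r * T a"
  shows "polyfam \<iota>' (\<lambda>x. T (Q x))"
proof -
  obtain gs where gs: "\<forall>(g, c)\<in>set gs. polyfun g" "\<forall>x. Q x = (\<Sum>(g, c)\<leftarrow>gs. \<iota> (g x) * c)"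
    using polyfam_expand[OF assms(1,3)] by blast
  have T0: "T 0 = 0" using T(1)[of 0 0] by simp
  have "T (\<Sum>(g, c)\<leftarrow>as. \<iota> (g x) * c) = (\<Sum>(g, c)\<leftarrow>as. \<iota>' (g x) * T c)"
    for x :: "nat \<Rightarrow> 'a" and as by (induction as) (auto simp: T T0)
  then have "(\<lambda>x. T (Q x)) = (\<lambda>x. \<Sum>(g, c)\<leftarrow>gs. \<iota>' (g x) * T c)" using gs(2) by auto
  moreover have "polyfam \<iota>' (\<lambda>x. \<Sum>(g, c)\<leftarrow>gs. \<iota>' (g x) * T c)"
    using gs(1) by (induction gs) (auto intro!: polyfam_intros polyfam_embed assms(2))
  ultimately show ?thesis by simp
qed

text \<open>
  Parameter \<open>0\<close> is singled out as the variable of a genuine polynomial, so that coefficients with respect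
  to it can be taken while the other parameters stay free.
\<close>

lemma polyfun_as_poly:
  assumes "polyfun \<Phi>"
  shows "\<exists>q. polyfam (\<lambda>a. [:a:]) q \<and> (\<forall>t x. \<Phi> (case_nat t x) = poly (q x) t)"
  using assms
proof induction
  case (const c)
  show ?case by (rule exI[of _ "\<lambda>x. [:c:]"]) (auto intro: polyfam_intros)
next
  case (coord i)
  show ?case
  proof (cases i)
    case 0
    then show ?thesis by (intro exI[of _ "\<lambda>x. [:0, 1:]"]) (auto intro: polyfam_intros)
  next
    case (Suc j)
    then show ?thesis by (intro exI[of _ "\<lambda>x. [:x j:]"]) (auto intro: polyfam_intros)
  qed
next
  case (add f g)
  then obtain p q where "polyfam (\<lambda>a. [:a:]) p" "\<forall>t x. f (case_nat t x) = poly (p x) t"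
    "polyfam (\<lambda>a. [:a:]) q" "\<forall>t x. g (case_nat t x) = poly (q x) t" by blast
  then show ?case by (intro exI[of _ "\<lambda>x. p x + q x"]) (auto intro: polyfam_intros)
next
  case (mult f g)
  then obtain p q where "polyfam (\<lambda>a. [:a:]) p" "\<forall>t x. f (case_nat t x) = poly (p x) t"
    "polyfam (\<lambda>a. [:a:]) q" "\<forall>t x. g (case_nat t x) = poly (q x) t" by blast
  then show ?case by (intro exI[of _ "\<lambda>x. p x * q x"]) (auto intro: polyfam_intros)
qed

definition the_poly :: "('k::field_char_0 \<Rightarrow> 'k) \<Rightarrow> 'k poly" where
  "the_poly g = (THE q. \<forall>t. poly q t = g t)"

lemma the_poly_eq: "(\<And>t. g t = poly q t) \<Longrightarrow> the_poly g = (q :: 'k::field_char_0 poly)"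
  unfolding the_poly_def by (rule the_equality) (auto simp: poly_eq_poly_eq_iff[symmetric])

lemma poly_eqI_eval: "(\<And>t. poly p t = poly q t) \<Longrightarrow> p = (q :: 'k::field_char_0 poly)"
  by (simp add: poly_eq_poly_eq_iff[symmetric] fun_eq_iff)

lemma poly_zero_off_0:
  assumes "\<And>t. t \<noteq> 0 \<Longrightarrow> poly p t = (0 :: 'k::field_char_0)"
  shows "p = 0"
proof -
  have "[:0, 1:] * p = 0" by (rule poly_eqI_eval) (use assms in auto)
  then show ?thesis by simp
qed

section \<open>The semigroup of points\<close>

text \<open>
  The point \<open>(\<lambda>,(Q,R))\<close> stands for the polynomial \<open>(x + \<Delta>\<lambda>) Q(x) + \<Delta>(\<Delta> - 1) R(x,\<Delta>)\<close>, the symbol of an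
  element of \<open>U(3)\<close> at \<open>\<partial> = -\<lambda>\<close>. The coordinates \<open>Q\<close> and \<open>R\<close> are unconstrained, which the polynomial
  itself is not. In \<open>R\<close> the outer variable is \<open>x\<close> and the inner one \<open>\<Delta>\<close>.
\<close>

type_synonym 'k fibre = "'k poly \<times> 'k poly poly"
type_synonym 'k pt = "'k \<times> 'k fibre"

definition fscale :: "'k::comm_ring_1 \<Rightarrow> 'k fibre \<Rightarrow> 'k fibre" where
  "fscale r a = ([:r:] * fst a, [:[:r:]:] * snd a)"

definition shift_poly :: "'k::comm_ring_1 \<Rightarrow> 'k poly \<Rightarrow> 'k poly" where
  "shift_poly l Q = pcompose Q [:l, 1:]"

definition shift_poly2 :: "'k::comm_ring_1 \<Rightarrow> 'k poly poly \<Rightarrow> 'k poly poly" where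
  "shift_poly2 l R = pcompose R [:[:l:], 1:]"

definition const_poly :: "'k::comm_ring_1 poly \<Rightarrow> 'k poly poly" where
  "const_poly Q = map_poly (\<lambda>a. [:a:]) Q"

definition poly2 :: "'k::comm_ring_1 poly poly \<Rightarrow> 'k \<Rightarrow> 'k \<Rightarrow> 'k" where
  "poly2 R x d = poly (poly R [:x:]) d"

text \<open>
  The coordinates of \<open>P(x) P'(x + \<lambda>)\<close>, see \<open>pval_pmult\<close>. The term with \<open>\<lambda>\<mu>\<close> in the second coordinate comes from
  \<open>(x + \<Delta>\<lambda>)(x + \<lambda> + \<Delta>\<mu>) = (x + \<Delta>(\<lambda> + \<mu>))(x + \<lambda>) + \<Delta>(\<Delta> - 1)\<lambda>\<mu>\<close>.
\<close>

fun pmult :: "'k::comm_ring_1 pt \<Rightarrow> 'k pt \<Rightarrow> 'k pt" (infixl "\<odot>" 70) where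
  "(l, (Q, R)) \<odot> (m, (Q', R')) = (l + m,
     (Q * [:l, 1:] * shift_poly l Q',
      [:[:l * m:]:] * const_poly Q * const_poly (shift_poly l Q')
      + [:[:0, l:], 1:] * const_poly Q * shift_poly2 l R'
      + R * [:[:l, m:], 1:] * const_poly (shift_poly l Q')
      + [:[:0, -1, 1:]:] * R * shift_poly2 l R'))"

definition pval :: "'k::comm_ring_1 pt \<Rightarrow> 'k \<Rightarrow> 'k \<Rightarrow> 'k" where
  "pval s x d = (x + d * fst s) * poly (fst (snd s)) x + d * (d - 1) * poly2 (snd (snd s)) x d"

lemma poly2_simps [simp]:
  "poly2 0 x d = 0" "poly2 1 x d = 1"
  "poly2 (R + R') x d = poly2 R x d + poly2 R' x d"
  "poly2 (R - R') x d = poly2 R x d - poly2 R' x d"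
  "poly2 (- R) x d = - poly2 R x d"
  "poly2 (R * R') x d = poly2 R x d * poly2 R' x d"
  "poly2 (pCons u R) x d = poly u d + x * poly2 R x d"
  "poly2 (smult u R) x d = poly u d * poly2 R x d"
  by (simp_all add: poly2_def)

lemma poly2_const_poly [simp]: "poly2 (const_poly Q) x d = poly Q x"
  by (induction Q) (simp_all add: const_poly_def map_poly_pCons)

lemma poly_shift_poly [simp]: "poly (shift_poly l Q) x = poly Q (x + l)"
  by (simp add: shift_poly_def poly_pcompose add.commute)

lemma poly2_shift_poly2 [simp]: "poly2 (shift_poly2 l R) x d = poly2 R (x + l) d"
  by (simp add: shift_poly2_def poly2_def poly_pcompose add.commute)

lemma fst_pmult [simp]: "fst (s \<odot> t) = fst s + fst t"
  by (cases s; cases t) auto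

lemma pval_pmult: "pval (s \<odot> t) x d = pval s x d * pval t (x + fst s) d"
proof -
  obtain l Q R m Q' R' where st: "s = (l, (Q, R))" "t = (m, (Q', R'))" by (metis surj_pair)
  show ?thesis unfolding st pval_def by (simp add: algebra_simps)
qed

text \<open>
  The two excluded values of \<open>\<Delta>\<close> are the zeros of \<open>\<Delta>(\<Delta> - 1)\<close>, by which \<open>R\<close> is multiplied in \<open>pval\<close>.
\<close>

lemma poly2_eqI:
  assumes "\<And>x d. d \<noteq> 0 \<Longrightarrow> d \<noteq> 1 \<Longrightarrow> poly2 R x d = poly2 R' x (d :: 'k::field_char_0)"
  shows "R = R'"
proof -
  let ?R = "R - R'"
  have "poly ?R [:x:] = 0" for x
  proof -
    have "[:0, -1, 1:] * poly ?R [:x:] = 0"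
    proof (rule poly_eqI_eval)
      fix t show "poly ([:0, -1, 1:] * poly ?R [:x:]) t = poly 0 t"
        using assms[of t x] by (cases "t = 0"; cases "t = 1") (simp_all add: poly2_def)
    qed
    then show ?thesis by (simp only: mult_eq_0_iff) simp
  qed
  then have "range (\<lambda>x::'k. [:x:]) \<subseteq> {z. poly ?R z = 0}" by blast
  moreover have "infinite (range (\<lambda>x::'k. [:x:]))"
    by (subst finite_image_iff) (auto simp: inj_def infinite_UNIV_char_0)
  ultimately have "infinite {z. poly ?R z = 0}" using finite_subset by blast
  then have "?R = 0" using poly_roots_finite by blast
  then show ?thesis by simp
qed

text \<open>
  At \<open>\<Delta> = 0\<close> only \<open>x Q(x)\<close> is left, so the values determine \<open>Q\<close> first and then \<open>R\<close>. Identities between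
  points are therefore proved by comparing values.
\<close>

lemma pval_inj:
  assumes "fst s = fst t" "\<And>x d. pval s x d = pval t x (d :: 'k::field_char_0)"
  shows "s = t"
proof -
  obtain l Q R Q' R' where st: "s = (l, (Q, R))" "t = (l, (Q', R'))" using assms(1) by (metis surj_pair fst_conv)
  have "[:0, 1:] * Q = [:0, 1:] * Q'"
    by (rule poly_eqI_eval) (use assms(2)[of _ 0] in \<open>auto simp: st pval_def\<close>)
  then have Q: "Q = Q'" by simp
  have "R = R'" by (rule poly2_eqI) (use assms(2) in \<open>auto simp: st Q pval_def\<close>)
  with Q show ?thesis by (simp add: st)
qed

lemma pmult_assoc: "(s \<odot> t) \<odot> w = s \<odot> (t \<odot> w :: 'k::field_char_0 pt)"
  by (rule pval_inj) (simp_all add: pval_pmult ac_simps)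

lemma pval_fibre_add: "pval (l, a + b) x d = pval (l, a) x d + pval (l, b) x d"
  by (simp add: pval_def algebra_simps)

lemma pval_fibre_scale: "pval (l, fscale r a) x d = r * pval (l, a) x d"
  by (simp add: pval_def fscale_def algebra_simps)


lemma pmult_snd: "(l + fst t, snd ((l, a) \<odot> t)) = (l, a) \<odot> t" "(fst s + l, snd (s \<odot> (l, a))) = s \<odot> (l, a)"
  by (simp_all add: prod_eq_iff)

lemma pmult_linear:
  fixes t :: "'k::field_char_0 pt"
  shows "(l, a + b) \<odot> t = (l + fst t, snd ((l, a) \<odot> t) + snd ((l, b) \<odot> t))"
    and "(l, fscale r a) \<odot> t = (l + fst t, fscale r (snd ((l, a) \<odot> t)))"
    and "t \<odot> (l, a + b) = (fst t + l, snd (t \<odot> (l, a)) + snd (t \<odot> (l, b)))"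
    and "t \<odot> (l, fscale r a) = (fst t + l, fscale r (snd (t \<odot> (l, a))))"
  by (rule pval_inj; simp add: pval_pmult pval_fibre_add pval_fibre_scale pmult_snd
      distrib_left distrib_right mult.left_commute mult.assoc)+

subsection \<open>The module of polynomials in \<Delta>\<close>

text \<open>
  The module \<open>D\<close> has the fibre \<open>k[\<Delta>]\<close> over every \<open>\<lambda>\<close>. Its element \<open>u\<close> over \<open>\<lambda>\<close> is encoded as the point with
  coordinates \<open>Q = 0\<close> and \<open>R = u\<close>, so that a cochain with first argument in \<open>D\<close> is again a function of a list of
  points; the head of the list carries the action \<open>\<triangleleft>\<close> in place of the product.
\<close>

definition Dpt :: "'k::comm_ring_1 \<Rightarrow> 'k poly \<Rightarrow> 'k pt" where
  "Dpt l u = (l, (0, [:u:]))"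

definition Dval :: "'k::comm_ring_1 pt \<Rightarrow> 'k poly" where
  "Dval h = poly (snd (snd h)) 0"

definition slice :: "'k::comm_ring_1 pt \<Rightarrow> 'k \<Rightarrow> 'k poly" where
  "slice s l = [:l, fst s:] * [:poly (fst (snd s)) l:] + [:0, -1, 1:] * poly (snd (snd s)) [:l:]"

text \<open>
  The module arises from all polynomials by setting \<open>x = 0\<close>, where the product \<open>P(x) P'(x + \<lambda>)\<close> becomes
  \<open>P(0) P'(\<lambda>)\<close>: a point acts by its polynomial at \<open>x = \<lambda>\<close>.
\<close>

definition Dact :: "'k::comm_ring_1 pt \<Rightarrow> 'k pt \<Rightarrow> 'k pt" (infixl "\<triangleleft>" 70) where
  "h \<triangleleft> s = Dpt (fst h + fst s) (Dval h * slice s (fst h))"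

lemma Dpt_simps [simp]: "fst (Dpt l u) = l" "Dval (Dpt l u) = u"
  by (simp_all add: Dpt_def Dval_def)

lemma Dpt_linear: "Dpt l (u + w) = (l, snd (Dpt l u) + snd (Dpt l w))"
  "Dpt l (smult r u) = (l, fscale r (snd (Dpt l u)))"
  by (simp_all add: Dpt_def fscale_def)

lemma Dpt_snd: "(l, snd (Dpt l u)) = Dpt l u"
  by (simp add: Dpt_def)

lemma Dval_linear [simp]: "Dval (l, a + b) = Dval (l, a) + Dval (l, b)" "Dval (l, fscale r a) = smult r (Dval (l, a))"
  by (simp_all add: Dval_def fscale_def)

lemma poly_slice [simp]: "poly (slice s l) d = pval s l d"
  by (simp add: slice_def pval_def poly2_def algebra_simps)

lemma slice_pmult: "slice (s \<odot> t) l = slice s l * slice t (l + fst (s :: 'k::field_char_0 pt))"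
  by (rule poly_eqI_eval) (simp add: pval_pmult)

lemma slice_linear:
  fixes a :: "'k::field_char_0 fibre"
  shows "slice (m, a + b) l = slice (m, a) l + slice (m, b) l"
    "slice (m, fscale r a) l = smult r (slice (m, a) l)"
  by (rule poly_eqI_eval; simp add: pval_fibre_add pval_fibre_scale)+

lemma Dact_assoc: "(h \<triangleleft> s) \<triangleleft> t = h \<triangleleft> (s \<odot> t :: 'k::field_char_0 pt)"
  by (simp add: Dact_def slice_pmult ac_simps)

lemma fst_Dact [simp]: "fst (h \<triangleleft> s) = fst h + fst s"
  by (simp add: Dact_def)

section \<open>Cochains\<close>

text \<open>
  A function of points is called smooth when it is polynomial along every family of points that is polynomial
  in parameters. Tested on families, smoothness is inherited by all the operations on cochains below,
  because each of them only composes with maps that send plots to plots.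
\<close>

definition plot :: "((nat \<Rightarrow> 'k) \<Rightarrow> 'k::field_char_0 pt) \<Rightarrow> bool" where
  "plot s \<longleftrightarrow> polyfun (\<lambda>x. fst (s x)) \<and> polyfam (\<lambda>a. [:a:]) (\<lambda>x. fst (snd (s x)))
     \<and> polyfam (\<lambda>a. [:[:a:]:]) (\<lambda>x. snd (snd (s x)))"

lemma polyfam_embeds:
  "polyfun g \<Longrightarrow> polyfam (\<lambda>a. [:a:]) (\<lambda>x. [:g x:])"
  "polyfun g \<Longrightarrow> polyfam (\<lambda>a. [:[:a:]:]) (\<lambda>x. [:[:g x:]:])"
  using polyfam_embed[of "\<lambda>a. [:a:]" g] polyfam_embed[of "\<lambda>a. [:[:a:]:]" g] by auto

lemma polyfam_poly:
  assumes "polyfam (\<lambda>a. [:a:]) Q" "polyfun l"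
  shows "polyfun (\<lambda>x. poly (Q x) (l x))"
proof (rule polyfam_ring_hom[OF assms(1)])
  show "polyfun (\<lambda>x. poly c (l x))" for c
    by (induction c) (auto intro!: polyfam_intros assms(2))
qed auto

lemma polyfam_poly2:
  assumes "polyfam (\<lambda>a. [:[:a:]:]) R" "polyfun l"
  shows "polyfam (\<lambda>a. [:a:]) (\<lambda>x. poly (R x) [:l x:])"
proof (rule polyfam_ring_hom[OF assms(1)])
  show "polyfam (\<lambda>a. [:a:]) (\<lambda>x. poly c [:l x:])" for c
    by (induction c) (auto intro!: polyfam.add polyfam.mult polyfam.const polyfam_embeds assms(2) simp del: mult_pCons_left mult_pCons_right)
qed auto

lemma polyfam_linear_poly: "polyfun l \<Longrightarrow> polyfun m \<Longrightarrow> polyfam (\<lambda>a. [:a:]) (\<lambda>x. [:l x, m x:])"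
proof -
  assume "polyfun l" "polyfun m"
  then have "polyfam (\<lambda>a. [:a:]) (\<lambda>x. [:l x:] + [:0, 1:] * [:m x:])"
    by (intro polyfam.add polyfam.mult polyfam.const polyfam_embeds) auto
  then show ?thesis by simp
qed

lemma polyfam_const_poly:
  fixes Q :: "(nat \<Rightarrow> 'k::field_char_0) \<Rightarrow> 'k poly"
  assumes "polyfam (\<lambda>a. [:a:]) Q"
  shows "polyfam (\<lambda>a. [:[:a:]:]) (\<lambda>x. const_poly (Q x))"
proof (rule polyfam_ring_hom[OF assms])
  show "const_poly (a + b) = const_poly a + const_poly b" "const_poly (a * b) = const_poly a * const_poly b"
    for a b :: "'k poly" by (rule poly2_eqI; simp)+
qed (auto intro: polyfam.const simp: const_poly_def map_poly_pCons)

lemma polyfam_const_poly_1: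
  assumes "polyfam (\<lambda>a. [:a:]) u"
  shows "polyfam (\<lambda>a. [:[:a:]:]) (\<lambda>x. [:u x:])"
  by (rule polyfam_ring_hom[OF assms]) (auto intro: polyfam.const)

lemma polyfam_shift_poly:
  assumes "polyfam (\<lambda>a. [:a:]) Q" "polyfun l"
  shows "polyfam (\<lambda>a. [:a:]) (\<lambda>x. shift_poly (l x) (Q x))"
proof (rule polyfam_ring_hom[OF assms(1)])
  show "polyfam (\<lambda>a. [:a:]) (\<lambda>x. shift_poly (l x) c)" for c
    by (induction c) (auto intro!: polyfam.add polyfam.mult polyfam.const polyfam_linear_poly assms(2)
        simp: shift_poly_def pcompose_pCons simp del: mult_pCons_left mult_pCons_right)
qed (auto simp: shift_poly_def pcompose_add pcompose_mult pcompose_pCons)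

lemma polyfam_shift_poly2:
  assumes "polyfam (\<lambda>a. [:[:a:]:]) R" "polyfun l"
  shows "polyfam (\<lambda>a. [:[:a:]:]) (\<lambda>x. shift_poly2 (l x) (R x))"
proof (rule polyfam_ring_hom[OF assms(1)])
  have "polyfam (\<lambda>a. [:[:a:]:]) (\<lambda>x. [:[:l x:]:] + [:0, 1:])"
    by (intro polyfam.add polyfam.const polyfam_embeds assms(2))
  then show "polyfam (\<lambda>a. [:[:a:]:]) (\<lambda>x. shift_poly2 (l x) c)" for c
    by (induction c) (auto intro!: polyfam.add polyfam.mult polyfam.const
        simp: shift_poly2_def pcompose_pCons simp del: mult_pCons_left mult_pCons_right)
qed (auto simp: shift_poly2_def pcompose_add pcompose_mult pcompose_pCons)

lemma plot_pmult: assumes "plot s" "plot t" shows "plot (\<lambda>x. s x \<odot> t x)"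
proof -
  define l Q R m Q' R' where "l x = fst (s x)" and "Q x = fst (snd (s x))" and "R x = snd (snd (s x))"
    and "m x = fst (t x)" and "Q' x = fst (snd (t x))" and "R' x = snd (snd (t x))" for x
  have st: "s x = (l x, (Q x, R x))" "t x = (m x, (Q' x, R' x))" for x
    by (simp_all add: l_def Q_def R_def m_def Q'_def R'_def)
  note P = assms[unfolded plot_def, folded l_def Q_def R_def m_def Q'_def R'_def]
  have [intro]: "polyfun l" "polyfun m" "polyfam (\<lambda>a. [:a:]) Q" "polyfam (\<lambda>a. [:a:]) Q'"
    "polyfam (\<lambda>a. [:[:a:]:]) R" "polyfam (\<lambda>a. [:[:a:]:]) R'" using P by auto
  have lin: "polyfam (\<lambda>a. [:[:a:]:]) (\<lambda>x. [:[:f x, g x:], 1:])" if "polyfun f" "polyfun g" for f g :: "(nat \<Rightarrow> 'a) \<Rightarrow> 'a"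
  proof -
    have "polyfam (\<lambda>a. [:[:a:]:]) (\<lambda>x. [:[:f x, g x:]:] + [:0, 1:])"
      using that by (intro polyfam.add polyfam.const polyfam_const_poly_1 polyfam_linear_poly)
    then show ?thesis by simp
  qed
  have "polyfam (\<lambda>a. [:[:a:]:]) (\<lambda>x. [:[:l x * m x:]:])"
    by (intro polyfam_embeds polyfam.mult) auto
  then show ?thesis
    unfolding plot_def st pmult.simps fst_conv snd_conv
    by (auto simp del: mult_pCons_left mult_pCons_right intro!: polyfam.add polyfam.mult polyfam.const polyfam_linear_poly
        polyfam_shift_poly polyfam_const_poly polyfam_shift_poly2 lin)
qed

lemma plot_Dpt: "polyfun l \<Longrightarrow> polyfam (\<lambda>a. [:a:]) u \<Longrightarrow> plot (\<lambda>x. Dpt (l x) (u x))"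
  by (auto simp: plot_def Dpt_def intro: polyfam.const polyfam_const_poly_1)

lemma plot_Dval: "plot s \<Longrightarrow> polyfam (\<lambda>a. [:a:]) (\<lambda>x. Dval (s x))"
  using polyfam_poly2[of "\<lambda>x. snd (snd (s x))" "\<lambda>x. 0"] by (auto simp: plot_def Dval_def intro: polyfam.const)

lemma plot_slice: "plot s \<Longrightarrow> polyfun l \<Longrightarrow> polyfam (\<lambda>a. [:a:]) (\<lambda>x. slice (s x) (l x))"
  unfolding plot_def slice_def
  by (intro polyfam.add polyfam.mult polyfam.const polyfam_linear_poly polyfam_embeds polyfam_poly polyfam_poly2) auto

lemma plot_Dact: "plot s \<Longrightarrow> plot t \<Longrightarrow> plot (\<lambda>x. s x \<triangleleft> t x)"
  unfolding Dact_def
  by (intro plot_Dpt polyfam.add polyfam.mult plot_Dval plot_slice) (auto simp: plot_def)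

lemma plot_const: "plot (\<lambda>x. s)"
  by (auto simp: plot_def intro: polyfam.const)

lemma plot_subst: "plot s \<Longrightarrow> (\<And>i. polyfun (\<sigma> i)) \<Longrightarrow> plot (\<lambda>y. s (\<lambda>i. \<sigma> i y))"
  by (auto simp: plot_def intro!: polyfam_subst[of "\<lambda>a. a" "\<lambda>x. fst (s x)"]
     polyfam_subst[of "\<lambda>a. [:a:]" "\<lambda>x. fst (snd (s x))"] polyfam_subst[of "\<lambda>a. [:[:a:]:]" "\<lambda>x. snd (snd (s x))"])

definition multilinear :: "nat \<Rightarrow> ('k::field_char_0 pt list \<Rightarrow> 'k) \<Rightarrow> bool" where
  "multilinear n F \<longleftrightarrow>
     (\<forall>L i l a b. length L = n \<longrightarrow> i < n \<longrightarrow> F (L[i := (l, a + b)]) = F (L[i := (l, a)]) + F (L[i := (l, b)])) \<and>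
     (\<forall>L i l r a. length L = n \<longrightarrow> i < n \<longrightarrow> F (L[i := (l, fscale r a)]) = r * F (L[i := (l, a)]))"

definition smooth :: "nat \<Rightarrow> ((nat \<Rightarrow> 'k) \<Rightarrow> 'k::field_char_0 pt list \<Rightarrow> 'k) \<Rightarrow> bool" where
  "smooth n F \<longleftrightarrow> (\<forall>ss. length ss = n \<longrightarrow> (\<forall>s\<in>set ss. plot s) \<longrightarrow> polyfun (\<lambda>x. F x (map (\<lambda>s. s x) ss)))"

lemma multilinearD:
  "multilinear n F \<Longrightarrow> length L = n \<Longrightarrow> i < n \<Longrightarrow> F (L[i := (l, a + b)]) = F (L[i := (l, a)]) + F (L[i := (l, b)])"
  "multilinear n F \<Longrightarrow> length L = n \<Longrightarrow> i < n \<Longrightarrow> F (L[i := (l, fscale c a)]) = c * F (L[i := (l, a)])"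
  by (simp_all only: multilinear_def)

lemma multilinear_head:
  assumes "multilinear (Suc n) F"
  shows "length r = n \<Longrightarrow> F ((l, a + b) # r) = F ((l, a) # r) + F ((l, b) # r)"
    and "length r = n \<Longrightarrow> F ((l, fscale c a) # r) = c * F ((l, a) # r)"
    and "multilinear n (\<lambda>r. F (s # r))"
proof -
  show "length r = n \<Longrightarrow> F ((l, a + b) # r) = F ((l, a) # r) + F ((l, b) # r)"
    using multilinearD(1)[OF assms, of "(l, a) # r" 0] by simp
  show "length r = n \<Longrightarrow> F ((l, fscale c a) # r) = c * F ((l, a) # r)"
    using multilinearD(2)[OF assms, of "(l, a) # r" 0] by simp
  show "multilinear n (\<lambda>r. F (s # r))"
    unfolding multilinear_def
    using multilinearD[OF assms, of "s # _" "Suc _"] by (simp del: split_paired_All)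
qed

lemma multilinear_SucI:
  assumes add: "\<And>r l a b. length r = n \<Longrightarrow> F ((l, a + b) # r) = F ((l, a) # r) + F ((l, b) # r)"
    and scale: "\<And>r l c a. length r = n \<Longrightarrow> F ((l, fscale c a) # r) = c * F ((l, a) # r)"
    and tail: "\<And>s. multilinear n (\<lambda>r. F (s # r))"
  shows "multilinear (Suc n) F"
  unfolding multilinear_def
proof (intro conjI allI impI)
  fix L :: "'a pt list" and i l a b c
  assume L: "length L = Suc n" "i < Suc n"
  then obtain s r where sr: "L = s # r" "length r = n" by (cases L) auto
  show "F (L[i := (l, a + b)]) = F (L[i := (l, a)]) + F (L[i := (l, b)])"
    using add[of r l a b] multilinearD(1)[OF tail, of r _ s l a b] L sr by (cases i) simp_all
  show "F (L[i := (l, fscale c a)]) = c * F (L[i := (l, a)])"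
    using scale[of r l c a] multilinearD(2)[OF tail, of r _ s l c a] L sr by (cases i) simp_all
qed

text \<open>
  The alternating sum of the terms that merge two neighbours (\<open>bar_sum\<close>), by recursion on the list: the terms
  that leave the first argument alone are the differential of the cochain with that argument fixed.
\<close>

fun bar :: "('k::field_char_0 pt list \<Rightarrow> 'k) \<Rightarrow> 'k pt list \<Rightarrow> 'k" where
  "bar F (s # t # r) = F (s \<odot> t # r) - bar (\<lambda>r. F (s # r)) (t # r)"
| "bar F _ = 0"

fun Dbar :: "('k::field_char_0 pt list \<Rightarrow> 'k) \<Rightarrow> 'k pt list \<Rightarrow> 'k" where
  "Dbar F (h # s # r) = F (h \<triangleleft> s # r) - bar (\<lambda>r. F (h # r)) (s # r)"
| "Dbar F _ = 0"

text \<open>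
  A reduced cochain is a function of lists of points with \<open>lambda_sum\<close> zero. Functions are defined on all
  lists, and identities are asserted for lists with this sum.
\<close>

definition lambda_sum :: "'k::comm_ring_1 pt list \<Rightarrow> 'k" where
  "lambda_sum L = sum_list (map fst L)"

lemma lambda_sum_simps [simp]: "lambda_sum [] = 0" "lambda_sum (s # r) = fst s + lambda_sum r" "lambda_sum (r @ r') = lambda_sum r + lambda_sum r'"
  by (simp_all add: lambda_sum_def)

definition cochain :: "nat \<Rightarrow> ('k::field_char_0 pt list \<Rightarrow> 'k) \<Rightarrow> bool" where
  "cochain n F \<longleftrightarrow> multilinear n F \<and> smooth n (\<lambda>x. F)"

text \<open>
  Merging keeps the sum of the \<open>\<lambda>\<close>, so \<open>bar F\<close> at a list depends on \<open>F\<close> only at shorter lists with the same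
  sum. This is what allows identities to be restricted to one value of the sum.
\<close>

lemma bar_cong:
  "(\<And>L'. Suc (length L') = length L \<Longrightarrow> lambda_sum L' = lambda_sum L \<Longrightarrow> F L' = G L') \<Longrightarrow> bar F L = bar G L"
proof (induction L arbitrary: F G rule: induct_list012)
  case (3 s t r)
  have "F (s \<odot> t # r) = G (s \<odot> t # r)" by (rule 3(3)) auto
  moreover have "bar (\<lambda>r. F (s # r)) (t # r) = bar (\<lambda>r. G (s # r)) (t # r)"
    by (rule 3(2)) (rule 3(3), auto)
  ultimately show ?case by simp
qed auto

lemma bar_zero [simp]: "bar (\<lambda>_. 0) L = 0"
  by (induction L rule: induct_list012) auto

lemma bar_zeroI: "(\<And>L'. Suc (length L') = length L \<Longrightarrow> lambda_sum L' = lambda_sum L \<Longrightarrow> F L' = 0) \<Longrightarrow> bar F L = 0"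
  using bar_cong[of L F "\<lambda>_. 0"] by simp

lemma bar_add: "bar (\<lambda>L. F L + G L) L = bar F L + bar G L"
  by (induction L arbitrary: F G rule: induct_list012) auto

lemma bar_scale: "bar (\<lambda>L. c * F L) L = c * bar F L"
  by (induction L arbitrary: F rule: induct_list012) (auto simp: algebra_simps)

lemma bar_diff: "bar (\<lambda>L. F L - G L) L = bar F L - bar G L"
  using bar_add[of F "\<lambda>L. (-1) * G L" L] bar_scale[of "-1" G L] by simp

lemma bar_bar: "bar (bar F) L = 0"
proof (induction L arbitrary: F rule: induct_list012)
  case (3 s t r)
  show ?case
  proof (cases r)
    case (Cons w r')
    define X where "X = (\<lambda>L. F (s \<odot> hd L # tl L))"
    have "bar (\<lambda>r. bar F (s # r)) (t # r) = bar (\<lambda>L. X L - bar (\<lambda>r. F (s # r)) L) (t # r)"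
    proof (rule bar_cong)
      fix L' :: "'a pt list" assume "Suc (length L') = length (t # r)"
      then show "bar F (s # L') = X L' - bar (\<lambda>r. F (s # r)) L'"
        using Cons by (cases L') (auto simp: X_def)
    qed
    also have "\<dots> = bar X (t # r)" by (simp only: bar_diff 3(2)) simp
    also have "\<dots> = F (s \<odot> (t \<odot> w) # r') - bar (\<lambda>r. F (s \<odot> t # r)) (w # r')"
      by (simp add: Cons X_def)
    finally show ?thesis by (subst bar.simps(1)) (simp only: Cons, simp add: pmult_assoc)
  qed simp
qed auto

lemma Dbar_Dbar: "Dbar (Dbar F) L = 0"
proof (cases "(Dbar F, L)" rule: Dbar.cases)
  case (1 _ h s r)
  then have L: "L = h # s # r" by simp
  show ?thesis
  proof (cases r)
    case (Cons w r')
    define X where "X = (\<lambda>L. F (h \<triangleleft> hd L # tl L))"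
    have "bar (\<lambda>r. Dbar F (h # r)) (s # r) = bar (\<lambda>L. X L - bar (\<lambda>r. F (h # r)) L) (s # r)"
    proof (rule bar_cong)
      fix L' :: "'a pt list" assume "Suc (length L') = length (s # r)"
      then show "Dbar F (h # L') = X L' - bar (\<lambda>r. F (h # r)) L'"
        using Cons by (cases L') (auto simp: X_def)
    qed
    also have "\<dots> = bar X (s # r)" by (simp only: bar_diff bar_bar) simp
    also have "\<dots> = F (h \<triangleleft> (s \<odot> w) # r') - bar (\<lambda>r. F (h \<triangleleft> s # r)) (w # r')"
      by (simp add: Cons X_def)
    finally show ?thesis unfolding L by (subst Dbar.simps(1)) (simp only: Cons, simp add: Dact_assoc)
  qed (simp add: L)
qed auto

subsection \<open>Closure properties\<close>

lemma multilinear_cong: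
  assumes "multilinear n F" "\<And>L. length L = n \<Longrightarrow> G L = F L"
  shows "multilinear n G"
  unfolding multilinear_def using multilinearD[OF assms(1)] assms(2) by (simp del: split_paired_All)

lemma multilinear_0 [simp]: "multilinear 0 F"
  by (simp add: multilinear_def)

lemma multilinear_add: "multilinear n F \<Longrightarrow> multilinear n G \<Longrightarrow> multilinear n (\<lambda>L. F L + G L)"
  unfolding multilinear_def by (simp add: algebra_simps del: split_paired_All)

lemma multilinear_scale: "multilinear n F \<Longrightarrow> multilinear n (\<lambda>L. c * F L)"
  unfolding multilinear_def by (simp add: algebra_simps del: split_paired_All)

lemma multilinear_diff: "multilinear n F \<Longrightarrow> multilinear n G \<Longrightarrow> multilinear n (\<lambda>L. F L - G L)"
  using multilinear_add[of n F "\<lambda>L. (-1) * G L"] multilinear_scale[of n G "-1"] by simp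

text \<open>
  The value at \<open>(l, a)\<close> lies over a \<open>\<lambda>\<close> that may differ from \<open>l\<close> but not depend on \<open>a\<close>, as for the product
  with a fixed point.
\<close>

definition fibre_linear :: "('k::field_char_0 pt \<Rightarrow> 'k pt) \<Rightarrow> bool" where
  "fibre_linear g \<longleftrightarrow>
     (\<forall>l a b. g (l, a + b) = (fst (g (l, a)), snd (g (l, a)) + snd (g (l, b)))) \<and>
     (\<forall>l a b. fst (g (l, a)) = fst (g (l, b))) \<and>
     (\<forall>l c a. g (l, fscale c a) = (fst (g (l, a)), fscale c (snd (g (l, a)))))"

lemma fibre_linear_apply:
  assumes "multilinear (Suc n) F" "fibre_linear g" "length r = n"
  shows "F (g (l, a + b) # r) = F (g (l, a) # r) + F (g (l, b) # r)"
    and "F (g (l, fscale c a) # r) = c * F (g (l, a) # r)"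
proof -
  have g: "g (l, a + b) = (fst (g (l, a)), snd (g (l, a)) + snd (g (l, b)))"
    "g (l, fscale c a) = (fst (g (l, a)), fscale c (snd (g (l, a))))" "fst (g (l, b)) = fst (g (l, a))"
    using assms(2) unfolding fibre_linear_def by blast+
  have gb: "(fst (g (l, a)), snd (g (l, b))) = g (l, b)" using g(3) by (simp add: prod_eq_iff)
  show "F (g (l, a + b) # r) = F (g (l, a) # r) + F (g (l, b) # r)"
    by (simp only: g(1) multilinear_head(1,2)[OF assms(1,3)] gb prod.collapse)
  show "F (g (l, fscale c a) # r) = c * F (g (l, a) # r)"
    by (simp only: g(2) multilinear_head(1,2)[OF assms(1,3)] prod.collapse)
qed

lemma fibre_linear_pmult: "fibre_linear (\<lambda>s. s \<odot> t)" "fibre_linear (\<lambda>t. s \<odot> t)"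
  by (simp_all add: fibre_linear_def pmult_linear del: split_paired_All)

lemma fibre_linear_Dact: "fibre_linear (\<lambda>h. h \<triangleleft> t)" "fibre_linear (\<lambda>t. h \<triangleleft> t)"
  by (simp_all add: fibre_linear_def Dact_def slice_linear Dpt_linear distrib_left distrib_right
      del: split_paired_All)

lemma multilinear_map_head:
  assumes "multilinear (Suc n) F" "fibre_linear g"
  shows "multilinear (Suc n) (\<lambda>L. F (g (hd L) # tl L))"
  by (rule multilinear_SucI)
    (simp_all add: fibre_linear_apply[OF assms] multilinear_head(3)[OF assms(1)] del: split_paired_All)

lemma multilinear_bar: "multilinear n F \<Longrightarrow> multilinear (Suc n) (bar F)"
proof (induction n arbitrary: F)
  case 0
  show ?case by (rule multilinear_SucI) simp_all
next
  case (Suc n)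
  note lin = multilinear_head[OF Suc.prems]
  show ?case
  proof (rule multilinear_SucI)
    fix r :: "'a pt list" and l a b c assume "length r = Suc n"
    then obtain t r' where r: "r = t # r'" "length r' = n" by (cases r) auto
    have "bar (\<lambda>r. F ((l, a + b) # r)) r = bar (\<lambda>r. F ((l, a) # r) + F ((l, b) # r)) r"
      by (rule bar_cong) (use r in \<open>simp add: lin\<close>)
    then show "bar F ((l, a + b) # r) = bar F ((l, a) # r) + bar F ((l, b) # r)"
      by (simp add: r bar_add fibre_linear_apply[OF Suc.prems fibre_linear_pmult(1) r(2)])
    have "bar (\<lambda>r. F ((l, fscale c a) # r)) r = bar (\<lambda>r. c * F ((l, a) # r)) r"
      by (rule bar_cong) (use r in \<open>simp add: lin\<close>)
    then show "bar F ((l, fscale c a) # r) = c * bar F ((l, a) # r)"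
      by (simp add: r bar_scale fibre_linear_apply[OF Suc.prems fibre_linear_pmult(1) r(2)] algebra_simps)
  next
    fix s :: "'a pt"
    have "multilinear (Suc n) (\<lambda>r. F (s \<odot> hd r # tl r) - bar (\<lambda>r. F (s # r)) r)"
      by (intro multilinear_diff multilinear_map_head[OF Suc.prems] fibre_linear_pmult Suc.IH lin)
    then show "multilinear (Suc n) (\<lambda>r. bar F (s # r))"
      by (rule multilinear_cong) (auto simp: length_Suc_conv)
  qed
qed

lemma multilinear_Dbar: assumes "multilinear (Suc n) F" shows "multilinear (Suc (Suc n)) (Dbar F)"
proof (rule multilinear_SucI)
  note lin = multilinear_head[OF assms]
  fix r :: "'a pt list" and l a b c assume "length r = Suc n"
  then obtain t r' where r: "r = t # r'" "length r' = n" by (cases r) auto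
  have "bar (\<lambda>r. F ((l, a + b) # r)) r = bar (\<lambda>r. F ((l, a) # r) + F ((l, b) # r)) r"
    by (rule bar_cong) (use r in \<open>simp add: lin\<close>)
  then show "Dbar F ((l, a + b) # r) = Dbar F ((l, a) # r) + Dbar F ((l, b) # r)"
    by (simp add: r bar_add fibre_linear_apply[OF assms fibre_linear_Dact(1) r(2)])
  have "bar (\<lambda>r. F ((l, fscale c a) # r)) r = bar (\<lambda>r. c * F ((l, a) # r)) r"
    by (rule bar_cong) (use r in \<open>simp add: lin\<close>)
  then show "Dbar F ((l, fscale c a) # r) = c * Dbar F ((l, a) # r)"
    by (simp add: r bar_scale fibre_linear_apply[OF assms fibre_linear_Dact(1) r(2)] algebra_simps)
next
  fix s :: "'a pt"
  have "multilinear (Suc n) (\<lambda>r. F (s \<triangleleft> hd r # tl r) - bar (\<lambda>r. F (s # r)) r)"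
    by (intro multilinear_diff multilinear_map_head[OF assms] fibre_linear_Dact multilinear_bar multilinear_head[OF assms])
  then show "multilinear (Suc n) (\<lambda>r. Dbar F (s # r))"
    by (rule multilinear_cong) (auto simp: length_Suc_conv)
qed

lemma smooth_Cons:
  assumes "smooth (Suc n) F" "plot s"
  shows "smooth n (\<lambda>x r. F x (s x # r))"
  unfolding smooth_def using assms(1)[unfolded smooth_def, rule_format, of "s # _"] assms(2) by auto

lemma smoothD: "smooth n F \<Longrightarrow> length ss = n \<Longrightarrow> (\<And>s. s \<in> set ss \<Longrightarrow> plot s) \<Longrightarrow> polyfun (\<lambda>x. F x (map (\<lambda>s. s x) ss))"
  by (simp add: smooth_def)

lemma smooth_bar: "smooth n F \<Longrightarrow> smooth (Suc n) (\<lambda>x. bar (F x))"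
proof (induction n arbitrary: F)
  case 0
  show ?case by (auto simp: smooth_def length_Suc_conv intro: polyfam.const)
next
  case (Suc n)
  show ?case unfolding smooth_def
  proof (intro allI impI)
    fix ss :: "((nat \<Rightarrow> 'a) \<Rightarrow> 'a pt) list" assume ss: "length ss = Suc (Suc n)" "\<forall>s\<in>set ss. plot s"
    then obtain s t r where str: "ss = s # t # r" "length r = n" by (auto simp: length_Suc_conv)
    have "polyfun (\<lambda>x. F x (s x \<odot> t x # map (\<lambda>s. s x) r))"
      using smoothD[OF Suc.prems, of "(\<lambda>x. s x \<odot> t x) # r"] ss str by (auto intro: plot_pmult)
    moreover have "polyfun (\<lambda>x. bar (\<lambda>r. F x (s x # r)) (map (\<lambda>s. s x) (t # r)))"
      by (rule smoothD[OF Suc.IH[OF smooth_Cons[OF Suc.prems, of s]]]) (use ss str in auto)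
    ultimately show "polyfun (\<lambda>x. bar (F x) (map (\<lambda>s. s x) ss))"
      by (simp add: str polyfam_diff)
  qed
qed

lemma smooth_Dbar: assumes "smooth (Suc n) (\<lambda>x. F)" shows "smooth (Suc (Suc n)) (\<lambda>x. Dbar F)"
  unfolding smooth_def
proof (intro allI impI)
  fix ss :: "((nat \<Rightarrow> 'a) \<Rightarrow> 'a pt) list" assume ss: "length ss = Suc (Suc n)" "\<forall>s\<in>set ss. plot s"
  then obtain s t r where str: "ss = s # t # r" "length r = n" by (auto simp: length_Suc_conv)
  have "polyfun (\<lambda>x. F (s x \<triangleleft> t x # map (\<lambda>s. s x) r))"
    using smoothD[OF assms, of "(\<lambda>x. s x \<triangleleft> t x) # r"] ss str by (auto intro: plot_Dact)
  moreover have "polyfun (\<lambda>x. bar (\<lambda>r. F (s x # r)) (map (\<lambda>s. s x) (t # r)))"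
    by (rule smoothD[OF smooth_bar[OF smooth_Cons[OF assms, of s]]]) (use ss str in auto)
  ultimately show "polyfun (\<lambda>x. Dbar F (map (\<lambda>s. s x) ss))"
    by (simp add: str polyfam_diff)
qed

lemma cochain_bar: "cochain n F \<Longrightarrow> cochain (Suc n) (bar F)"
  by (simp add: cochain_def multilinear_bar smooth_bar)

lemma cochain_Dbar: "cochain (Suc n) F \<Longrightarrow> cochain (Suc (Suc n)) (Dbar F)"
  by (simp add: cochain_def multilinear_Dbar smooth_Dbar)

lemma cochain_add: "cochain n F \<Longrightarrow> cochain n G \<Longrightarrow> cochain n (\<lambda>L. F L + G L)"
  by (simp add: cochain_def multilinear_add smooth_def polyfam.add)

lemma cochain_diff: "cochain n F \<Longrightarrow> cochain n G \<Longrightarrow> cochain n (\<lambda>L. F L - G L)"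
  by (simp add: cochain_def multilinear_diff smooth_def polyfam_diff)

lemma cochain_Cons: "cochain (Suc n) F \<Longrightarrow> cochain n (\<lambda>r. F (s # r))"
  using smooth_Cons[of n "\<lambda>x. F" "\<lambda>x. s"] by (simp add: cochain_def multilinear_head plot_const)

lemma cochain_map_head:
  assumes "cochain (Suc n) F" "fibre_linear g" "\<And>s. plot s \<Longrightarrow> plot (\<lambda>x. g (s x))"
  shows "cochain (Suc n) (\<lambda>L. F (g (hd L) # tl L))"
  unfolding cochain_def smooth_def
proof (intro conjI allI impI)
  show "multilinear (Suc n) (\<lambda>L. F (g (hd L) # tl L))"
    using assms(1,2) by (auto simp: cochain_def intro: multilinear_map_head)
  fix ss :: "((nat \<Rightarrow> 'a) \<Rightarrow> 'a pt) list" assume ss: "length ss = Suc n" "\<forall>s\<in>set ss. plot s"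
  then obtain s r where sr: "ss = s # r" by (cases ss) auto
  show "polyfun (\<lambda>x. F (g (hd (map (\<lambda>s. s x) ss)) # tl (map (\<lambda>s. s x) ss)))"
    using smoothD[of "Suc n" "\<lambda>x. F" "(\<lambda>x. g (s x)) # r"] assms(1,3) ss by (auto simp: sr cochain_def)
qed

lemma cochain_head_times:
  assumes "cochain n H"
    and "\<And>l a b. c (l, a + b) = c (l, a) + c (l, b)" "\<And>l r a. c (l, fscale r a) = r * c (l, a)"
    and "\<And>s. plot s \<Longrightarrow> polyfun (\<lambda>x. c (s x))"
  shows "cochain (Suc n) (\<lambda>L. c (hd L) * H (tl L))"
  unfolding cochain_def smooth_def
proof (intro conjI allI impI)
  show "multilinear (Suc n) (\<lambda>L. c (hd L) * H (tl L))"
    using assms(1) by (intro multilinear_SucI) (simp_all add: assms(2,3) cochain_def multilinear_scale distrib_right del: split_paired_All)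
  fix ss :: "((nat \<Rightarrow> 'a) \<Rightarrow> 'a pt) list" assume ss: "length ss = Suc n" "\<forall>s\<in>set ss. plot s"
  then obtain s r where sr: "ss = s # r" by (cases ss) auto
  show "polyfun (\<lambda>x. c (hd (map (\<lambda>s. s x) ss)) * H (tl (map (\<lambda>s. s x) ss)))"
    using smoothD[of n "\<lambda>x. H" r] assms(1,4) ss by (auto simp: sr cochain_def intro!: polyfam.mult)
qed

lemma cochain_lambda_times:
  assumes "cochain (Suc n) F"
  shows "cochain (Suc n) (\<lambda>L. fst (hd L) * F L)"
  unfolding cochain_def smooth_def
proof (intro conjI allI impI)
  have "multilinear (Suc n) F" using assms by (simp add: cochain_def)
  note lin = multilinear_head[OF this]
  show "multilinear (Suc n) (\<lambda>L. fst (hd L) * F L)"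
    by (rule multilinear_SucI) (simp_all add: lin multilinear_scale distrib_left del: split_paired_All)
  fix ss :: "((nat \<Rightarrow> 'a) \<Rightarrow> 'a pt) list" assume ss: "length ss = Suc n" "\<forall>s\<in>set ss. plot s"
  then obtain s r where sr: "ss = s # r" by (cases ss) auto
  show "polyfun (\<lambda>x. fst (hd (map (\<lambda>s. s x) ss)) * F (map (\<lambda>s. s x) ss))"
    using smoothD[of "Suc n" "\<lambda>x. F" ss] assms ss by (auto simp: sr cochain_def plot_def intro!: polyfam.mult)
qed

section \<open>Division by the first variable\<close>

text \<open>
  On lists whose sum, together with \<open>t\<close>, is zero, the last \<open>\<lambda>\<close> is a function of the others. Replacing it by
  this value turns \<open>t\<close> into a free variable.
\<close>

fun close :: "'k::comm_ring_1 \<Rightarrow> 'k pt list \<Rightarrow> 'k pt list" where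
  "close t [] = []"
| "close t [s] = [(- t, snd s)]"
| "close t (s # w # r) = s # close (t + fst s) (w # r)"

lemma length_close [simp]: "length (close t r) = length r"
  by (induction t r rule: close.induct) auto

lemma lambda_sum_close: "r \<noteq> [] \<Longrightarrow> lambda_sum (close t r) = - t"
  by (induction t r rule: close.induct) auto

lemma close_eq: "t + lambda_sum r = 0 \<Longrightarrow> close t r = r"
  by (induction t r rule: close.induct) (auto simp: prod_eq_iff add_eq_0_iff add.assoc minus_equation_iff)

lemma multilinear_close: "multilinear n F \<Longrightarrow> multilinear n (\<lambda>r. F (close t r))"
proof (induction n arbitrary: F t)
  case (Suc n)
  note lin = multilinear_head[OF Suc.prems]
  show ?case
  proof (rule multilinear_SucI)
    fix r :: "'a pt list" and l a b c assume "length r = n"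
    then show "F (close t ((l, a + b) # r)) = F (close t ((l, a) # r)) + F (close t ((l, b) # r))"
      "F (close t ((l, fscale c a) # r)) = c * F (close t ((l, a) # r))"
      by (cases r; simp add: lin)+
  next
    fix s :: "'a pt"
    show "multilinear n (\<lambda>r. F (close t (s # r)))"
    proof (cases n)
      case (Suc m)
      show ?thesis
        by (rule multilinear_cong[OF Suc.IH[OF lin(3), of s "t + fst s"]]) (auto simp: Suc length_Suc_conv)
    qed simp
  qed
qed simp

lemma close_plots:
  assumes "polyfun t" "\<forall>s\<in>set ss. plot s"
  shows "\<exists>ss'. length ss' = length ss \<and> (\<forall>s\<in>set ss'. plot s) \<and> (\<forall>x. close (t x) (map (\<lambda>s. s x) ss) = map (\<lambda>s. s x) ss')"
  using assms
proof (induction ss arbitrary: t rule: induct_list012)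
  case (2 s)
  show ?case
    by (rule exI[of _ "[\<lambda>x. (- t x, snd (s x))]"]) (use 2 in \<open>auto simp: plot_def intro: polyfam_uminus\<close>)
next
  case (3 s w r)
  have "polyfun (\<lambda>x. t x + fst (s x))" using 3(3,4) by (auto simp: plot_def intro: polyfam.add)
  from 3(2)[OF this] 3(4) obtain ss' where "length ss' = length (w # r)" "\<forall>s\<in>set ss'. plot s"
    "\<forall>x. close (t x + fst (s x)) (map (\<lambda>s. s x) (w # r)) = map (\<lambda>s. s x) ss'" by auto
  then show ?case using 3(4) by (intro exI[of _ "s # ss'"]) auto
qed auto

lemma polyfun_close_family:
  assumes F: "cochain (Suc n) F" and ss: "length ss = n" "\<forall>s\<in>set ss. plot s" and s: "plot s"
  shows "\<exists>q. polyfam (\<lambda>a. [:a:]) q \<and> (\<forall>x t. F ((t, snd (s x)) # close t (map (\<lambda>s. s x) ss)) = poly (q x) t)"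
proof -
  let ?up = "\<lambda>s y. s (\<lambda>i. y (Suc i))"
  have up: "plot (?up s)" if "plot s" for s :: "(nat \<Rightarrow> 'a) \<Rightarrow> 'a pt"
    by (rule plot_subst[OF that]) (rule polyfun_coord)
  obtain ss' where ss': "length ss' = n" "\<forall>s\<in>set ss'. plot s"
    "\<And>y. close (y 0) (map (\<lambda>s. s y) (map ?up ss)) = map (\<lambda>s. s y) ss'"
    using close_plots[of "\<lambda>y. y 0" "map ?up ss"] ss up by auto
  define \<Phi> where "\<Phi> y = F ((y 0, snd (?up s y)) # map (\<lambda>s. s y) ss')" for y
  have "plot (\<lambda>y. (y 0, snd (?up s y)))" using up[OF s] by (simp add: plot_def)
  then have "polyfun \<Phi>"
    using smoothD[of "Suc n" "\<lambda>x. F" "(\<lambda>y. (y 0, snd (?up s y))) # ss'"] F ss' by (auto simp: cochain_def \<Phi>_def[abs_def])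
  then obtain q where q: "polyfam (\<lambda>a. [:a:]) q" "\<And>t x. \<Phi> (case_nat t x) = poly (q x) t"
    using polyfun_as_poly by blast
  have "F ((t, snd (s x)) # close t (map (\<lambda>s. s x) ss)) = \<Phi> (case_nat t x)" for x t
    using ss'(3)[of "case_nat t x"] by (simp add: \<Phi>_def comp_def)
  then show ?thesis using q by auto
qed

lemma synthetic_div_linear:
  "synthetic_div (p + q) c = synthetic_div p c + synthetic_div q (c :: 'a::comm_ring_1)"
  "synthetic_div (smult r p) c = smult r (synthetic_div p c)"
proof -
  have "p + q + smult c (synthetic_div p c + synthetic_div q c)
    = (p + smult c (synthetic_div p c)) + (q + smult c (synthetic_div q c))"
    by (simp add: smult_add_right)
  also have "\<dots> = pCons (poly p c + poly q c) (synthetic_div p c + synthetic_div q c)"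
    by (simp only: synthetic_div_correct add_pCons)
  finally have "p + q + smult c (synthetic_div p c + synthetic_div q c)
    = pCons (poly p c + poly q c) (synthetic_div p c + synthetic_div q c)" .
  then show "synthetic_div (p + q) c = synthetic_div p c + synthetic_div q c"
    using synthetic_div_unique by metis
  have "smult r p + smult c (smult r (synthetic_div p c)) = pCons (r * poly p c) (smult r (synthetic_div p c))"
    using arg_cong[OF synthetic_div_correct[of p c], of "smult r"] by (simp add: smult_add_right mult.commute)
  then show "synthetic_div (smult r p) c = smult r (synthetic_div p c)"
    using synthetic_div_unique by metis
qed

lemma polyfam_synthetic_div:
  "polyfam (\<lambda>a. [:a:]) q \<Longrightarrow> polyfam (\<lambda>a. [:a:]) (\<lambda>x. synthetic_div (q x) c)"
  by (rule polyfam_linear[where \<iota> = "\<lambda>a. [:a:]" and T = "\<lambda>q. synthetic_div q c"]) (auto simp: synthetic_div_linear)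

text \<open>
  After the last \<open>\<lambda>\<close> has been eliminated by \<open>close\<close>, a cochain is a polynomial in the first \<open>\<lambda>\<close>, and vanishing at
  \<open>0\<close> makes it divisible by this variable. The first point must not be the last one, hence the condition on \<open>n\<close>.
\<close>

lemma cochain_divide:
  assumes F: "cochain (Suc n) F" and n: "n \<ge> 1"
    and zero: "\<And>a r. length r = n \<Longrightarrow> lambda_sum r = 0 \<Longrightarrow> F ((0, a) # r) = 0"
  obtains G where "cochain (Suc n) G"
    "\<And>l a r. length r = n \<Longrightarrow> l + lambda_sum r = 0 \<Longrightarrow> F ((l, a) # r) = l * G ((l, a) # r)"
proof -
  define W where "W L = the_poly (\<lambda>t. F ((t, snd (hd L)) # close t (tl L)))" for L
  define G where "G L = poly (synthetic_div (W L) 0) (fst (hd L))" for L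
  have W_fam: "\<exists>q. polyfam (\<lambda>a. [:a:]) q \<and> (\<forall>x. W (map (\<lambda>s. s x) ss) = q x)"
    if ss: "length ss = Suc n" "\<forall>s\<in>set ss. plot s" for ss
  proof -
    obtain s r where sr: "ss = s # r" using ss(1) by (cases ss) auto
    obtain q where "polyfam (\<lambda>a. [:a:]) q" "\<And>x t. F ((t, snd (s x)) # close t (map (\<lambda>s. s x) r)) = poly (q x) t"
      using polyfun_close_family[OF F, of r s] ss by (auto simp: sr)
    then show ?thesis by (intro exI[of _ q]) (auto simp: sr W_def intro: the_poly_eq)
  qed
  have W: "poly (W L) t = F ((t, snd (hd L)) # close t (tl L))" if L: "length L = Suc n" for L t
  proof -
    obtain s r where sr: "L = s # r" "length r = n" using L by (cases L) auto
    obtain q where q: "\<And>t. F ((t, snd s) # close t r) = poly q t"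
      using polyfun_close_family[OF F, of "map (\<lambda>s x. s) r" "\<lambda>x. s"] sr by (auto simp: plot_const comp_def)
    have "the_poly (\<lambda>t. F ((t, snd s) # close t r)) = q" by (rule the_poly_eq) (rule q)
    then show ?thesis by (simp add: W_def sr q)
  qed
  have lin: "multilinear (Suc n) (\<lambda>L. F ((t, snd (hd L)) # close t (tl L)))" for t
  proof (rule multilinear_SucI)
    have F': "multilinear (Suc n) F" using F by (simp add: cochain_def)
    note lin = multilinear_head[OF F']
    show "multilinear n (\<lambda>r. F ((t, snd (hd (s # r))) # close t (tl (s # r))))" for s
      using multilinear_close[OF lin(3)] by simp
  qed (use multilinear_head[of n F] F in \<open>simp_all add: cochain_def\<close>)
  have "multilinear (Suc n) G"
    unfolding multilinear_def
  proof (intro conjI allI impI)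
    fix L :: "'a pt list" and i l a b c assume L: "length L = Suc n" "i < Suc n"
    have hd: "fst (hd (L[i := (l, a)])) = fst (hd (L[i := (l, b)]))" for a b
      using L by (cases L; cases i) auto
    have "W (L[i := (l, a + b)]) = W (L[i := (l, a)]) + W (L[i := (l, b)])"
      by (rule poly_eqI_eval) (use L in \<open>simp add: W multilinearD[OF lin]\<close>)
    then show "G (L[i := (l, a + b)]) = G (L[i := (l, a)]) + G (L[i := (l, b)])"
      using hd[of "a + b" a] hd[of "a + b" b] by (simp add: G_def synthetic_div_linear)
    have "W (L[i := (l, fscale c a)]) = smult c (W (L[i := (l, a)]))"
      by (rule poly_eqI_eval) (use L in \<open>simp add: W multilinearD[OF lin]\<close>)
    then show "G (L[i := (l, fscale c a)]) = c * G (L[i := (l, a)])"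
      using hd[of "fscale c a" a] by (simp add: G_def synthetic_div_linear)
  qed
  moreover have "smooth (Suc n) (\<lambda>x. G)"
    unfolding smooth_def
  proof (intro allI impI)
    fix ss :: "((nat \<Rightarrow> 'a) \<Rightarrow> 'a pt) list" assume ss: "length ss = Suc n" "\<forall>s\<in>set ss. plot s"
    then obtain s r where sr: "ss = s # r" by (cases ss) auto
    obtain q where q: "polyfam (\<lambda>a. [:a:]) q" "\<And>x. W (map (\<lambda>s. s x) ss) = q x" using W_fam[OF ss] by blast
    have "polyfun (\<lambda>x. poly (synthetic_div (q x) 0) (fst (s x)))"
      by (rule polyfam_poly) (use ss in \<open>auto simp: sr plot_def intro: polyfam_synthetic_div q\<close>)
    moreover have "G (map (\<lambda>s. s x) ss) = poly (synthetic_div (q x) 0) (fst (s x))" for x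
      unfolding G_def q by (simp add: sr)
    ultimately show "polyfun (\<lambda>x. G (map (\<lambda>s. s x) ss))" by (simp only:)
  qed
  ultimately have "cochain (Suc n) G" by (simp add: cochain_def)
  moreover have "F ((l, a) # r) = l * G ((l, a) # r)" if r: "length r = n" "l + lambda_sum r = 0" for l a r
  proof -
    have r0: "r \<noteq> []" using n r by auto
    have "poly (W ((l, a) # r)) 0 = 0"
      using r by (simp add: W zero lambda_sum_close[OF r0])
    moreover have "poly w l = l * poly (synthetic_div w 0) l" if "poly w 0 = 0" for w
      using arg_cong[OF synthetic_div_correct'[of 0 w], of "\<lambda>p. poly p l"] that by simp
    ultimately have "poly (W ((l, a) # r)) l = l * poly (synthetic_div (W ((l, a) # r)) 0) l" by blast
    then show ?thesis using r by (simp add: W close_eq G_def)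
  qed
  ultimately show thesis by (rule that)
qed

section \<open>Exactness of the complex of points\<close>

lemma multilinear_zero: "multilinear (Suc n) F \<Longrightarrow> length r = n \<Longrightarrow> F ((l, 0) # r) = 0"
  using multilinear_head(1)[of n F r l 0 0] by simp

lemma cochain_lin:
  assumes "cochain (Suc n) F" "length r = n"
  shows "F ((l, a + b) # r) = F ((l, a) # r) + F ((l, b) # r)"
    and "F ((l, fscale c a) # r) = c * F ((l, a) # r)" and "F ((l, 0) # r) = 0"
  using assms multilinear_head(1,2)[of n F r] multilinear_zero[of n F r] by (simp_all add: cochain_def del: split_paired_All)

lemma cochain_Dpt:
  assumes "cochain (Suc n) F" "length r = n"
  shows "F (Dpt l (u + w) # r) = F (Dpt l u # r) + F (Dpt l w # r)"
    and "F (Dpt l (smult c u) # r) = c * F (Dpt l u # r)" and "F (Dpt l 0 # r) = 0"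
    and "F (Dpt l [:c:] # r) = c * F (Dpt l 1 # r)"
proof -
  show s: "F (Dpt l (u + w) # r) = F (Dpt l u # r) + F (Dpt l w # r)"
    "F (Dpt l (smult c u) # r) = c * F (Dpt l u # r)" for c u
    by (simp_all only: Dpt_linear cochain_lin[OF assms] Dpt_snd)
  show "F (Dpt l 0 # r) = 0" using s(2)[of 0] by simp
  show "F (Dpt l [:c:] # r) = c * F (Dpt l 1 # r)" using s(2)[of c 1] by simp
qed

definition Dmap :: "('k::field_char_0 poly \<Rightarrow> 'k poly) \<Rightarrow> ('k pt list \<Rightarrow> 'k) \<Rightarrow> 'k pt list \<Rightarrow> 'k" where
  "Dmap T F L = F (Dpt (fst (hd L)) (T (Dval (hd L))) # tl L)"

lemma Dmap_Dpt [simp]: "Dmap T F (Dpt l u # r) = F (Dpt l (T u) # r)"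
  by (simp add: Dmap_def)

lemma cochain_Dmap:
  assumes "cochain (Suc n) F" and T: "\<And>u w. T (u + w) = T u + T w" "\<And>c u. T (smult c u) = smult c (T u)"
  shows "cochain (Suc n) (Dmap T F)"
  unfolding Dmap_def
proof (rule cochain_map_head[OF assms(1)])
  show "fibre_linear (\<lambda>h. Dpt (fst h) (T (Dval h)))"
    by (simp add: fibre_linear_def T Dpt_linear del: split_paired_All)
  fix s :: "(nat \<Rightarrow> 'a) \<Rightarrow> 'a pt" assume "plot s"
  then show "plot (\<lambda>x. Dpt (fst (s x)) (T (Dval (s x))))"
    by (intro plot_Dpt polyfam_linear[where T = T and \<iota> = "\<lambda>a. [:a:]"]) (auto simp: plot_def T intro: plot_Dval[unfolded plot_def])
qed

text \<open>
  Multiplication by a fixed polynomial \<open>c\<close> in \<open>\<Delta>\<close> is an endomorphism of the module \<open>D\<close>.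
\<close>

lemma Dbar_mult:
  assumes "\<And>l u r. A (Dpt l (c * u) # r) = B (Dpt l u # r)"
  shows "Dbar A (Dpt l (c * u) # L) = Dbar B (Dpt l u # L)"
  by (cases L) (simp_all add: Dact_def mult.assoc assms)

lemma Dbar_cong:
  assumes "\<And>l' u r. Suc (length r) = length L \<Longrightarrow> l' + lambda_sum r = l + lambda_sum L \<Longrightarrow> F (Dpt l' u # r) = G (Dpt l' u # r)"
  shows "Dbar F (Dpt l u # L) = Dbar G (Dpt l u # L)"
proof (cases L)
  case (Cons s r)
  have "bar (\<lambda>r. F (Dpt l u # r)) (s # r) = bar (\<lambda>r. G (Dpt l u # r)) (s # r)"
    by (rule bar_cong) (use assms Cons in auto)
  then show ?thesis using assms[of r "l + fst s"] by (simp add: Cons Dact_def add.assoc)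
qed simp

lemma Dbar_diff: "Dbar (\<lambda>L. F L - G L) L = Dbar F L - Dbar G L"
  by (cases "(F, L)" rule: Dbar.cases) (simp_all add: bar_diff)

lemma Dbar_add: "Dbar (\<lambda>L. F L + G L) L = Dbar F L + Dbar G L"
  by (cases "(F, L)" rule: Dbar.cases) (simp_all add: bar_add)

text \<open>
  The point of \<open>v\<close> over \<open>\<lambda> = 0\<close>; left multiplication by it is multiplication by \<open>x\<close> in both
  coordinates.
\<close>

definition x_pt :: "'k::comm_ring_1 pt" where
  "x_pt = (0, ([:1:], 0))"

definition x_div :: "'k::comm_ring_1 pt \<Rightarrow> 'k pt" where
  "x_div s = (fst s, (synthetic_div (fst (snd s)) 0, synthetic_div (snd (snd s)) 0))"

lemma pval_x_pt [simp]: "pval x_pt x d = x"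
  by (simp add: pval_def x_pt_def)

lemma fst_x_pt [simp]: "fst x_pt = 0"
  by (simp add: x_pt_def)

lemma x_pt_pmult: "x_pt \<odot> s = (fst s, ([:0, 1:] * fst (snd s), [:0, 1:] * snd (snd (s :: 'k::field_char_0 pt))))"
  by (rule pval_inj) (simp_all add: pval_pmult, simp add: pval_def algebra_simps)

lemma synthetic_div_pCons_0: "synthetic_div (pCons 0 p) 0 = (p :: 'a::comm_ring_1 poly)"
  using synthetic_div_correct[of p 0] by simp

lemma x_div_pmult [simp]: "x_div (x_pt \<odot> s) = (s :: 'k::field_char_0 pt)"
  by (simp add: x_pt_pmult x_div_def synthetic_div_pCons_0 del: synthetic_div_pCons)

lemma pCons_synthetic_div: "(p :: 'a::comm_ring_1 poly) = [:poly p 0:] + [:0, 1:] * synthetic_div p 0"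
  using synthetic_div_correct'[of 0 p] by (simp add: add.commute)

lemma fibre_linear_x_div: "fibre_linear x_div"
  by (simp add: fibre_linear_def x_div_def synthetic_div_linear fscale_def del: split_paired_All)

lemma plot_x_div: "plot s \<Longrightarrow> plot (\<lambda>x. x_div (s x))"
proof -
  assume s: "plot s"
  have "polyfam (\<lambda>a. [:[:a:]:]) (\<lambda>x. synthetic_div (snd (snd (s x))) 0)"
    by (rule polyfam_linear[where \<iota> = "\<lambda>a. [:[:a:]:]" and T = "\<lambda>q. synthetic_div q 0"])
      (use s in \<open>auto simp: synthetic_div_linear plot_def\<close>)
  then show ?thesis using s by (auto simp: plot_def x_div_def polyfam_synthetic_div)
qed

text \<open>
  At \<open>x = 0\<close> the polynomial of a point is \<open>\<Delta>\<close> times \<open>\<lambda> Q(0) + (\<Delta> - 1) R(0,\<Delta>)\<close>. The second factor is a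
  homomorphism to \<open>D\<close> that kills \<open>x_pt\<close> and its multiples; having divided by \<open>\<Delta>\<close> makes it surjective
  over \<open>\<lambda> \<noteq> 0\<close>.
\<close>

definition Dproj :: "'k::comm_ring_1 pt \<Rightarrow> 'k pt" where
  "Dproj s = Dpt (fst s) ([:fst s:] * [:poly (fst (snd s)) 0:] + [:-1, 1:] * poly (snd (snd s)) 0)"

lemma fst_Dproj [simp]: "fst (Dproj s) = fst s"
  by (simp add: Dproj_def)

lemma Dproj_eq: "Dproj s = Dpt (fst s) (Dval (Dproj s))"
  by (simp add: Dproj_def)

lemma slice_0: "slice s 0 = [:0, 1:] * Dval (Dproj (s :: 'k::field_char_0 pt))"
  by (rule poly_eqI_eval) (simp add: pval_def Dproj_def poly2_def algebra_simps)

lemma Dproj_pmult: "Dproj (s \<odot> t) = Dproj s \<triangleleft> (t :: 'k::field_char_0 pt)"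
proof -
  have "[:0, 1:] * Dval (Dproj (s \<odot> t)) = [:0, 1:] * (Dval (Dproj s) * slice t (fst s))"
    using slice_pmult[of s t 0] by (simp add: slice_0)
  then have "Dval (Dproj (s \<odot> t)) = Dval (Dproj s) * slice t (fst s)" by simp
  then show ?thesis by (subst Dproj_eq) (simp add: Dact_def)
qed

lemma fibre_linear_Dproj: "fibre_linear (Dproj :: 'k::field_char_0 pt \<Rightarrow> 'k pt)"
proof -
  have "Dval (Dproj (l, a + b)) = Dval (Dproj (l, a)) + Dval (Dproj (l, b))"
    "Dval (Dproj (l, fscale c a)) = smult c (Dval (Dproj (l, a)))" for l c and a b :: "'k fibre"
    by (rule poly_eqI_eval; simp add: Dproj_def fscale_def algebra_simps)+
  then have "Dproj (l, a + b) = (l, snd (Dproj (l, a)) + snd (Dproj (l, b)))"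
    "Dproj (l, fscale c a) = (l, fscale c (snd (Dproj (l, a))))" for l c and a b :: "'k fibre"
    by (subst (1 2 3) Dproj_eq, simp add: Dpt_linear, subst (1 2) Dproj_eq, simp add: Dpt_linear)
  then show ?thesis unfolding fibre_linear_def by simp
qed

lemma plot_Dproj: assumes "plot s" shows "plot (\<lambda>x. Dproj (s x))"
proof -
  have "polyfam (\<lambda>a. [:a:]) (\<lambda>x. poly (snd (snd (s x))) 0)"
    using plot_Dval[OF assms] by (simp add: Dval_def)
  then show ?thesis
    unfolding Dproj_def
    by (intro plot_Dpt polyfam.add polyfam.mult polyfam.const polyfam_embeds polyfam_poly)
      (use assms in \<open>auto simp: plot_def\<close>)
qed

lemma cochain_Dproj: "cochain (Suc n) F \<Longrightarrow> cochain (Suc n) (\<lambda>L. F (Dproj (hd L) # tl L))"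
  by (rule cochain_map_head) (auto intro: fibre_linear_Dproj plot_Dproj)

lemma bar_Dproj: "bar (\<lambda>L. F (Dproj (hd L) # tl L)) (s # r) = Dbar F (Dproj s # r)"
  by (cases r) (simp_all add: Dproj_pmult)

text \<open>
  Over \<open>\<lambda> \<noteq> 0\<close> the projection to \<open>D\<close> is surjective; over \<open>\<lambda> = 0\<close> it only reaches the multiples of \<open>\<Delta> - 1\<close>, but a
  polynomial that vanishes for all \<open>\<lambda> \<noteq> 0\<close> vanishes at \<open>0\<close>.
\<close>

lemma Dproj_dense:
  assumes X: "cochain (Suc n) X" and n: "n \<ge> 1"
    and zero: "\<And>s r. length r = n \<Longrightarrow> fst s + lambda_sum r = 0 \<Longrightarrow> X (Dproj s # r) = 0"
    and r: "length r = n" "l + lambda_sum r = 0"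
  shows "X (Dpt l u # r) = 0"
proof -
  obtain q where q: "\<And>t. X ((t, snd (Dpt l u)) # close t r) = poly q t"
    using polyfun_close_family[OF X, of "map (\<lambda>s x. s) r" "\<lambda>x. Dpt l u"] r by (auto simp: plot_const comp_def)
  have Dt: "(t, snd (Dpt l u)) = Dpt t u" for t by (simp add: Dpt_def)
  have "poly q t = 0" if "t \<noteq> 0" for t
  proof -
    let ?s = "(t, ([:poly u 1 / t:], [:synthetic_div u 1:]))"
    have "Dproj ?s = Dpt t u"
      using synthetic_div_correct'[of 1 u] that by (simp add: Dproj_def add.commute)
    moreover have "r \<noteq> []" using n r by auto
    ultimately show ?thesis using zero[of "close t r" ?s] r by (simp add: q[symmetric] Dt lambda_sum_close)
  qed
  then have "q = 0" by (rule poly_zero_off_0)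
  then show ?thesis using q[of l] r by (simp add: Dt close_eq)
qed

text \<open>
  Subtracting the coboundary of \<open>H(s,\<dots>) = g(x, s/x,\<dots>)\<close>, with \<open>s/x\<close> the quotient in the division with remainder by
  \<open>x\<close>, makes a cochain vanish when its first argument is \<open>x_pt\<close>. The cocycle condition with first argument \<open>x_pt\<close>
  then makes it vanish on the multiples of \<open>x_pt\<close> too, so that it depends only on the remainders \<open>Q(0)\<close> and \<open>R(0,\<Delta>)\<close>.
  Vanishing on \<open>x_pt\<close> itself says that the dependence on \<open>Q(0)\<close> is divisible by \<open>\<lambda>\<close>; therefore it factors
  through \<open>Dproj\<close>.
\<close>

lemma cochain_mod_x:
  assumes g: "cochain m g" and m: "m \<ge> 2"
    and zero: "\<And>r. length r = m \<Longrightarrow> lambda_sum r = 0 \<Longrightarrow> bar g (x_pt # r) = 0"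
  obtains H F where "cochain (m - 1) H" "cochain m F"
    "\<And>s r. length (s # r) = m \<Longrightarrow> lambda_sum (s # r) = 0 \<Longrightarrow> g (s # r) = bar H (s # r) + F (Dproj s # r)"
proof -
  define k where "k = m - 2"
  have k: "m = Suc (Suc k)" using m by (simp add: k_def)
  note g = g[unfolded k] and zero = zero[unfolded k]
  define H where "H L = g (x_pt # x_div (hd L) # tl L)" for L
  have H: "cochain (Suc k) H"
    unfolding H_def[abs_def]
    by (rule cochain_map_head[OF cochain_Cons[OF g], of x_div]) (auto intro: fibre_linear_x_div plot_x_div)
  define g' where "g' L = g L - bar H L" for L
  have g': "cochain (Suc (Suc k)) g'"
    unfolding g'_def[abs_def] by (intro cochain_diff cochain_bar g H)
  have x_zero: "g' (x_pt # r) = 0" if "length r = Suc k" for r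
  proof -
    obtain s r' where r: "r = s # r'" "length r' = k" using \<open>length r = Suc k\<close> by (cases r) auto
    have "H (x_pt # L) = 0" if "length L = k" for L
      using cochain_lin(3)[OF cochain_Cons[OF g] that, of x_pt 0] by (simp add: H_def x_div_def x_pt_def zero_prod_def)
    then have "bar (\<lambda>r. H (x_pt # r)) (s # r') = 0"
      by (intro bar_zeroI) (use r in auto)
    then show ?thesis by (simp add: g'_def r H_def)
  qed
  have x_mult_zero: "g' (x_pt \<odot> s # r) = 0" if "length r = Suc k" "fst s + lambda_sum r = 0" for s r
  proof -
    have "bar g' (x_pt # s # r) = 0"
      using zero[of "s # r"] that unfolding g'_def[abs_def] by (simp only: bar_diff bar_bar) simp
    moreover have "bar (\<lambda>r. g' (x_pt # r)) (s # r) = 0"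
      by (rule bar_zeroI) (use that x_zero in auto)
    ultimately show ?thesis by simp
  qed
  define one_point :: "'a \<Rightarrow> 'a pt" where "one_point l = (l, ([:1:], 0))" for l
  define E where "E L = g' ((fst (hd L), ([:poly (Dval (hd L)) 1:], 0)) # tl L)" for L
  have scale: "(l, ([:c:], 0 :: 'a poly poly)) = (l, fscale c (snd (one_point l)))" for l c
    by (simp add: one_point_def fscale_def)
  have E_val: "E (h # r) = poly (Dval h) 1 * g' (one_point (fst h) # r)" if "length r = Suc k" for h r
    unfolding E_def using that cochain_lin(2)[OF g' that, of "fst h" "poly (Dval h) 1" "snd (one_point (fst h))"]
    by (simp add: scale) (simp add: one_point_def)
  have E: "cochain (Suc (Suc k)) E"
    unfolding E_def[abs_def]
  proof (rule cochain_map_head[OF g', of "\<lambda>h. (fst h, ([:poly (Dval h) 1:], 0))"])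
    show "fibre_linear (\<lambda>h :: 'a pt. (fst h, ([:poly (Dval h) 1:], 0 :: 'a poly poly)))"
      by (simp add: fibre_linear_def del: split_paired_All) (simp add: fscale_def mult.commute del: split_paired_All)
    fix s :: "(nat \<Rightarrow> 'a) \<Rightarrow> 'a pt" assume s: "plot s"
    have "polyfun (\<lambda>x. poly (Dval (s x)) 1)" by (rule polyfam_poly[OF plot_Dval[OF s] polyfam.const])
    then show "plot (\<lambda>x. (fst (s x), ([:poly (Dval (s x)) 1:], 0 :: 'a poly poly)))"
      using s by (auto simp: plot_def intro: polyfam_embeds polyfam.const)
  qed
  have E_zero: "E ((0, a) # r) = 0" if "length r = Suc k" "lambda_sum r = 0" for a r
    using x_zero[OF that(1)] that by (simp add: E_val one_point_def flip: x_pt_def)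
  obtain E' where E': "cochain (Suc (Suc k)) E'"
    "\<And>l a r. length r = Suc k \<Longrightarrow> l + lambda_sum r = 0 \<Longrightarrow> E ((l, a) # r) = l * E' ((l, a) # r)"
    by (rule cochain_divide[OF E _ E_zero]) simp_all
  define F where "F L = Dmap (\<lambda>u. [:poly u 1:]) E' L + Dmap (\<lambda>u. synthetic_div u 1) g' L" for L
  have "cochain (Suc (Suc k)) F"
    unfolding F_def[abs_def]
    by (intro cochain_add cochain_Dmap E' g') (auto simp: synthetic_div_linear)
  moreover have "g (s # r) = bar H (s # r) + F (Dproj s # r)"
    if "length (s # r) = Suc (Suc k)" "lambda_sum (s # r) = 0" for s r
  proof -
    obtain l Q R where s: "s = (l, (Q, R))" by (metis surj_pair)
    have r: "length r = Suc k" "l + lambda_sum r = 0" using that by (auto simp: s)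
    let ?u = "[:l:] * [:poly Q 0:] + [:-1, 1:] * poly R 0"
    have u: "poly ?u 1 = l * poly Q 0" by simp
    have div: "synthetic_div ?u 1 = poly R 0"
      using synthetic_div_unique[of ?u 1 "poly R 0" "l * poly Q 0"] by (simp add: algebra_simps smult_add_right)
    have sum: "s = (l, (fscale (poly Q 0) (snd (one_point l)) + snd (Dpt l (poly R 0))) + snd (x_pt \<odot> x_div s))"
      using pCons_synthetic_div[of Q] pCons_synthetic_div[of R]
      by (simp add: s x_pt_pmult x_div_def Dpt_def one_point_def fscale_def add.commute)
    have "g' (s # r) = poly Q 0 * g' ((l, snd (one_point l)) # r) + g' ((l, snd (Dpt l (poly R 0))) # r)
        + g' ((l, snd (x_pt \<odot> x_div s)) # r)"
      by (subst sum) (simp only: cochain_lin(1,2)[OF g' r(1)])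
    moreover have "(l, snd (x_pt \<odot> x_div s)) = x_pt \<odot> x_div s" by (simp add: s x_pt_pmult x_div_def)
    moreover have "g' (x_pt \<odot> x_div s # r) = 0" by (rule x_mult_zero) (use r in \<open>simp_all add: s x_div_def\<close>)
    ultimately have "g' (s # r) = poly Q 0 * g' (one_point l # r) + g' (Dpt l (poly R 0) # r)"
      by (simp add: Dpt_snd) (simp add: one_point_def)
    moreover have "g' (one_point l # r) = l * E' (Dpt l 1 # r)"
      using E'(2)[OF r, of "snd (Dpt l 1)"] E_val[OF r(1), of "Dpt l 1"] by (simp add: Dpt_snd)
    ultimately have "g' (s # r) = F (Dproj s # r)"
      unfolding F_def Dproj_def by (simp only: Dmap_Dpt s fst_conv snd_conv u div cochain_Dpt[OF E'(1) r(1)]) simp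
    then show ?thesis by (simp add: g'_def algebra_simps)
  qed
  ultimately show thesis using that[of H F] H by (simp add: k)
qed


lemma slice_x_pt_0 [simp]: "slice x_pt 0 = (0 :: 'k::field_char_0 poly)"
  by (rule poly_eqI_eval) simp

text \<open>
  Let \<open>o\<close> be the element \<open>1\<close> of \<open>D\<close> over \<open>\<lambda> = 0\<close>. It is killed by \<open>x_pt\<close>, and \<open>o \<triangleleft> s\<close> is \<open>\<Delta>\<close> times the projection of \<open>s\<close>.
  So the cocycle condition at \<open>o\<close> expresses \<open>f(\<Delta> \<cdot> Dproj s,\<dots>)\<close> as the differential of \<open>f(o,\<dots>)\<close>, and
  \<open>cochain_mod_x\<close> replaces \<open>f(o,\<dots>)\<close> by a cochain on \<open>D\<close>. The bound on \<open>i\<close> is the one of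
  \<open>cochain_mod_x\<close>.
\<close>

lemma Delta_exact:
  assumes f: "cochain (Suc i) f" and i: "i \<ge> 2"
    and cocycle: "\<And>l u r. length r = Suc i \<Longrightarrow> l + lambda_sum r = 0 \<Longrightarrow> Dbar f (Dpt l u # r) = 0"
  obtains F where "cochain i F"
    "\<And>l u r. length r = i \<Longrightarrow> l + lambda_sum r = 0 \<Longrightarrow> f (Dpt l ([:0, 1:] * u) # r) = Dbar F (Dpt l u # r)"
proof -
  define g where "g r = f (Dpt 0 1 # r)" for r
  have g: "cochain i g" unfolding g_def[abs_def] by (rule cochain_Cons[OF f])
  have bar_g: "bar g (s # r) = f (Dpt (fst s) ([:0, 1:] * Dval (Dproj s)) # r)"
    if "length r = i" "fst s + lambda_sum r = 0" for s r
    using cocycle[of "s # r" 0 1] that by (simp add: Dact_def slice_0 g_def[abs_def])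
  obtain H F where F: "cochain i F"
    "\<And>s r. length (s # r) = i \<Longrightarrow> lambda_sum (s # r) = 0 \<Longrightarrow> g (s # r) = bar H (s # r) + F (Dproj s # r)"
  proof (rule cochain_mod_x[OF g i])
    fix r :: "'a pt list" assume "length r = i" "lambda_sum r = 0"
    then show "bar g (x_pt # r) = 0"
      using bar_g[of r x_pt] cochain_Dpt(3)[OF f, of r 0] slice_0[of "x_pt :: 'a pt"] by (simp del: mult_pCons_left)
  qed blast
  define X where "X L = Dmap ((*) [:0, 1:]) f L - Dbar F L" for L
  obtain k where k: "i = Suc k" using i by (cases i) auto
  have "cochain (Suc i) X"
    unfolding X_def[abs_def]
    by (intro cochain_diff cochain_Dmap f) (use cochain_Dbar[of k F] F(1) in \<open>auto simp: k algebra_simps smult_add_right\<close>)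
  moreover have "X (Dproj s # r) = 0" if r: "length r = i" "fst s + lambda_sum r = 0" for s r
  proof -
    have "bar g (s # r) = bar (\<lambda>L. bar H L + F (Dproj (hd L) # tl L)) (s # r)"
    proof (rule bar_cong)
      fix L :: "'a pt list" assume L: "Suc (length L) = length (s # r)" "lambda_sum L = lambda_sum (s # r)"
      then show "g L = bar H L + F (Dproj (hd L) # tl L)"
        using F(2)[of "hd L" "tl L"] r k by (cases L) auto
    qed
    also have "\<dots> = Dbar F (Dproj s # r)" by (simp only: bar_add bar_bar bar_Dproj) simp
    finally show ?thesis
      using bar_g[OF r] unfolding X_def by (subst (1) Dproj_eq) (simp only: Dmap_Dpt, simp)
  qed
  ultimately have "X (Dpt l u # r) = 0" if "length r = i" "l + lambda_sum r = 0" for l u r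
    using Dproj_dense[of i X] i that by simp
  then have "f (Dpt l ([:0, 1:] * u) # r) = Dbar F (Dpt l u # r)" if "length r = i" "l + lambda_sum r = 0" for l u r
    using that by (simp add: X_def del: mult_pCons_left)
  then show thesis using that F(1) by blast
qed

lemma linear_mult: "c * (u + w) = c * u + c * w" "c * smult a u = smult a (c * u :: 'a::comm_ring_1 poly)"
  by (simp_all add: algebra_simps)

text \<open>
  A cochain that vanishes on the multiples of \<open>\<Delta> - 1\<close> is a cochain on \<open>D/(\<Delta> - 1)\<close>. Its product with \<open>\<Delta>\<close> is
  itself, so \<open>Delta_exact\<close> gives a primitive \<open>F\<close> on \<open>D\<close>. Then \<open>y(u) = F((\<Delta> - 1)u)\<close> is a cocycle one degree lower, and
  \<open>F(\<Delta> u)\<close> is another primitive, whose restriction to the multiples of \<open>\<Delta> - 1\<close> is \<open>y(\<Delta> u)\<close>. That is a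
  coboundary by \<open>Delta_exact\<close> again, and subtracting it yields a primitive on the quotient.
\<close>

lemma D1_exact:
  assumes f: "cochain (Suc i) f" and i: "i \<ge> 3"
    and cocycle: "\<And>l u r. length r = Suc i \<Longrightarrow> l + lambda_sum r = 0 \<Longrightarrow> Dbar f (Dpt l u # r) = 0"
    and van: "\<And>l u r. length r = i \<Longrightarrow> l + lambda_sum r = 0 \<Longrightarrow> f (Dpt l ([:-1, 1:] * u) # r) = 0"
  obtains F where "cochain i F"
    "\<And>l u r. length r = i \<Longrightarrow> l + lambda_sum r = 0 \<Longrightarrow> f (Dpt l u # r) = Dbar F (Dpt l u # r)"
    "\<And>l u r. Suc (length r) = i \<Longrightarrow> l + lambda_sum r = 0 \<Longrightarrow> F (Dpt l ([:-1, 1:] * u) # r) = 0"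
proof -
  obtain k where k: "i = Suc k" "k \<ge> 2" using i by (cases i) auto
  have i2: "i \<ge> 2" using i by simp
  have f_Delta: "f (Dpt l ([:0, 1:] * u) # r) = f (Dpt l u # r)" if "length r = i" "l + lambda_sum r = 0" for l u r
  proof -
    have "[:0, 1:] * u = u + [:-1, 1:] * u" by simp
    then have "f (Dpt l ([:0, 1:] * u) # r) = f (Dpt l (u + [:-1, 1:] * u) # r)" by (simp only:)
    then show ?thesis by (simp only: cochain_Dpt(1)[OF f that(1)] van[OF that]) simp
  qed
  obtain F where F: "cochain i F"
    "\<And>l u r. length r = i \<Longrightarrow> l + lambda_sum r = 0 \<Longrightarrow> f (Dpt l ([:0, 1:] * u) # r) = Dbar F (Dpt l u # r)"
    by (rule Delta_exact[OF f i2 cocycle]) blast+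
  define y where "y = Dmap ((*) [:-1, 1:]) F"
  have y: "cochain (Suc k) y" unfolding y_def
    using F(1) by (intro cochain_Dmap) (simp_all add: k linear_mult del: mult_pCons_left)
  have y_cocycle: "Dbar y (Dpt l u # r) = 0" if "length r = Suc k" "l + lambda_sum r = 0" for l u r
  proof -
    have "Dbar y (Dpt l u # r) = Dbar F (Dpt l ([:-1, 1:] * u) # r)"
      by (rule Dbar_mult[symmetric]) (simp add: y_def del: mult_pCons_left)
    also have "\<dots> = f (Dpt l ([:-1, 1:] * u) # r)"
      using that F(2)[symmetric] f_Delta by (simp add: k del: mult_pCons_left)
    finally show ?thesis using van that by (simp add: k del: mult_pCons_left)
  qed
  obtain G where G: "cochain k G"
    "\<And>l u r. length r = k \<Longrightarrow> l + lambda_sum r = 0 \<Longrightarrow> y (Dpt l ([:0, 1:] * u) # r) = Dbar G (Dpt l u # r)"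
    by (rule Delta_exact[OF y k(2) y_cocycle]) blast+
  obtain m where m: "k = Suc m" using k by (cases k) auto
  define G' where "G' = Dmap (\<lambda>u. synthetic_div u 1) G"
  have G': "cochain k G'" unfolding G'_def m
    by (rule cochain_Dmap) (use G(1) m in \<open>simp_all add: synthetic_div_linear\<close>)
  have G'_val: "G' (Dpt l ([:-1, 1:] * u) # r) = G (Dpt l u # r)" for l u r
  proof -
    have "synthetic_div ([:-1, 1:] * u) 1 = u"
      using synthetic_div_unique[of "[:-1, 1:] * u" 1 u 0] by simp
    then show ?thesis by (simp add: G'_def del: mult_pCons_left)
  qed
  define Fa where "Fa = Dmap ((*) [:0, 1:]) F"
  define Fb where "Fb L = Fa L - Dbar G' L" for L
  have "cochain i Fa" unfolding Fa_def k
    by (rule cochain_Dmap) (use F(1) k in \<open>simp_all add: linear_mult del: mult_pCons_left\<close>)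
  then have "cochain i Fb" unfolding Fb_def[abs_def]
    using cochain_Dbar[of m G'] G' by (intro cochain_diff) (simp_all add: k m)
  moreover have "f (Dpt l u # r) = Dbar Fb (Dpt l u # r)" if r: "length r = i" "l + lambda_sum r = 0" for l u r
  proof -
    have "Dbar Fb (Dpt l u # r) = Dbar Fa (Dpt l u # r)"
      unfolding Fb_def[abs_def] by (simp only: Dbar_diff Dbar_Dbar) simp
    also have "\<dots> = Dbar F (Dpt l ([:0, 1:] * u) # r)"
      by (rule Dbar_mult[symmetric]) (simp add: Fa_def del: mult_pCons_left)
    finally show ?thesis using F(2)[OF r, symmetric] by (simp only: f_Delta[OF r])
  qed
  moreover have "Fb (Dpt l ([:-1, 1:] * u) # r) = 0" if r: "Suc (length r) = i" "l + lambda_sum r = 0" for l u r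
  proof -
    have "Fa (Dpt l ([:-1, 1:] * u) # r) = y (Dpt l ([:0, 1:] * u) # r)"
      by (simp only: Fa_def y_def Dmap_Dpt mult.left_commute)
    also have "\<dots> = Dbar G (Dpt l u # r)" using r by (intro G(2)) (simp_all add: k)
    also have "\<dots> = Dbar G' (Dpt l ([:-1, 1:] * u) # r)"
      by (rule Dbar_mult[symmetric]) (rule G'_val)
    finally show ?thesis by (simp add: Fb_def)
  qed
  ultimately show thesis by (rule that)
qed

text \<open>
  A point acts on \<open>D/\<Delta>\<close> by \<open>\<lambda> Q(\<lambda>)\<close> and on \<open>D/(\<Delta> - 1)\<close> by \<open>(\<lambda> + \<mu>) Q(\<lambda>)\<close>, where \<open>\<mu>\<close> is the \<open>\<lambda>\<close> of the point. The
  two actions are conjugate under multiplication by \<open>\<lambda>\<close>.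
\<close>

lemma Dbar_weights:
  fixes \<gamma> :: "'k::field_char_0 \<Rightarrow> 'k pt list \<Rightarrow> 'k"
  defines "A \<equiv> \<lambda>L. fst (hd L) * (poly (Dval (hd L)) 0 * \<gamma> (fst (hd L)) (tl L))"
    and "B \<equiv> \<lambda>L. poly (Dval (hd L)) 1 * \<gamma> (fst (hd L)) (tl L)"
  shows "Dbar A (Dpt l u # L) = l * (poly u 0 * Dbar B (Dpt l 1 # L))"
    and "Dbar B (Dpt l u # L) = poly u 1 * Dbar B (Dpt l 1 # L)"
proof -
  have "bar (\<lambda>r. c * \<gamma> l r) L = c * bar (\<gamma> l) L" for c L by (rule bar_scale)
  moreover have "bar (\<lambda>r. l * (c * \<gamma> l r)) L = l * (c * bar (\<gamma> l) L)" for c L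
    using bar_scale[of "l * c" "\<gamma> l" L] by (simp add: mult.assoc)
  ultimately show "Dbar A (Dpt l u # L) = l * (poly u 0 * Dbar B (Dpt l 1 # L))"
    "Dbar B (Dpt l u # L) = poly u 1 * Dbar B (Dpt l 1 # L)"
    by (cases L; simp add: A_def B_def Dact_def; simp add: pval_def algebra_simps)+
qed

text \<open>
  The cocycle is changed in three steps until it vanishes on \<open>\<Delta>D\<close> and on the element \<open>1\<close> over \<open>\<lambda> = 0\<close>; together these
  form a submodule with quotient \<open>D/(\<Delta> - 1)\<close>, by \<open>Dbar_weights\<close>. On the quotient \<open>D1_exact\<close> applies.
\<close>

theorem D_exact:
  assumes f: "cochain (Suc i) f" and i: "i \<ge> 3"
    and cocycle: "\<And>l u r. length r = Suc i \<Longrightarrow> l + lambda_sum r = 0 \<Longrightarrow> Dbar f (Dpt l u # r) = 0"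
  obtains F where "cochain i F"
    "\<And>l u r. length r = i \<Longrightarrow> l + lambda_sum r = 0 \<Longrightarrow> f (Dpt l u # r) = Dbar F (Dpt l u # r)"
proof -
  obtain k where k: "i = Suc k" "k \<ge> 2" using i by (cases i) auto
  have i2: "i \<ge> 2" using i by simp
  obtain F1 where F1: "cochain i F1"
    "\<And>l u r. length r = i \<Longrightarrow> l + lambda_sum r = 0 \<Longrightarrow> f (Dpt l ([:0, 1:] * u) # r) = Dbar F1 (Dpt l u # r)"
    by (rule Delta_exact[OF f i2 cocycle]) blast+
  note F1 = F1(1)[unfolded k(1)] F1(2)
  have tail: "synthetic_div ([:0, 1:] * u) 0 = u" for u :: "'a poly"
    using synthetic_div_pCons_0[of u] by simp
  \<comment> \<open>First, the values on \<open>\<Delta>D\<close> are removed by \<open>Delta_exact\<close>.\<close>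
  define F2 where "F2 = Dmap (\<lambda>u. synthetic_div u 0) F1"
  have F2: "cochain (Suc k) F2" unfolding F2_def by (intro cochain_Dmap F1) (simp_all add: synthetic_div_linear)
  have F2_val: "F2 (Dpt l ([:0, 1:] * u) # r) = F1 (Dpt l u # r)" for l u r
    by (simp only: F2_def Dmap_Dpt tail)
  define f1 where "f1 L = f L - Dbar F2 L" for L
  have f1: "cochain (Suc i) f1" unfolding f1_def[abs_def] k
    by (intro cochain_diff cochain_Dbar F2) (use f in \<open>simp add: k\<close>)
  have f1_Delta: "f1 (Dpt l ([:0, 1:] * u) # r) = 0" if "length r = i" "l + lambda_sum r = 0" for l u r
    using F1(2)[OF that] Dbar_mult[of F2 "[:0, 1:]" F1 l u r, OF F2_val] by (simp add: f1_def)
  have f1_cocycle: "Dbar f1 (Dpt l u # r) = 0" if "length r = Suc i" "l + lambda_sum r = 0" for l u r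
    using cocycle[OF that] unfolding f1_def[abs_def] by (simp only: Dbar_diff Dbar_Dbar) simp
  \<comment> \<open>The restriction to \<open>1\<close> over \<open>\<lambda> = 0\<close> is now a cocycle on points.\<close>
  define g where "g r = f1 (Dpt 0 1 # r)" for r
  have g: "cochain i g" unfolding g_def[abs_def] by (rule cochain_Cons[OF f1])
  have g_cocycle: "bar g (s # r) = 0" if "length r = i" "fst s + lambda_sum r = 0" for s r
    using f1_cocycle[of "s # r" 0 1] f1_Delta[of r "fst s" "Dval (Dproj s)"] that by (simp add: Dact_def slice_0 g_def[abs_def])
  obtain H G where H: "cochain k H" and G: "cochain i G" and g_eq:
    "\<And>s r. length (s # r) = i \<Longrightarrow> lambda_sum (s # r) = 0 \<Longrightarrow> g (s # r) = bar H (s # r) + G (Dproj s # r)"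
  proof (rule cochain_mod_x[OF g])
    show "i \<ge> 2" using i by simp
    show "bar g (x_pt # r) = 0" if "length r = i" "lambda_sum r = 0" for r
      using g_cocycle[of r x_pt] that by simp
  qed (simp add: k)
  have G_cocycle: "Dbar G (Dpt l u # r) = 0" if r: "length r = i" "l + lambda_sum r = 0" for l u r
  proof (rule Dproj_dense[OF _ _ _ r])
    show "cochain (Suc i) (Dbar G)" using cochain_Dbar[of k G] G by (simp add: k)
    fix s :: "'a pt" and r :: "'a pt list" assume r: "length r = i" "fst s + lambda_sum r = 0"
    have "0 = bar g (s # r)" using g_cocycle[OF r] by simp
    also have "\<dots> = bar (\<lambda>L. bar H L + G (Dproj (hd L) # tl L)) (s # r)"
    proof (rule bar_cong)
      fix L :: "'a pt list" assume L: "Suc (length L) = length (s # r)" "lambda_sum L = lambda_sum (s # r)"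
      then show "g L = bar H L + G (Dproj (hd L) # tl L)"
        using g_eq[of "hd L" "tl L"] r k by (cases L) auto
    qed
    also have "\<dots> = Dbar G (Dproj s # r)" by (simp only: bar_add bar_bar bar_Dproj) simp
    finally show "Dbar G (Dproj s # r) = 0" by simp
  qed (use i in simp)
  \<comment> \<open>Next, the two parts of this cocycle are removed by cochains on \<open>D\<close> that extend \<open>H\<close> and \<open>G\<close>.\<close>
  define h where "h L = poly (Dval (hd L)) 0 * H (tl L)" for L
  have h: "cochain i h" unfolding h_def[abs_def] k
    by (rule cochain_head_times[OF H]) (auto intro!: polyfam_poly plot_Dval polyfam.const)
  define h2 where "h2 = Dmap (\<lambda>u. synthetic_div u 0) G"
  have h2: "cochain i h2" unfolding h2_def using G by (simp add: k cochain_Dmap synthetic_div_linear)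
  define f3 where "f3 L = f1 L + Dbar h L - Dbar h2 L" for L
  have f3: "cochain (Suc i) f3" unfolding f3_def[abs_def]
    using cochain_Dbar[of k] h h2 f1 by (intro cochain_diff cochain_add) (simp_all add: k)
  have f3_cocycle: "Dbar f3 (Dpt l u # r) = 0" if "length r = Suc i" "l + lambda_sum r = 0" for l u r
    using f1_cocycle[OF that] unfolding f3_def[abs_def] by (simp only: Dbar_diff Dbar_add Dbar_Dbar) simp
  have f3_Delta: "f3 (Dpt l ([:0, 1:] * u) # r) = 0" if "length r = i" "l + lambda_sum r = 0" for l u r
  proof -
    have "Dbar h (Dpt l ([:0, 1:] * u) # r) = Dbar (\<lambda>_. 0) (Dpt l u # r)"
      by (rule Dbar_mult) (simp add: h_def)
    also have "\<dots> = 0" by (cases r) simp_all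
    finally have "Dbar h (Dpt l ([:0, 1:] * u) # r) = 0" .
    moreover have "Dbar h2 (Dpt l ([:0, 1:] * u) # r) = Dbar G (Dpt l u # r)"
      by (rule Dbar_mult) (simp only: h2_def Dmap_Dpt tail)
    ultimately show ?thesis using f1_Delta[OF that] G_cocycle[OF that] by (simp only: f3_def) simp
  qed
  have f3_base: "f3 (Dpt 0 1 # r) = 0" if r: "length r = i" "lambda_sum r = 0" for r
  proof -
    obtain s r' where sr: "r = s # r'" using r i by (cases r) auto
    have "Dbar h (Dpt 0 1 # r) = - bar H r"
      by (simp add: sr Dact_def h_def pval_def)
    moreover have "Dbar h2 (Dpt 0 1 # r) = G (Dproj s # r')"
    proof -
      have "h2 (Dpt 0 1 # L) = 0" if "length L = k" for L
        using cochain_Dpt(3)[OF G[unfolded k] that] by (simp add: h2_def one_pCons)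
      then have "bar (\<lambda>r. h2 (Dpt 0 1 # r)) (s # r') = 0"
        by (intro bar_zeroI) (use sr r k in auto)
      then show ?thesis
        by (subst Dproj_eq) (simp add: sr Dact_def slice_0 h2_def tail del: mult_pCons_left synthetic_div_pCons)
    qed
    ultimately show ?thesis using g_eq[of s r'] r by (simp add: f3_def g_def sr)
  qed
  have f3_eq: "f3 (Dpt l u # r) = poly u 0 * f3 (Dpt l 1 # r)" if r: "length r = i" "l + lambda_sum r = 0" for l u r
  proof -
    have "f3 (Dpt l u # r) = f3 (Dpt l [:poly u 0:] # r) + f3 (Dpt l ([:0, 1:] * synthetic_div u 0) # r)"
      by (subst pCons_synthetic_div[of u]) (simp only: cochain_Dpt[OF f3 r(1)])
    then show ?thesis by (simp only: f3_Delta[OF r] cochain_Dpt(4)[OF f3 r(1)]) simp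
  qed
  \<comment> \<open>What remains depends on \<open>u(0)\<close> and vanishes at \<open>\<lambda> = 0\<close>, so that \<open>\<lambda>\<close> can be split off.\<close>
  define E where "E = Dmap (\<lambda>u. [:poly u 0:]) f3"
  have E: "cochain (Suc i) E" unfolding E_def by (intro cochain_Dmap f3) simp_all
  have "E ((0, a) # r) = 0" if "length r = i" "lambda_sum r = 0" for a r
    using f3_base[OF that] cochain_Dpt(4)[OF f3 that(1)] by (simp add: E_def Dmap_def)
  then obtain g3 where g3: "cochain (Suc i) g3"
    "\<And>l a r. length r = i \<Longrightarrow> l + lambda_sum r = 0 \<Longrightarrow> E ((l, a) # r) = l * g3 ((l, a) # r)"
    using i by (elim cochain_divide[OF E, rotated -1]) auto
  define \<gamma> where "\<gamma> l r = g3 (Dpt l 1 # r)" for l r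
  have f3_\<gamma>: "f3 (Dpt l u # r) = l * (poly u 0 * \<gamma> l r)" if r: "length r = i" "l + lambda_sum r = 0" for l u r
  proof -
    have "f3 (Dpt l 1 # r) = E ((l, snd (Dpt l 1)) # r)" by (simp add: Dpt_snd E_def one_pCons)
    then have "f3 (Dpt l 1 # r) = l * \<gamma> l r" by (simp add: g3(2)[OF r]) (simp add: \<gamma>_def Dpt_snd)
    then show ?thesis by (simp add: f3_eq[OF r, of u])
  qed
  define A where "A \<gamma> L = fst (hd L) * (poly (Dval (hd L)) 0 * \<gamma> (fst (hd L)) (tl L))" for \<gamma> and L :: "'a pt list"
  define B where "B \<gamma> L = poly (Dval (hd L)) 1 * \<gamma> (fst (hd L)) (tl L)" for \<gamma> and L :: "'a pt list"
  have AB: "A \<gamma> = (\<lambda>L. fst (hd L) * (poly (Dval (hd L)) 0 * \<gamma> (fst (hd L)) (tl L)))"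
    "B \<gamma> = (\<lambda>L. poly (Dval (hd L)) 1 * \<gamma> (fst (hd L)) (tl L))" for \<gamma>
    by (simp_all add: A_def B_def fun_eq_iff)
  have weights: "Dbar (A \<gamma>) (Dpt l u # L) = l * (poly u 0 * Dbar (B \<gamma>) (Dpt l 1 # L))"
    "Dbar (B \<gamma>) (Dpt l u # L) = poly u 1 * Dbar (B \<gamma>) (Dpt l 1 # L)" for \<gamma> l u L
    unfolding AB by (rule Dbar_weights)+
  \<comment> \<open>The quotient by \<open>\<lambda>\<close> is a cocycle when it is made to depend on \<open>u(1)\<close> instead of \<open>u(0)\<close>.\<close>
  define fX where "fX = Dmap (\<lambda>u. [:poly u 1:]) g3"
  have fX: "cochain (Suc i) fX" unfolding fX_def by (intro cochain_Dmap g3) simp_all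
  have fX_val: "fX (Dpt l u # r) = B \<gamma> (Dpt l u # r)" if "length r = i" for l u r
    using cochain_Dpt(4)[OF g3(1) that] by (simp add: fX_def B_def \<gamma>_def)
  have fX_bar: "Dbar fX (Dpt l u # r) = poly u 1 * Dbar (B \<gamma>) (Dpt l 1 # r)" if "length r = Suc i" for l u r
  proof -
    have "Dbar fX (Dpt l u # r) = Dbar (B \<gamma>) (Dpt l u # r)"
      by (rule Dbar_cong) (use that fX_val in auto)
    then show ?thesis by (simp only: weights(2)[of \<gamma> l u])
  qed
  have B_zero: "l * Dbar (B \<gamma>) (Dpt l 1 # r) = 0" if r: "length r = Suc i" "l + lambda_sum r = 0" for l r
  proof -
    have "Dbar f3 (Dpt l 1 # r) = Dbar (A \<gamma>) (Dpt l 1 # r)"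
      by (rule Dbar_cong) (use r f3_\<gamma> in \<open>simp add: A_def\<close>)
    then show ?thesis using f3_cocycle[OF r, of 1] weights(1)[of \<gamma> l 1 r] by simp
  qed
  have fX_cocycle: "Dbar fX (Dpt l u # r) = 0" if r: "length r = Suc i" "l + lambda_sum r = 0" for l u r
  proof (rule Dproj_dense[OF cochain_Dbar[OF fX] _ _ r])
    fix s :: "'a pt" and r :: "'a pt list" assume r: "length r = Suc i" "fst s + lambda_sum r = 0"
    have u: "poly (Dval (Dproj s)) 1 = fst s * poly (fst (snd s)) 0" by (simp add: Dproj_def)
    show "Dbar fX (Dproj s # r) = 0"
      by (subst Dproj_eq) (use B_zero[OF r] in \<open>auto simp: fX_bar[OF r(1)] u\<close>)
  qed simp
  have fX_van: "fX (Dpt l ([:-1, 1:] * u) # r) = 0" if "length r = i" "l + lambda_sum r = 0" for l u r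
    using fX_val[OF that(1), of l "[:-1, 1:] * u"] by (simp add: B_def)
  obtain F where F: "cochain i F"
    "\<And>l u r. length r = i \<Longrightarrow> l + lambda_sum r = 0 \<Longrightarrow> fX (Dpt l u # r) = Dbar F (Dpt l u # r)"
    "\<And>l u r. Suc (length r) = i \<Longrightarrow> l + lambda_sum r = 0 \<Longrightarrow> F (Dpt l ([:-1, 1:] * u) # r) = 0"
    by (rule D1_exact[OF fX i fX_cocycle fX_van]) blast+
  note F = F(1)[unfolded k(1)] F(2,3)
  \<comment> \<open>Its primitive is transported back by the same change from \<open>u(1)\<close> to \<open>\<lambda> u(0)\<close>.\<close>
  define \<eta> where "\<eta> l r = F (Dpt l 1 # r)" for l r
  have F_val: "F (Dpt l u # r) = B \<eta> (Dpt l u # r)" if r: "length r = k" "l + lambda_sum r = 0" for l u r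
  proof -
    have "u = [:poly u 1:] + [:-1, 1:] * synthetic_div u 1"
      using synthetic_div_correct'[of 1 u] by (simp add: add.commute)
    then have "F (Dpt l u # r) = F (Dpt l [:poly u 1:] # r) + F (Dpt l ([:-1, 1:] * synthetic_div u 1) # r)"
      using cochain_Dpt(1)[OF F(1) r(1)] by metis
    then show ?thesis using F(3)[of r l "synthetic_div u 1"] r
      by (simp only: cochain_Dpt(4)[OF F(1) r(1)]) (simp add: k B_def \<eta>_def del: mult_pCons_left)
  qed
  define F3 where "F3 L = fst (hd L) * Dmap (\<lambda>u. [:poly u 0:]) F L" for L
  have F3: "cochain i F3" unfolding F3_def[abs_def] k
    by (intro cochain_lambda_times cochain_Dmap F) simp_all
  have f3_exact: "f3 (Dpt l u # r) = Dbar F3 (Dpt l u # r)" if r: "length r = i" "l + lambda_sum r = 0" for l u r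
  proof -
    have "Dbar F3 (Dpt l u # r) = Dbar (A \<eta>) (Dpt l u # r)"
      by (rule Dbar_cong) (use r k cochain_Dpt(4)[OF F(1)] in \<open>auto simp: F3_def A_def \<eta>_def\<close>)
    also have "\<dots> = l * (poly u 0 * Dbar (B \<eta>) (Dpt l 1 # r))" by (rule weights)
    also have "Dbar (B \<eta>) (Dpt l 1 # r) = Dbar F (Dpt l 1 # r)"
      by (rule Dbar_cong) (use r k F_val in auto)
    also have "\<dots> = \<gamma> l r" using F(2)[OF r, of 1] fX_val[OF r(1), of l 1] by (simp add: B_def)
    finally show ?thesis by (simp add: f3_\<gamma>[OF r])
  qed
  define F0 where "F0 L = F2 L - h L + h2 L + F3 L" for L
  have "cochain i F0" unfolding F0_def[abs_def]
    by (intro cochain_add cochain_diff h h2 F3) (use F2 in \<open>simp add: k\<close>)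
  moreover have "f (Dpt l u # r) = Dbar F0 (Dpt l u # r)" if r: "length r = i" "l + lambda_sum r = 0" for l u r
    using f3_exact[OF r, of u] unfolding F0_def[abs_def] by (simp only: Dbar_add Dbar_diff f3_def f1_def) (simp add: algebra_simps)
  ultimately show thesis by (rule that)
qed

text \<open>
  One application of \<open>cochain_mod_x\<close> turns the cocycle into the pull-back of a cochain on \<open>D\<close> of degree \<open>n - 1\<close>, which is
  closed because the projection to \<open>D\<close> is dense.
\<close>

theorem bar_exact:
  assumes f: "cochain n f" and n: "n \<ge> 4"
    and cocycle: "\<And>L. length L = Suc n \<Longrightarrow> lambda_sum L = 0 \<Longrightarrow> bar f L = 0"
  obtains F where "cochain (n - 1) F" "\<And>L. length L = n \<Longrightarrow> lambda_sum L = 0 \<Longrightarrow> f L = bar F L"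
proof -
  obtain k where k: "n = Suc k" "k \<ge> 3" using n by (cases n) auto
  obtain j where j: "k = Suc j" using k by (cases k) auto
  obtain H F where H: "cochain k H" and F: "cochain (Suc k) F" and f_eq:
    "\<And>s r. length (s # r) = n \<Longrightarrow> lambda_sum (s # r) = 0 \<Longrightarrow> f (s # r) = bar H (s # r) + F (Dproj s # r)"
  proof (rule cochain_mod_x[OF f])
    show "n \<ge> 2" using n by simp
    show "bar f (x_pt # r) = 0" if "length r = n" "lambda_sum r = 0" for r
      using cocycle[of "x_pt # r"] that by simp
  qed (simp add: k)
  have F_cocycle: "Dbar F (Dpt l u # r) = 0" if r: "length r = Suc k" "l + lambda_sum r = 0" for l u r
  proof (rule Dproj_dense[OF cochain_Dbar[OF F] _ _ r])
    fix s :: "'a pt" and r :: "'a pt list" assume r: "length r = Suc k" "fst s + lambda_sum r = 0"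
    have "0 = bar f (s # r)" using cocycle[of "s # r"] r by (simp add: k)
    also have "\<dots> = bar (\<lambda>L. bar H L + F (Dproj (hd L) # tl L)) (s # r)"
    proof (rule bar_cong)
      fix L :: "'a pt list" assume L: "Suc (length L) = length (s # r)" "lambda_sum L = lambda_sum (s # r)"
      then show "f L = bar H L + F (Dproj (hd L) # tl L)"
        using f_eq[of "hd L" "tl L"] r k by (cases L) auto
    qed
    also have "\<dots> = Dbar F (Dproj s # r)" by (simp only: bar_add bar_bar bar_Dproj) simp
    finally show "Dbar F (Dproj s # r) = 0" by simp
  qed simp
  obtain G where G: "cochain k G"
    "\<And>l u r. length r = k \<Longrightarrow> l + lambda_sum r = 0 \<Longrightarrow> F (Dpt l u # r) = Dbar G (Dpt l u # r)"
    by (rule D_exact[OF F k(2) F_cocycle]) blast+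
  define K where "K L = H L + G (Dproj (hd L) # tl L)" for L
  have "cochain (n - 1) K" unfolding K_def[abs_def]
    by (intro cochain_add) (use H G(1) cochain_Dproj[of j G] in \<open>simp_all add: k j\<close>)
  moreover have "f L = bar K L" if L: "length L = n" "lambda_sum L = 0" for L
  proof -
    obtain s r where sr: "L = s # r" using L k by (cases L) auto
    have "F (Dproj s # r) = Dbar G (Dproj s # r)"
      by (subst (1 2) Dproj_eq) (use L in \<open>simp add: G(2) sr k\<close>)
    then show ?thesis using f_eq[of s r] L unfolding K_def[abs_def]
      by (simp only: sr bar_add bar_Dproj)
  qed
  ultimately show thesis by (rule that)
qed

section \<open>The symbol of an element\<close>

text \<open>
  The variables are \<open>\<partial>\<close>, \<open>x\<close>, \<open>\<Delta>\<close>. The symbol is a polynomial function, which justifies taking the coefficient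
  of \<open>\<lambda>\<^sup>n\<close> in the last clause (\<open>polyfun_term_symbol\<close>).
\<close>

primrec term_symbol :: "'k::field_char_0 U3_term \<Rightarrow> 'k \<Rightarrow> 'k \<Rightarrow> 'k \<Rightarrow> 'k" where
  "term_symbol Gen = (\<lambda>p x d. x - d * p)"
| "term_symbol Zero = (\<lambda>p x d. 0)"
| "term_symbol (Add a b) = (\<lambda>p x d. term_symbol a p x d + term_symbol b p x d)"
| "term_symbol (Scale r a) = (\<lambda>p x d. r * term_symbol a p x d)"
| "term_symbol (Del a) = (\<lambda>p x d. p * term_symbol a p x d)"
| "term_symbol (NProd n a b) = (\<lambda>p x d. fact n *
     coeff (the_poly (\<lambda>l. term_symbol a (- l) x d * term_symbol b (p + l) (x + l) d)) n)"

lemma polyfun_term_symbol: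
  "polyfun f \<Longrightarrow> polyfun g \<Longrightarrow> polyfun h \<Longrightarrow> polyfun (\<lambda>y. term_symbol t (f y) (g y) (h y))"
proof (induction t arbitrary: f g h)
  case (NProd n a b)
  have up: "polyfun (\<lambda>y. f (\<lambda>i. y (Suc i)))" if "polyfun f" for f :: "(nat \<Rightarrow> 'a) \<Rightarrow> 'a"
    by (rule polyfam_subst[OF _ that]) simp_all
  define \<Phi> where "\<Phi> y = term_symbol a (- y 0) (g (\<lambda>i. y (Suc i))) (h (\<lambda>i. y (Suc i)))
    * term_symbol b (f (\<lambda>i. y (Suc i)) + y 0) (g (\<lambda>i. y (Suc i)) + y 0) (h (\<lambda>i. y (Suc i)))" for y
  have "polyfun \<Phi>" unfolding \<Phi>_def[abs_def]
    by (intro polyfam.mult NProd.IH polyfam.add polyfam_uminus polyfun_coord up NProd.prems)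
  then obtain q where q: "polyfam (\<lambda>a. [:a:]) q" "\<And>t x. \<Phi> (case_nat t x) = poly (q x) t"
    using polyfun_as_poly by blast
  have "the_poly (\<lambda>l. term_symbol a (- l) (g y) (h y) * term_symbol b (f y + l) (g y + l) (h y)) = q y" for y
    by (rule the_poly_eq) (simp add: \<Phi>_def flip: q(2))
  moreover have "polyfun (\<lambda>y. coeff (q y) n)"
    by (rule polyfam_linear[OF _ _ q(1)]) simp_all
  ultimately show ?case by (auto intro: polyfam.mult polyfam.const)
qed (auto intro!: polyfam_intros)

text \<open>
  The clause for products is used through the polynomial \<open>sym_prod\<close> only.
\<close>

declare term_symbol.simps(6) [simp del]

lemma polyfun_one_variable:
  assumes "polyfun \<Phi>"
  obtains q where "\<And>t. \<Phi> (\<lambda>i. t) = poly q t"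
proof -
  have "polyfun (\<lambda>y. \<Phi> (\<lambda>i. y 0))" by (rule polyfam_subst[OF _ assms]) simp_all
  then obtain q where "\<forall>t x. \<Phi> (\<lambda>i. case_nat t x 0) = poly (q x) t" using polyfun_as_poly by blast
  then show thesis using that[of "q undefined"] by auto
qed

definition sym_prod :: "'k::field_char_0 U3_term \<Rightarrow> 'k U3_term \<Rightarrow> 'k \<Rightarrow> 'k \<Rightarrow> 'k \<Rightarrow> 'k poly" where
  "sym_prod a b p x d = the_poly (\<lambda>l. term_symbol a (- l) x d * term_symbol b (p + l) (x + l) d)"

lemma term_symbol_NProd: "term_symbol (NProd n a b) p x d = fact n * coeff (sym_prod a b p x d) n"
  by (simp add: sym_prod_def term_symbol.simps(6))

lemma poly_sym_prod: "poly (sym_prod a b p x d) l = term_symbol a (- l) x d * term_symbol b (p + l) (x + l) d"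
proof -
  have "polyfun (\<lambda>y. term_symbol a (- y 0) x d * term_symbol b (p + y 0) (x + y 0) d)"
    by (intro polyfam.mult polyfun_term_symbol polyfam_uminus polyfam.add polyfam.const polyfun_coord)
  then obtain q where q: "\<And>t. term_symbol a (- t) x d * term_symbol b (p + t) (x + t) d = poly q t"
    by (rule polyfun_one_variable) blast
  have "sym_prod a b p x d = q" unfolding sym_prod_def by (rule the_poly_eq) (rule q)
  then show ?thesis by (simp add: q)
qed

lemma sym_prod_eqI:
  "(\<And>l. term_symbol a (- l) x d * term_symbol b (p + l) (x + l) d = poly q l) \<Longrightarrow> sym_prod a b p x d = q"
  by (rule poly_eqI_eval) (simp add: poly_sym_prod)

lemma coeff_poly_const: "coeff (poly q [:t:]) i = poly (map_poly (\<lambda>u. coeff u i) q) t"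
  by (induction q) (simp_all add: map_poly_pCons)

lemma poly_poly_const: "poly (poly q [:t:]) s = poly (map_poly (\<lambda>u. poly u s) q) t"
  by (induction q) (simp_all add: map_poly_pCons)

lemma polyfun_two_variables:
  assumes "polyfun \<Phi>"
  shows "\<exists>q. \<forall>s t. \<Phi> (\<lambda>i. if i = 0 then s else t) = poly (poly q [:t:]) s"
  using assms
proof induction
  case (const c)
  show ?case by (rule exI[of _ "[:[:c:]:]"]) simp
next
  case (coord i)
  show ?case by (rule exI[of _ "if i = 0 then [:[:0, 1:]:] else [:0, 1:]"]) simp
next
  case (add f g)
  then obtain p q where "\<forall>s t. f (\<lambda>i. if i = 0 then s else t) = poly (poly p [:t:]) s"
    "\<forall>s t. g (\<lambda>i. if i = 0 then s else t) = poly (poly q [:t:]) s" by blast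
  then show ?case by (intro exI[of _ "p + q"]) simp
next
  case (mult f g)
  then obtain p q where "\<forall>s t. f (\<lambda>i. if i = 0 then s else t) = poly (poly p [:t:]) s"
    "\<forall>s t. g (\<lambda>i. if i = 0 then s else t) = poly (poly q [:t:]) s" by blast
  then show ?case by (intro exI[of _ "p * q"]) simp
qed

lemma coeff_linear_power_choose: "coeff ([:l, 1:] ^ j) n = of_nat (j choose n) * (l :: 'k::field_char_0) ^ (j - n)"
proof (cases "n \<le> j")
  case False
  then have "degree ([:l, 1:] ^ j) < n" by (simp add: degree_linear_power)
  with False show ?thesis by (simp add: coeff_eq_0)
qed (simp add: coeff_linear_poly_power)

lemma coeff_shift_poly:
  fixes l :: "'k::field_char_0"
  assumes "degree r \<le> N"
  shows "coeff (shift_poly l r) n = (\<Sum>j\<le>N. coeff r j * (of_nat (j choose n) * l ^ (j - n)))"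
proof -
  have "shift_poly l r = (\<Sum>j\<le>N. smult (coeff r j) ([:l, 1:] ^ j))"
  proof (rule poly_eqI_eval)
    fix t
    have "poly r (t + l) = (\<Sum>j\<le>N. coeff r j * (t + l) ^ j)"
      unfolding poly_altdef using assms by (intro sum.mono_neutral_left) (auto simp: coeff_eq_0)
    then show "poly (shift_poly l r) t = poly (\<Sum>j\<le>N. smult (coeff r j) ([:l, 1:] ^ j)) t"
      by (simp add: poly_sum poly_power add.commute)
  qed
  then show ?thesis by (simp add: coeff_sum coeff_linear_power_choose)
qed

text \<open>
  Both sides collect coefficients of the product of the three symbols, a polynomial \<open>\<Phi>(s,t)\<close> with \<open>s = \<lambda>\<close> and
  \<open>t = \<lambda> + \<mu>\<close>: on the left in the variables \<open>\<lambda>, \<mu>\<close>, on the right in the variables \<open>s, t\<close>. Expanding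
  \<open>(\<lambda> + \<mu>)\<^sup>j\<close> produces the binomial coefficients.
\<close>

lemma term_symbol_assoc:
  "term_symbol (NProd m a (NProd n b c)) p x d =
    (\<Sum>i\<le>m. of_nat (m choose i) * term_symbol (NProd (m + n - i) (NProd i a b) c) p x d)"
proof -
  define \<Phi> where "\<Phi> s t = term_symbol a (- s) x d * term_symbol b (s - t) (x + s) d * term_symbol c (p + t) (x + t) d" for s t
  have "polyfun (\<lambda>y. \<Phi> (y 0) (y 1))" unfolding \<Phi>_def
    by (intro polyfam.mult polyfun_term_symbol polyfam_uminus polyfam_diff polyfam.add polyfam.const polyfun_coord)
  from polyfun_two_variables[OF this] obtain q where q: "\<And>s t. \<Phi> s t = poly (poly q [:t:]) s" by auto
  define N where "N = max (degree q) (m + n)"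
  have inner: "term_symbol a (- l) x d * coeff (sym_prod b c (p + l) (x + l) d) n =
      (\<Sum>j\<le>N. poly (coeff q j) l * (of_nat (j choose n) * l ^ (j - n)))" for l
  proof -
    let ?r = "map_poly (\<lambda>u. poly u l) q"
    have "smult (term_symbol a (- l) x d) (sym_prod b c (p + l) (x + l) d) = shift_poly l ?r"
      by (rule poly_eqI_eval)
        (simp add: poly_sym_prod poly_poly_const[symmetric] q[symmetric] \<Phi>_def algebra_simps)
    moreover have "degree ?r \<le> N" using map_poly_degree_leq[of "\<lambda>u. poly u l" q] by (simp add: N_def)
    ultimately show ?thesis
      using coeff_shift_poly[of ?r N l n] by (simp add: coeff_map_poly flip: coeff_smult)
  qed
  have "sym_prod a (NProd n b c) p x d =
      (\<Sum>j\<le>N. smult (fact n * of_nat (j choose n)) (monom 1 (j - n) * coeff q j))"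
  proof (rule sym_prod_eqI)
    fix l
    have "term_symbol a (- l) x d * term_symbol (NProd n b c) (p + l) (x + l) d =
      fact n * (term_symbol a (- l) x d * coeff (sym_prod b c (p + l) (x + l) d) n)"
      by (simp only: term_symbol_NProd mult.left_commute)
    then show "term_symbol a (- l) x d * term_symbol (NProd n b c) (p + l) (x + l) d =
      poly (\<Sum>j\<le>N. smult (fact n * of_nat (j choose n)) (monom 1 (j - n) * coeff q j)) l"
      by (simp only: inner) (simp add: poly_sum poly_monom sum_distrib_left ac_simps)
  qed
  then have "term_symbol (NProd m a (NProd n b c)) p x d =
    (\<Sum>j\<le>N. fact m * (fact n * of_nat (j choose n)) * (if m < j - n then 0 else coeff (coeff q j) (m - (j - n))))"
    by (simp only: term_symbol_NProd coeff_sum coeff_smult coeff_monom_mult)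
      (simp add: sum_distrib_left mult.assoc cong: if_cong)
  also have "\<dots> = (\<Sum>j\<in>{n..m + n}. fact m * (fact n * of_nat (j choose n)) * coeff (coeff q j) (m + n - j))"
    by (rule sum.mono_neutral_cong_right) (auto simp: N_def)
  also have "\<dots> = (\<Sum>i\<le>m. fact m * (fact n * of_nat ((m + n - i) choose n)) * coeff (coeff q (m + n - i)) i)"
    by (rule sum.reindex_bij_witness[of _ "\<lambda>i. m + n - i" "\<lambda>j. m + n - j"]) auto
  also have "\<dots> = (\<Sum>i\<le>m. of_nat (m choose i) * term_symbol (NProd (m + n - i) (NProd i a b) c) p x d)"
  proof (rule sum.cong)
    fix i assume "i \<in> {..m}"
    then have i: "i \<le> m" by simp
    have "sym_prod (NProd i a b) c p x d = smult (fact i) (map_poly (\<lambda>u. coeff u i) q)"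
    proof (rule sym_prod_eqI)
      fix t
      have "smult (term_symbol c (p + t) (x + t) d) (sym_prod a b (- t) x d) = poly q [:t:]"
        by (rule poly_eqI_eval) (simp add: poly_sym_prod q[symmetric] \<Phi>_def algebra_simps)
      then have "term_symbol c (p + t) (x + t) d * coeff (sym_prod a b (- t) x d) i = coeff (poly q [:t:]) i"
        by (simp flip: coeff_smult)
      then show "term_symbol (NProd i a b) (- t) x d * term_symbol c (p + t) (x + t) d =
          poly (smult (fact i) (map_poly (\<lambda>u. coeff u i) q)) t"
        by (simp only: term_symbol_NProd coeff_poly_const) (simp add: algebra_simps)
    qed
    moreover have "m + n - i - n = m - i" using i by simp
    then have "(fact m * (fact n * of_nat ((m + n - i) choose n)) :: 'a) = of_nat (m choose i) * fact i * fact (m + n - i)"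
      using i by (simp add: binomial_fact)
    ultimately show "fact m * (fact n * of_nat ((m + n - i) choose n)) * coeff (coeff q (m + n - i)) i =
        of_nat (m choose i) * term_symbol (NProd (m + n - i) (NProd i a b) c) p x d"
      by (simp only: term_symbol_NProd coeff_smult) (simp add: coeff_map_poly)
  qed simp
  finally show ?thesis .
qed

lemma term_symbol_sum_term: "term_symbol (sum_term f n) p x d = (\<Sum>i<n. term_symbol (f i) p x d)"
  by (induction n) simp_all

lemma term_symbol_cong: "U3_cong s t \<Longrightarrow> term_symbol s p x d = term_symbol t p x d"
proof (induction s t arbitrary: p x d rule: U3_cong.induct)
  case (cong_nprod a a' b b' n)
  then show ?case by (simp add: term_symbol.simps(6))
next
  case (nprod_add_left n a b c)
  have "sym_prod (Add a b) c p x d = sym_prod a c p x d + sym_prod b c p x d"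
    by (rule sym_prod_eqI) (simp add: poly_sym_prod algebra_simps)
  then show ?case by (simp only: term_symbol_NProd term_symbol.simps(1-5) coeff_add distrib_left)
next
  case (nprod_add_right n a b c)
  have "sym_prod a (Add b c) p x d = sym_prod a b p x d + sym_prod a c p x d"
    by (rule sym_prod_eqI) (simp add: poly_sym_prod algebra_simps)
  then show ?case by (simp only: term_symbol_NProd term_symbol.simps(1-5) coeff_add distrib_left)
next
  case (nprod_scale_left n r a b)
  have "sym_prod (Scale r a) b p x d = smult r (sym_prod a b p x d)"
    by (rule sym_prod_eqI) (simp add: poly_sym_prod algebra_simps)
  then show ?case by (simp only: term_symbol_NProd term_symbol.simps(1-5) coeff_smult mult.left_commute)
next
  case (nprod_scale_right n a r b)
  have "sym_prod a (Scale r b) p x d = smult r (sym_prod a b p x d)"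
    by (rule sym_prod_eqI) (simp add: poly_sym_prod algebra_simps)
  then show ?case by (simp only: term_symbol_NProd term_symbol.simps(1-5) coeff_smult mult.left_commute)
next
  case (nprod_del_left_0 a b)
  have "sym_prod (Del a) b p x d = - pCons 0 (sym_prod a b p x d)"
    by (rule sym_prod_eqI) (simp add: poly_sym_prod algebra_simps)
  then show ?case by (simp only: term_symbol_NProd term_symbol.simps(1-5)) simp
next
  case (nprod_del_left_Suc n a b)
  have "sym_prod (Del a) b p x d = - pCons 0 (sym_prod a b p x d)"
    by (rule sym_prod_eqI) (simp add: poly_sym_prod algebra_simps)
  then show ?case by (simp only: term_symbol_NProd term_symbol.simps(1-5)) (simp add: algebra_simps)
next
  case (nprod_del_right_0 a b)
  have "sym_prod a (Del b) p x d = smult p (sym_prod a b p x d) + pCons 0 (sym_prod a b p x d)"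
    by (rule sym_prod_eqI) (simp add: poly_sym_prod algebra_simps)
  then show ?case by (simp only: term_symbol_NProd term_symbol.simps(1-5)) simp
next
  case (nprod_del_right_Suc n a b)
  have "sym_prod a (Del b) p x d = smult p (sym_prod a b p x d) + pCons 0 (sym_prod a b p x d)"
    by (rule sym_prod_eqI) (simp add: poly_sym_prod algebra_simps)
  then show ?case by (simp only: term_symbol_NProd term_symbol.simps(1-5)) (simp add: algebra_simps)
next
  case (nprod_assoc m a n b c)
  show ?case
    by (simp only: term_symbol_assoc term_symbol_sum_term term_symbol.simps(4) lessThan_Suc_atMost)
next
  case (gen_local n)
  have "sym_prod Gen Gen p x d = [:x, d:] * [:x - d * p, 1 - d:]"
    by (rule sym_prod_eqI) (simp add: algebra_simps)
  moreover have "coeff ([:x, d:] * [:x - d * p, 1 - d:]) n = 0"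
    using gen_local by (intro coeff_eq_0 le_less_trans[OF degree_mult_le]) simp
  ultimately show ?case by (simp only: term_symbol_NProd) simp
next
  case gen_relation
  have "sym_prod Gen Gen p x d = [:x * (x - d * p), x * (1 - d) + d * (x - d * p), d * (1 - d):]"
    by (rule sym_prod_eqI) (simp add: algebra_simps)
  then show ?case
    by (simp only: term_symbol_NProd term_symbol.simps(1-5)) (simp add: numeral_2_eq_2 algebra_simps)
qed (simp_all add: algebra_simps)

lift_definition symbol :: "'k::field_char_0 U3 \<Rightarrow> 'k \<Rightarrow> 'k \<Rightarrow> 'k \<Rightarrow> 'k" is term_symbol
  by (intro ext term_symbol_cong)

lemma symbol_simps [simp]:
  "symbol U3_gen p x d = x - d * p" "symbol 0 p x d = 0"
  "symbol (a + b) p x d = symbol a p x d + symbol b p x d"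
  "symbol (U3_scale r a) p x d = r * symbol a p x d"
  "symbol (U3_del a) p x d = p * symbol a p x d"
  by (transfer; simp)+

lemma term_symbol_NProd_eq:
  "(\<forall>l. term_symbol a (- l) x d * term_symbol b (p + l) (x + l) d = poly q l) \<Longrightarrow>
    term_symbol (NProd n a b) p x d = fact n * coeff q n"
  using sym_prod_eqI[of a x d b p q] by (simp only: term_symbol_NProd)

lemma symbol_nprod:
  assumes "\<And>l. symbol a (- l) x d * symbol b (p + l) (x + l) d = poly q l"
  shows "symbol (U3_nprod n a b) p x d = fact n * coeff q n"
proof -
  obtain a' b' where "a = abs_U3 a'" "b = abs_U3 b'" by (meson U3_abs_surj)
  then show ?thesis
    using assms term_symbol_NProd_eq[of a' x d b' p q n] by (simp add: symbol.abs_eq U3_nprod.abs_eq)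
qed

lemma symbol_prod_poly: "\<exists>q. \<forall>l. symbol a (- l) x d * symbol b (p + l) (x + l) d = poly q l"
  by transfer (rule exI, rule allI, rule poly_sym_prod[symmetric])


section \<open>A spanning set\<close>

abbreviation L_op :: "nat \<Rightarrow> 'k::field_char_0 U3 \<Rightarrow> 'k U3" where
  "L_op n \<equiv> U3_nprod n U3_gen"

definition e_elt :: "'k::field_char_0 U3" where
  "e_elt = L_op 2 U3_gen"

lemma L_op_1_gen: "L_op 1 U3_gen = U3_gen + U3_scale (1/2) (U3_del (e_elt :: 'k::field_char_0 U3))"
proof -
  have "U3_scale 2 (L_op 1 U3_gen) = U3_scale 2 U3_gen + U3_del (e_elt :: 'k U3)"
    using U3_gen_relation by (simp add: e_elt_def algebra_simps)
  then have "U3_scale (1/2) (U3_scale 2 (L_op 1 U3_gen)) =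
      U3_scale (1/2) (U3_scale 2 U3_gen + U3_del (e_elt :: 'k U3))" by (simp only:)
  then show ?thesis by (simp add: U3_vs.scale_right_distrib)
qed

text \<open>
  Associativity leaves only three terms, since \<open>v \<^sub>(\<^sub>i\<^sub>) v = 0\<close> for \<open>i \<ge> 3\<close>.
\<close>

lemma L_op_L_op:
  "L_op m (L_op n y) = L_op 0 (L_op (m + n) y) + U3_scale (of_nat m) (U3_nprod (m + n - 1) (L_op 1 U3_gen) y)
     + U3_scale (of_nat (m choose 2)) (U3_nprod (m + n - 2) e_elt (y :: 'k::field_char_0 U3))"
proof -
  let ?f = "\<lambda>i. U3_scale (of_nat (m choose i)) (U3_nprod (m + n - i) (L_op i U3_gen) y)"
  have "L_op m (L_op n y) = sum ?f {..m}" by (rule U3_nprod_assoc)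
  also have "\<dots> = sum ?f {..max m 2}"
    by (rule sum.mono_neutral_left) (auto simp: binomial_eq_0)
  also have "\<dots> = sum ?f {..2}"
    by (rule sum.mono_neutral_right) (auto simp: U3_gen_local)
  also have "\<dots> = U3_nprod (m + n) (L_op 0 U3_gen) y
      + U3_scale (of_nat m) (U3_nprod (m + n - 1) (L_op 1 U3_gen) y)
      + U3_scale (of_nat (m choose 2)) (U3_nprod (m + n - 2) e_elt y)"
    by (simp add: numeral_2_eq_2 e_elt_def)
  also have "U3_nprod (m + n) (L_op 0 U3_gen) y = L_op 0 (L_op (m + n) y)"
    using U3_nprod_assoc[of 0 U3_gen "m + n" U3_gen y] by simp
  finally show ?thesis .
qed

lemma nprod_L_op_1_gen:
  "U3_nprod 0 (L_op 1 U3_gen) y = L_op 0 y"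
  "U3_nprod (Suc k) (L_op 1 U3_gen) y = L_op (Suc k) y - U3_scale (of_nat (Suc k) / 2) (U3_nprod k e_elt y)"
  by (simp_all add: L_op_1_gen U3_nprod_add_left U3_nprod_scale_left U3_nprod_del_left_0 U3_nprod_del_left_Suc
      U3_vs.scale_minus_left del: of_nat_Suc One_nat_def)

lemma of_nat_choose_two: "of_nat (Suc m choose 2) = (of_nat (Suc m) * of_nat m / 2 :: 'k::field_char_0)"
proof -
  have "2 * (Suc m choose 2) = Suc m * m"
    by (induction m) (simp_all add: numeral_2_eq_2)
  then have "of_nat (2 * (Suc m choose 2)) = (of_nat (Suc m * m) :: 'k)" by (simp only:)
  then show ?thesis by (simp only: of_nat_mult) (simp add: field_simps)
qed

lemma L_op_L_op_0: "L_op (Suc m) (L_op 0 y) = L_op 0 (L_op (Suc m) y) + U3_scale (of_nat (Suc m)) (L_op m y)"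
proof (cases m)
  case 0
  then show ?thesis by (simp add: L_op_L_op[of 1 0] nprod_L_op_1_gen flip: One_nat_def)
next
  case (Suc k)
  have "U3_nprod (Suc m + 0 - 1) (L_op 1 U3_gen) y = L_op m y - U3_scale (of_nat m / 2) (U3_nprod k e_elt y)"
    unfolding Suc by (simp add: nprod_L_op_1_gen del: of_nat_Suc One_nat_def)
  then show ?thesis
    unfolding L_op_L_op[of "Suc m" 0] of_nat_choose_two
    by (simp add: Suc U3_vs.scale_right_diff_distrib del: of_nat_Suc One_nat_def)
qed

text \<open>
  With \<open>v \<^sub>(\<^sub>1\<^sub>) v\<close> eliminated, all products \<open>L\<^sub>m L\<^sub>n\<close> are expressed by \<open>L\<^sub>0\<close>, single \<open>L\<^sub>k\<close> and the action of \<open>e = v \<^sub>(\<^sub>2\<^sub>) v\<close>. When the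
  other terms vanish, the formula determines the action of \<open>e\<close>.
\<close>

lemma L_op_L_op_Suc:
  "L_op (Suc m) (L_op (Suc n) y) = L_op 0 (L_op (m + n + 2) y) + U3_scale (of_nat (Suc m)) (L_op (m + n + 1) y)
     - U3_scale (of_nat (Suc m) * of_nat (Suc n) / 2) (U3_nprod (m + n) e_elt (y :: 'k::field_char_0 U3))"
proof -
  let ?M = "of_nat (Suc m) :: 'k" and ?e = "U3_nprod (m + n) e_elt y"
  have c: "?M * (of_nat (Suc (m + n)) / 2) - ?M * of_nat m / 2 = ?M * of_nat (Suc n) / 2"
    by (simp add: field_simps)
  have h: "U3_nprod (Suc m + Suc n - 1) (L_op 1 U3_gen) y = L_op (m + n + 1) y - U3_scale (of_nat (Suc (m + n)) / 2) ?e"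
    using nprod_L_op_1_gen(2)[of "m + n" y] by (simp del: of_nat_Suc)
  have "L_op (Suc m) (L_op (Suc n) y) = L_op 0 (L_op (m + n + 2) y) + U3_scale ?M (L_op (m + n + 1) y)
      - (U3_scale (?M * (of_nat (Suc (m + n)) / 2)) ?e - U3_scale (?M * of_nat m / 2) ?e)"
    unfolding L_op_L_op[of "Suc m" "Suc n"] of_nat_choose_two h U3_vs.scale_right_diff_distrib
    by (simp del: of_nat_Suc)
  then show ?thesis by (simp only: c flip: U3_vs.scale_left_diff_distrib)
qed

text \<open>
  The condition says that \<open>v \<^sub>(\<^sub>\<lambda>\<^sub>) y\<close> has degree at most \<open>1\<close> in \<open>\<lambda>\<close>. It holds when the symbol of \<open>y\<close> depends on
  \<open>\<Delta>\<close> alone, and then \<open>L\<^sub>1\<close> multiplies this symbol by \<open>\<Delta>\<close>.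
\<close>

definition low :: "'k::field_char_0 U3 \<Rightarrow> bool" where
  "low y \<longleftrightarrow> (\<forall>n\<ge>2. L_op n y = 0)"

lemma e_gen_zero: "U3_nprod (n + 2) e_elt U3_gen = (0 :: 'k::field_char_0 U3)"
proof -
  have "of_nat (Suc n) * of_nat (Suc 2) / 2 \<noteq> (0 :: 'k)" by (simp del: of_nat_Suc)
  moreover have "U3_scale (of_nat (Suc n) * of_nat (Suc 2) / 2) (U3_nprod (n + 2) e_elt U3_gen) = (0 :: 'k U3)"
    using L_op_L_op_Suc[of n 2 "U3_gen :: 'k U3"] by (simp add: U3_gen_local del: of_nat_Suc)
  ultimately show ?thesis by (metis U3_vs.scale_eq_0_iff)
qed

lemma low_e: "low (e_elt :: 'k::field_char_0 U3)"
  unfolding low_def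
proof (intro allI impI)
  fix n :: nat assume "n \<ge> 2"
  define m where "m = n - 2"
  have n: "n = Suc (Suc m)" using \<open>n \<ge> 2\<close> by (simp add: m_def)
  have "U3_nprod (Suc m + 1) e_elt U3_gen = (0 :: 'k U3)" using e_gen_zero[of m] by simp
  moreover have "(e_elt :: 'k U3) = L_op (Suc 1) U3_gen" by (simp add: e_elt_def numeral_2_eq_2)
  ultimately show "L_op n e_elt = (0 :: 'k U3)"
    using L_op_L_op_Suc[of "Suc m" 1 "U3_gen :: 'k U3"] by (simp add: n U3_gen_local del: of_nat_Suc One_nat_def)
qed

lemma low_e_zero:
  assumes "low (y :: 'k::field_char_0 U3)"
  shows "U3_nprod (Suc n) e_elt y = 0"
proof -
  have "of_nat (Suc n) * of_nat (Suc 1) / 2 \<noteq> (0 :: 'k)" by (simp del: of_nat_Suc)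
  moreover have "U3_scale (of_nat (Suc n) * of_nat (Suc 1) / 2) (U3_nprod (n + 1) e_elt y) = 0"
    using L_op_L_op_Suc[of n 1 y] assms by (simp add: low_def numeral_2_eq_2 del: of_nat_Suc)
  ultimately show ?thesis by (metis U3_vs.scale_eq_0_iff Suc_eq_plus1)
qed

lemma low_L_op_1: assumes "low y" shows "low (L_op 1 y)"
  unfolding low_def
proof (intro allI impI)
  fix n :: nat assume "n \<ge> 2"
  define m where "m = n - 2"
  have n: "n = Suc (Suc m)" using \<open>n \<ge> 2\<close> by (simp add: m_def)
  show "L_op n (L_op 1 y) = 0"
    using L_op_L_op_Suc[of "Suc m" 0 y] assms low_e_zero[OF assms, of m] by (simp add: n low_def del: of_nat_Suc)
qed

text \<open>
  Normalised to have the symbol \<open>\<Delta>(\<Delta> - 1)\<close>.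
\<close>

definition c_elt :: "'k::field_char_0 U3" where
  "c_elt = U3_scale (- 1 / 2) e_elt"

lemma low_power: "low ((L_op 1 ^^ k) c_elt)"
proof (induction k)
  case 0
  show ?case using low_e unfolding low_def c_elt_def funpow_0 U3_nprod_scale_right by simp
qed (simp add: low_L_op_1 del: One_nat_def)

text \<open>
  The generators have the symbols \<open>x - \<Delta>\<partial>\<close> and \<open>\<Delta>(\<Delta> - 1)\<Delta>\<^sup>k\<close>, and \<open>L\<^sub>0\<close> multiplies a symbol by \<open>x\<close>. Induction over this
  predicate gives every element the coordinates \<open>Q\<close> and \<open>R\<close>.
\<close>

inductive spanned :: "'k::field_char_0 U3 \<Rightarrow> bool" where
  gen: "spanned U3_gen"
| low: "spanned ((L_op 1 ^^ k) c_elt)"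
| zero: "spanned 0"
| add: "spanned a \<Longrightarrow> spanned b \<Longrightarrow> spanned (a + b)"
| scale: "spanned a \<Longrightarrow> spanned (U3_scale r a)"
| del: "spanned a \<Longrightarrow> spanned (U3_del a)"
| L0: "spanned a \<Longrightarrow> spanned (L_op 0 a)"

lemma spanned_sum: "(\<And>i. i \<in> A \<Longrightarrow> spanned (f i)) \<Longrightarrow> spanned (sum f A)"
  by (induction A rule: infinite_finite_induct) (auto intro: spanned.intros)

lemma spanned_diff: "spanned a \<Longrightarrow> spanned b \<Longrightarrow> spanned (a - b)"
  using spanned.add[OF _ spanned.scale, of a b "-1"] by simp

lemma spanned_e: "spanned e_elt"
proof -
  have "e_elt = U3_scale (- 2) ((L_op 1 ^^ 0) c_elt)" by (simp add: c_elt_def)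
  then show ?thesis by (metis spanned.low spanned.scale)
qed

lemma spanned_L_op: "spanned a \<Longrightarrow> spanned (L_op n a)"
proof (induction arbitrary: n rule: spanned.induct)
  case gen
  consider "n = 0" | "n = 1" | "n = 2" | "n \<ge> 3" by linarith
  then show ?case
  proof cases
    case 2
    then show ?thesis by (simp only: L_op_1_gen) (intro spanned.intros spanned_e)
  qed (simp_all add: U3_gen_local spanned.intros spanned_e flip: e_elt_def)
next
  case (low k)
  consider "n = 0" | "n = 1" | "n \<ge> 2" by linarith
  then show ?case
  proof cases
    case 2
    then show ?thesis using spanned.low[of "Suc k"] by simp
  next
    case 3
    then have "L_op n ((L_op 1 ^^ k) c_elt) = (0 :: 'a U3)" using low_power[of k] unfolding low_def by blast
    then show ?thesis by (simp only: spanned.zero)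
  next
    case 1
    show ?thesis unfolding 1 by (intro spanned.L0 spanned.low)
  qed
next
  case (del a)
  then show ?case by (cases n) (simp_all add: U3_nprod_del_right_0 U3_nprod_del_right_Suc spanned.intros del: of_nat_Suc)
next
  case (L0 a)
  then show ?case by (cases n) (simp_all add: L_op_L_op_0 spanned.intros del: of_nat_Suc)
qed (simp_all add: U3_nprod_add_right U3_nprod_scale_right spanned.intros)

text \<open>
  Left multiplication by a product is expressed through left multiplications by its factors, by solving the
  associativity law for its last summand.
\<close>

lemma spanned_nprod: "spanned y \<Longrightarrow> spanned (U3_nprod n a y)"
proof (induction a arbitrary: n y rule: U3_induct)
  case (del a)
  then show ?case by (cases n) (simp_all add: U3_nprod_del_left_0 U3_nprod_del_left_Suc spanned.intros
      del: of_nat_Suc U3_vs.scale_minus_left)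
next
  case (nprod m a b)
  have "spanned (U3_nprod k (U3_nprod m a b) y)" for k
  proof (induction m arbitrary: k rule: less_induct)
    case (less m)
    have "U3_nprod m a (U3_nprod k b y) = (\<Sum>i<m. U3_scale (of_nat (m choose i)) (U3_nprod (m + k - i) (U3_nprod i a b) y))
        + U3_nprod k (U3_nprod m a b) y"
      by (simp add: U3_nprod_assoc flip: lessThan_Suc_atMost)
    then have "U3_nprod k (U3_nprod m a b) y = U3_nprod m a (U3_nprod k b y)
        - (\<Sum>i<m. U3_scale (of_nat (m choose i)) (U3_nprod (m + k - i) (U3_nprod i a b) y))"
      by simp
    then show ?case
      using nprod less.IH by (auto intro!: spanned_diff spanned_sum spanned.scale)
  qed
  then show ?case .
qed (simp_all add: spanned_L_op U3_nprod_add_left U3_nprod_scale_left spanned.intros)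

lemma spanned_all: "spanned a"
  by (induction a rule: U3_induct) (auto intro: spanned.intros spanned_nprod)

section \<open>Fibres of elements\<close>

lemma symbol_L_op:
  assumes "\<And>l. (x + d * l) * symbol a (p + l) (x + l) d = poly q l"
  shows "symbol (L_op n a) p x d = fact n * coeff q n"
  by (rule symbol_nprod) (use assms in simp)

lemma symbol_L_op_0 [simp]: "symbol (L_op 0 a) p x d = x * symbol a p x d"
proof -
  obtain q where q: "\<And>l. symbol U3_gen (- l) x d * symbol a (p + l) (x + l) d = poly q l"
    using symbol_prod_poly by blast
  then show ?thesis using symbol_nprod[of U3_gen x d a p q 0] q[of 0] by (simp add: poly_0_coeff_0)
qed

lemma symbol_L_op_1:
  assumes "\<And>p x. symbol a p x d = c"
  shows "symbol (L_op 1 a) p x d = d * c"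
  using symbol_L_op[of x d a p "[:x * c, d * c:]" 1] assms by (simp add: algebra_simps)

lemma symbol_c_elt: "symbol c_elt p x d = d * (d - 1)"
proof -
  have "symbol e_elt p x d = fact 2 * coeff [:x * (x - d * p), x * (1 - d) + d * (x - d * p), d * (1 - d):] 2"
    unfolding e_elt_def by (rule symbol_L_op) (simp add: algebra_simps)
  then have e: "symbol e_elt p x d = 2 * (d * (1 - d))" by (simp add: numeral_2_eq_2)
  show ?thesis unfolding c_elt_def symbol_simps e by (simp add: algebra_simps)
qed

lemma symbol_low: "symbol ((L_op 1 ^^ k) c_elt) p x d = d * (d - 1) * d ^ k"
proof (induction k arbitrary: p x)
  case 0
  show ?case by (simp add: symbol_c_elt)
next
  case (Suc k)
  show ?case unfolding funpow.simps o_apply by (subst symbol_L_op_1[OF Suc.IH]) simp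
qed

definition x_times :: "'k::field_char_0 fibre \<Rightarrow> 'k fibre" where
  "x_times a = ([:0, 1:] * fst a, [:0, 1:] * snd a)"

lemma pval_x_times: "pval (l, x_times a) x d = x * pval (l, a) x d"
  by (simp add: pval_def x_times_def algebra_simps)

lemma pval_0 [simp]: "pval (l, 0) x d = 0"
  by (simp add: pval_def)

lemma pval_fibre_one: "pval (l, ([:1:], 0)) x d = x + d * l"
  by (simp add: pval_def)

lemma pval_fibre_const: "pval (l, (0, [:u:])) x d = d * (d - 1) * poly u d"
  by (simp add: pval_def)

lemma fibre_exists: "\<exists>m. \<forall>x d. symbol a (- l) x d = pval (l, m) x d"
proof (induction a rule: spanned.induct[OF spanned_all, case_names gen low zero add scale del L0])
  case gen
  show ?case by (rule exI[of _ "([:1:], 0)"]) (simp add: pval_fibre_one)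
next
  case (low k)
  show ?case by (rule exI[of _ "(0, [:monom 1 k:])"]) (simp only: symbol_low pval_fibre_const poly_monom mult_1 simp_thms)
next
  case zero
  show ?case by (rule exI[of _ 0]) simp
next
  case (add a b)
  then obtain m n where "\<forall>x d. symbol a (- l) x d = pval (l, m) x d" "\<forall>x d. symbol b (- l) x d = pval (l, n) x d" by blast
  then show ?case by (intro exI[of _ "m + n"]) (simp add: pval_fibre_add)
next
  case (scale a r)
  then obtain m where "\<forall>x d. symbol a (- l) x d = pval (l, m) x d" by blast
  then show ?case by (intro exI[of _ "fscale r m"]) (simp add: pval_fibre_scale)
next
  case (del a)
  then obtain m where "\<forall>x d. symbol a (- l) x d = pval (l, m) x d" by blast
  then show ?case by (intro exI[of _ "fscale (- l) m"]) (simp add: pval_fibre_scale)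
next
  case (L0 a)
  then obtain m where "\<forall>x d. symbol a (- l) x d = pval (l, m) x d" by blast
  then show ?case by (intro exI[of _ "x_times m"]) (simp add: pval_x_times)
qed

text \<open>
  The coordinates of the symbol at \<open>\<partial> = -\<lambda>\<close>; they are unique by \<open>pval_inj\<close>.
\<close>

definition fibre :: "'k::field_char_0 \<Rightarrow> 'k U3 \<Rightarrow> 'k fibre" where
  "fibre l a = (SOME m. \<forall>x d. symbol a (- l) x d = pval (l, m) x d)"

lemma pval_fibre: "pval (l, fibre l a) x d = symbol a (- l) x d"
proof -
  have "\<forall>x d. symbol a (- l) x d = pval (l, fibre l a) x d"
    unfolding fibre_def by (rule someI_ex[OF fibre_exists])
  then show ?thesis by simp
qed

lemma fibre_eqI: "(\<And>x d. symbol a (- l) x d = pval (l, m) x d) \<Longrightarrow> fibre l a = m"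
  using pval_inj[of "(l, fibre l a)" "(l, m)"] by (simp add: pval_fibre)

lemma fibre_simps:
  "fibre l U3_gen = ([:1:], 0)" "fibre l ((L_op 1 ^^ k) c_elt) = (0, [:monom 1 k:])" "fibre l 0 = 0"
  "fibre l (a + b) = fibre l a + fibre l b" "fibre l (U3_scale r a) = fscale r (fibre l a)"
  "fibre l (U3_del a) = fscale (- l) (fibre l a)" "fibre l (L_op 0 a) = x_times (fibre l a)"
  by (rule fibre_eqI; simp only: symbol_simps symbol_low symbol_L_op_0 pval_fibre_one pval_fibre_const
      pval_0 pval_fibre_add pval_fibre_scale pval_x_times pval_fibre poly_monom; simp)+

lemma plot_fibre: assumes "polyfun g" shows "plot (\<lambda>x. (g x, fibre (g x) a))"
proof (induction a rule: spanned.induct[OF spanned_all, case_names gen low zero add scale del L0])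
  case (del a)
  have "polyfun (\<lambda>x. - g x)" using assms by (rule polyfam_uminus)
  with del show ?case
    unfolding plot_def fibre_simps fscale_def fst_conv snd_conv
    by (auto intro: polyfam.mult polyfam_embeds simp del: mult_pCons_left)
qed (use assms in \<open>auto simp: plot_def fibre_simps fscale_def x_times_def simp del: mult_pCons_left One_nat_def
    intro: polyfam.const polyfam.add polyfam.mult\<close>)

subsection \<open>Elements with prescribed coordinates\<close>

text \<open>
  For linear \<open>f\<close> and \<open>T\<close> this is the linear map that extends \<open>f\<close> and turns multiplication by the variable into \<open>T\<close>.
\<close>

definition horner :: "('a::zero \<Rightarrow> 'b::ab_group_add) \<Rightarrow> ('b \<Rightarrow> 'b) \<Rightarrow> 'a poly \<Rightarrow> 'b" where
  "horner f T p = fold_coeffs (\<lambda>a y. f a + T y) p 0"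

lemma horner_pCons:
  assumes "f 0 = 0" "T 0 = 0"
  shows "horner f T (pCons a p) = f a + T (horner f T p)"
  by (cases "a = 0 \<and> p = 0") (auto simp: horner_def assms)

lemma horner_0 [simp]: "horner f T 0 = 0"
  by (simp add: horner_def)

lemma horner_add:
  fixes f :: "'a::ab_group_add \<Rightarrow> 'b::ab_group_add"
  assumes "\<And>a b. f (a + b) = f a + f b" "\<And>x y. T (x + y) = T x + T y"
  shows "horner f T (p + q) = horner f T p + horner f T q"
proof -
  have z: "f 0 = 0" "T 0 = 0" using assms(1)[of 0 0] assms(2)[of 0 0] by auto
  show ?thesis by (induction p q rule: poly_induct2) (simp_all add: horner_pCons[of f T, OF z] assms add_ac)
qed

lemma horner_smult:
  assumes "f 0 = 0" "T 0 = 0" "\<And>a. f (c * a) = S (f a)" "\<And>x y. S (x + y) = S x + S y" "\<And>x. T (S x) = S (T x)" "S 0 = 0"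
  shows "horner f T (smult c p) = S (horner f T p)"
  by (induction p) (simp_all add: horner_pCons assms)

definition U3_c_part :: "'k::field_char_0 poly \<Rightarrow> 'k U3" where
  "U3_c_part = horner (\<lambda>r. U3_scale r c_elt) (L_op 1)"

lemma U3_c_part_0 [simp]: "U3_c_part 0 = 0"
  by (simp add: U3_c_part_def)

lemma U3_c_part_pCons: "U3_c_part (pCons a u) = U3_scale a c_elt + L_op 1 (U3_c_part u)"
  unfolding U3_c_part_def by (rule horner_pCons) simp_all

text \<open>
  The element with coordinates \<open>Q\<close>, \<open>R\<close> that do not depend on \<open>\<lambda>\<close>: \<open>x\<close> becomes \<open>L\<^sub>0\<close> and \<open>\<Delta>\<close> becomes
  \<open>L\<^sub>1\<close>.
\<close>

definition lift :: "'k::field_char_0 fibre \<Rightarrow> 'k U3" where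
  "lift m = horner (\<lambda>r. U3_scale r U3_gen) (L_op 0) (fst m) + horner U3_c_part (L_op 0) (snd m)"

lemma c_part_linear:
  "U3_c_part (u + w) = U3_c_part u + U3_c_part w" "U3_c_part (smult r u) = U3_scale r (U3_c_part u)"
  unfolding U3_c_part_def by (rule horner_add horner_smult; simp add: U3_nprod_add_right U3_nprod_scale_right U3_vs.scale_right_distrib
      U3_vs.scale_left_distrib)+

lemma lift_add: "lift (m + n) = lift m + lift n"
  unfolding lift_def fst_add snd_add
  by (subst (1 2) horner_add) (simp_all add: U3_nprod_add_right U3_vs.scale_left_distrib c_part_linear)

lemma lift_fscale: "lift (fscale r m) = U3_scale r (lift m)"
proof -
  have "horner (\<lambda>r. U3_scale r U3_gen) (L_op 0) (smult r p) = U3_scale r (horner (\<lambda>r. U3_scale r U3_gen) (L_op 0) p)" for p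
    by (rule horner_smult) (simp_all add: U3_nprod_scale_right U3_vs.scale_right_distrib)
  moreover have "horner U3_c_part (L_op 0) (smult [:r:] p) = U3_scale r (horner U3_c_part (L_op 0) p)" for p
    by (rule horner_smult) (simp_all add: U3_nprod_scale_right U3_vs.scale_right_distrib c_part_linear)
  ultimately show ?thesis by (simp add: lift_def fscale_def U3_vs.scale_right_distrib)
qed

lemma lift_x_times: "lift (x_times m) = L_op 0 (lift m)"
  by (simp add: lift_def x_times_def horner_pCons U3_nprod_add_right)

lemma U3_c_part_monom: "U3_c_part (monom 1 k) = (L_op 1 ^^ k) c_elt"
  by (induction k) (simp_all add: monom_0 monom_Suc U3_c_part_pCons)

lemma lift_gens: "lift ([:1:], 0) = U3_gen" "lift (0, [:monom 1 k:]) = (L_op 1 ^^ k) c_elt" "lift 0 = 0"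
  by (simp_all add: lift_def horner_pCons U3_c_part_monom del: One_nat_def)

lemma symbol_c_part: "symbol (U3_c_part u) p x d = d * (d - 1) * poly u d"
proof (induction u arbitrary: p x)
  case (pCons a u)
  show ?case by (simp only: U3_c_part_pCons symbol_simps symbol_c_elt symbol_L_op_1[OF pCons.IH]) (simp add: algebra_simps)
qed simp

lemma symbol_lift: "symbol (lift m) (- l) x d = pval (l, m) x d"
proof -
  have "symbol (horner (\<lambda>r. U3_scale r U3_gen) (L_op 0) Q) (- l) x d = (x + d * l) * poly Q x" for Q
    by (induction Q) (simp_all add: horner_pCons algebra_simps)
  moreover have "symbol (horner U3_c_part (L_op 0) R) (- l) x d = d * (d - 1) * poly2 R x d" for R
  proof (induction R)
    case (pCons u R)
    have "horner U3_c_part (L_op 0) (pCons u R) = U3_c_part u + L_op 0 (horner U3_c_part (L_op 0) R)"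
      by (rule horner_pCons) simp_all
    then show ?case by (simp only: symbol_simps symbol_L_op_0 symbol_c_part pCons.IH) (simp add: algebra_simps)
  qed simp
  ultimately show ?thesis by (simp add: lift_def pval_def)
qed

lemma fibre_lift [simp]: "fibre l (lift m) = m"
  by (rule fibre_eqI) (rule symbol_lift)

text \<open>
  A functional on which \<open>\<partial>\<close> acts by \<open>-\<lambda>\<close> only sees the fibre at \<open>\<lambda>\<close>. The functional is generalised in the induction
  because in the case of \<open>L\<^sub>0\<close> it is replaced by its composition with \<open>L\<^sub>0\<close>, which commutes with \<open>\<partial>\<close>.
\<close>

lemma functional_lift_fibre:
  assumes "\<And>a b. \<psi> (a + b) = \<psi> a + \<psi> b" "\<And>r a. \<psi> (U3_scale r a) = r * \<psi> a" "\<And>a. \<psi> (U3_del a) = - l * \<psi> a"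
  shows "\<psi> (lift (fibre l a)) = \<psi> (a :: 'k::field_char_0 U3)"
  using assms
proof (induction a arbitrary: \<psi> rule: spanned.induct[OF spanned_all, case_names gen low zero add scale del L0])
  case (L0 a)
  have "\<psi> (L_op 0 (lift (fibre l a))) = \<psi> (L_op 0 a)"
    by (rule L0.IH[of "\<lambda>a. \<psi> (L_op 0 a)"])
      (simp_all add: U3_nprod_add_right U3_nprod_scale_right U3_nprod_del_right_0 L0.prems)
  then show ?case by (simp add: fibre_simps lift_x_times)
next
  case (add a b)
  show ?case by (simp only: fibre_simps lift_add add.prems(1) add.IH[OF add.prems])
next
  case (scale a r)
  show ?case by (simp only: fibre_simps lift_fscale scale.prems(2) scale.IH[OF scale.prems])
next
  case (del a)
  show ?case by (simp only: fibre_simps lift_fscale del.prems(2,3) del.IH[OF del.prems])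
qed (simp_all only: fibre_simps lift_gens)

text \<open>
  Taking fibres turns the value of the \<open>\<lambda>\<close>-product at \<open>\<lambda> = l\<close> into the product of points.
\<close>

lemma fibre_lprod:
  "(l + m, fibre (l + m) (\<Sum>j\<le>degree (U3_lprod a b). U3_scale (l ^ j) (coeff (U3_lprod a b) j)))
    = (l, fibre l a) \<odot> (m, fibre m b)"
proof (rule pval_inj)
  fix x d
  obtain q where q: "\<And>t. symbol a (- t) x d * symbol b (- (l + m) + t) (x + t) d = poly q t"
    using symbol_prod_poly by blast
  have c: "symbol (coeff (U3_lprod a b) j) (- (l + m)) x d = coeff q j" for j
    using symbol_nprod[OF q, of j] by (simp add: coeff_U3_lprod)
  have sum: "symbol (sum f A) p x d = (\<Sum>j\<in>A. symbol (f j) p x d)" for f :: "nat \<Rightarrow> 'a U3" and A p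
    by (induction A rule: infinite_finite_induct) simp_all
  have "coeff q j = 0" if "j > degree (U3_lprod a b)" for j
    using c[of j] that by (simp add: coeff_eq_0)
  then have "degree q \<le> degree (U3_lprod a b)" by (intro degree_le) simp
  then have "poly q l = (\<Sum>j\<le>degree (U3_lprod a b). coeff q j * l ^ j)"
    unfolding poly_altdef by (intro sum.mono_neutral_left) (auto simp: coeff_eq_0)
  then show "pval (l + m, fibre (l + m) (\<Sum>j\<le>degree (U3_lprod a b). U3_scale (l ^ j) (coeff (U3_lprod a b) j))) x d
      = pval ((l, fibre l a) \<odot> (m, fibre m b)) x d"
    using q[of l] by (simp add: pval_pmult pval_fibre sum c[simplified] mult.commute)
qed simp

section \<open>Polynomials in several variables as functions\<close>

definition meval :: "(nat \<Rightarrow> 'k::comm_ring_1) \<Rightarrow> 'k mpoly \<Rightarrow> 'k" where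
  "meval y p = (\<Sum>m\<in>Poly_Mapping.keys p. Poly_Mapping.lookup p m *
     (\<Prod>k\<in>Poly_Mapping.keys m. y k ^ Poly_Mapping.lookup m k))"

lemma mconst_sum: "mconst (sum f A) = (\<Sum>a\<in>A. mconst (f a))"
  by (induction A rule: infinite_finite_induct) simp_all

lemma mconst_prod: "mconst (prod f A) = (\<Prod>a\<in>A. mconst (f a))"
  by (induction A rule: infinite_finite_induct) simp_all

lemma mconst_power: "mconst (r ^ n) = mconst r ^ n"
  by (induction n) simp_all

lemma mconst_inj: "mconst r = mconst s \<Longrightarrow> r = s"
  by (metis lookup_single_eq mconst_def)

lemma msubst_meval: "msubst (\<lambda>k. mconst (y k)) p = mconst (meval y p)"
  by (simp add: msubst_def meval_def mconst_sum mconst_prod mconst_power)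

lemma meval_simps [simp]:
  "meval y 0 = 0" "meval y 1 = 1" "meval y (p + q) = meval y p + meval y q" "meval y (p * q) = meval y p * meval y q"
  "meval y (- p) = - meval y p" "meval y (mconst r) = r" "meval y (mvar i) = y i" "meval y (p ^ n) = meval y p ^ n"
  "meval y (sum f A) = (\<Sum>a\<in>A. meval y (f a))"
proof -
  have neg: "mconst (- r) = - mconst r" for r :: 'a by (simp add: mconst_def single_uminus)
  show "meval y 0 = 0" "meval y 1 = 1" "meval y (p + q) = meval y p + meval y q" "meval y (p * q) = meval y p * meval y q"
    "meval y (- p) = - meval y p" "meval y (mconst r) = r" "meval y (mvar i) = y i" "meval y (p ^ n) = meval y p ^ n"
    "meval y (sum f A) = (\<Sum>a\<in>A. meval y (f a))"
    by (rule mconst_inj; simp add: neg mconst_sum mconst_power flip: msubst_meval)+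
qed

lemma meval_diff [simp]: "meval y (p - q) = meval y p - meval y q"
  using meval_simps(3)[of y p "- q"] by (simp del: meval_simps(3))

lemma meval_msubst: "meval y (msubst f p) = meval (\<lambda>k. meval y (f k)) p"
  by (rule mconst_inj) (simp only: msubst_meval[symmetric] msubst_msubst)

lemma meval_cong:
  assumes "\<And>k. k \<in> mvars p \<Longrightarrow> y k = z k"
  shows "meval y p = meval z p"
proof -
  have "y k = z k" if "m \<in> Poly_Mapping.keys p" "k \<in> Poly_Mapping.keys m" for m k
    using assms that by (auto simp: mvars_def)
  then show ?thesis by (simp add: meval_def)
qed

lemma digits_unique:
  fixes B :: nat
  shows "(\<And>k. k < N \<Longrightarrow> f k < B \<and> g k < B) \<Longrightarrow> (\<Sum>k<N. f k * B ^ k) = (\<Sum>k<N. g k * B ^ k) \<Longrightarrow> k < N \<Longrightarrow> f k = g k"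
proof (induction N arbitrary: f g k)
  case (Suc N)
  have split: "(\<Sum>k<Suc N. h k * B ^ k) = h 0 + B * (\<Sum>k<N. h (Suc k) * B ^ k)" for h
    by (simp add: sum.lessThan_Suc_shift sum_distrib_left ac_simps del: sum.lessThan_Suc)
  have eq: "f 0 + B * (\<Sum>k<N. f (Suc k) * B ^ k) = g 0 + B * (\<Sum>k<N. g (Suc k) * B ^ k)"
    using Suc.prems(2) by (simp only: split)
  have lt: "f 0 < B" "g 0 < B" using Suc.prems(1)[of 0] by auto
  have "(f 0 + B * (\<Sum>k<N. f (Suc k) * B ^ k)) mod B = f 0" "(g 0 + B * (\<Sum>k<N. g (Suc k) * B ^ k)) mod B = g 0"
    using lt by simp_all
  with eq have f0: "f 0 = g 0" by simp
  with eq lt have "(\<Sum>k<N. f (Suc k) * B ^ k) = (\<Sum>k<N. g (Suc k) * B ^ k)" by simp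
  then have "f (Suc k) = g (Suc k)" if "k < N" for k
    using Suc.IH[of "\<lambda>k. f (Suc k)" "\<lambda>k. g (Suc k)" k] Suc.prems(1) that by simp
  then show ?case using f0 Suc.prems(3) by (cases k) auto
qed simp

text \<open>
  Kronecker's substitution \<open>y\<^sub>k = t\<^bsup>b^k\<^esup>\<close>, for a base \<open>b\<close> larger than all exponents, sends distinct monomials to
  distinct powers of \<open>t\<close>, which reduces the claim to one variable.
\<close>

lemma meval_eq_0_imp:
  assumes "\<And>y. meval y p = 0"
  shows "p = (0 :: 'k::field_char_0 mpoly)"
proof (rule ccontr)
  assume "p \<noteq> 0"
  then obtain m0 where m0: "m0 \<in> Poly_Mapping.keys p" by (metis keys_eq_empty all_not_in_conv)
  let ?K = "Poly_Mapping.keys p"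
  have "finite (\<Union>m\<in>?K. Poly_Mapping.lookup m ` Poly_Mapping.keys m)" "finite (\<Union>m\<in>?K. Poly_Mapping.keys m)"
    by auto
  then obtain B N where B0: "\<And>b. b \<in> (\<Union>m\<in>?K. Poly_Mapping.lookup m ` Poly_Mapping.keys m) \<Longrightarrow> b < B"
    and N: "\<And>k. k \<in> (\<Union>m\<in>?K. Poly_Mapping.keys m) \<Longrightarrow> k < N"
    by (meson finite_nat_set_iff_bounded)
  have B: "Poly_Mapping.lookup m k < Suc B" if "m \<in> ?K" for m k
  proof (cases "k \<in> Poly_Mapping.keys m")
    case True
    then have "Poly_Mapping.lookup m k \<in> (\<Union>m\<in>?K. Poly_Mapping.lookup m ` Poly_Mapping.keys m)" using that by blast
    then show ?thesis using B0 less_SucI by blast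
  qed (simp add: in_keys_iff)
  define e where "e m = (\<Sum>k<N. Poly_Mapping.lookup m k * Suc B ^ k)" for m
  have e_inj: "m = m'" if "m \<in> ?K" "m' \<in> ?K" "e m = e m'" for m m'
  proof (rule poly_mapping_eqI)
    fix k
    show "Poly_Mapping.lookup m k = Poly_Mapping.lookup m' k"
    proof (cases "k < N")
      case True
      then show ?thesis
        using digits_unique[of N "Poly_Mapping.lookup m" "Suc B" "Poly_Mapping.lookup m'" k] B that by (simp add: e_def)
    next
      case False
      have "Poly_Mapping.lookup m k = 0" if "m \<in> ?K" for m
      proof (rule ccontr)
        assume "Poly_Mapping.lookup m k \<noteq> 0"
        then have "k \<in> (\<Union>m\<in>?K. Poly_Mapping.keys m)" using that by (auto simp: in_keys_iff)
        then show False using N False by blast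
      qed
      then show ?thesis using that by simp
    qed
  qed
  define q where "q = (\<Sum>m\<in>?K. monom (Poly_Mapping.lookup p m) (e m))"
  have "poly q t = 0" for t
  proof -
    have "(\<Prod>k\<in>Poly_Mapping.keys m. (t ^ (Suc B ^ k)) ^ Poly_Mapping.lookup m k) = t ^ e m" if "m \<in> ?K" for m
    proof -
      have "(\<Prod>k\<in>Poly_Mapping.keys m. (t ^ (Suc B ^ k)) ^ Poly_Mapping.lookup m k)
          = (\<Prod>k<N. (t ^ (Suc B ^ k)) ^ Poly_Mapping.lookup m k)"
      proof (rule prod.mono_neutral_left)
        show "Poly_Mapping.keys m \<subseteq> {..<N}" using N that by blast
      qed (simp_all add: in_keys_iff)
      then show ?thesis by (simp add: e_def power_sum mult.commute flip: power_mult)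
    qed
    then have "meval (\<lambda>k. t ^ (Suc B ^ k)) p = poly q t"
      by (simp add: meval_def q_def poly_sum poly_monom)
    then show ?thesis using assms by simp
  qed
  then have "q = 0" using poly_all_0_iff_0 by blast
  then have "0 = coeff q (e m0)" by simp
  also have "\<dots> = (\<Sum>m\<in>?K. if m = m0 then Poly_Mapping.lookup p m else 0)"
    unfolding q_def coeff_sum by (rule sum.cong) (use e_inj m0 in auto)
  also have "\<dots> = Poly_Mapping.lookup p m0" using m0 by simp
  finally show False using m0 by (simp add: in_keys_iff)
qed

lemma meval_eqI: "(\<And>y. meval y p = meval y q) \<Longrightarrow> p = (q :: 'k::field_char_0 mpoly)"
  using meval_eq_0_imp[of "p - q"] by simp

lemma polyfun_meval:
  assumes "\<And>i. polyfun (g i)"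
  shows "polyfun (\<lambda>x. meval (\<lambda>i. g i x) p)"
  unfolding meval_def by (intro polyfam_sum polyfam.mult polyfam.const polyfam_prod polyfam_power assms)

lemma polyfun_mpoly: "polyfun G \<Longrightarrow> \<exists>P. \<forall>y. meval y P = (G y :: 'k::field_char_0)"
proof (induction rule: polyfam.induct)
  case (const c)
  show ?case by (rule exI[of _ "mconst c"]) simp
next
  case (coord i)
  show ?case by (rule exI[of _ "mvar i"]) simp
next
  case (add f g)
  then obtain P Q where "\<forall>y. meval y P = f y" "\<forall>y. meval y Q = g y" by blast
  then show ?case by (intro exI[of _ "P + Q"]) simp
next
  case (mult f g)
  then obtain P Q where "\<forall>y. meval y P = f y" "\<forall>y. meval y Q = g y" by blast
  then show ?case by (intro exI[of _ "P * Q"]) simp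
qed

lemma polyfun_mpoly_vars:
  assumes "polyfun G" "\<And>y. G (\<lambda>k. if k < n then y k else 0) = G y"
  shows "\<exists>P. mvars P \<subseteq> {..<n} \<and> (\<forall>y. meval y P = (G y :: 'k::field_char_0))"
proof -
  obtain P where P: "\<And>y. meval y P = G y" using polyfun_mpoly[OF assms(1)] by blast
  let ?f = "\<lambda>k. if k < n then mvar k else 0 :: 'k mpoly"
  have "mvars (msubst ?f P) \<subseteq> {..<n}"
  proof (rule mvars_msubst_le)
    show "mvars (?f k) \<subseteq> {..<n}" for k
      using mvars_mvar[of k, where 'a = 'k] by (cases "k < n") auto
  qed
  moreover have "meval y (msubst ?f P) = G y" for y
  proof -
    have "(\<lambda>k. meval y (?f k)) = (\<lambda>k. if k < n then y k else 0)" by auto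
    then show ?thesis using assms(2)[of y] by (simp only: meval_msubst P)
  qed
  ultimately show ?thesis by blast
qed

section \<open>Comparison of the two complexes\<close>

text \<open>
  A cochain with \<open>m\<close> arguments has \<open>m - 1\<close> variables; the last argument behaves as if its variable were minus the
  sum of the others, by the rule for \<open>\<partial>\<close> in this argument.
\<close>

definition lambda_at :: "nat \<Rightarrow> (nat \<Rightarrow> 'k::comm_ring_1) \<Rightarrow> nat \<Rightarrow> 'k" where
  "lambda_at m y i = (if Suc i < m then y i else - (\<Sum>j<m - 1. y j))"

definition points_at :: "nat \<Rightarrow> (nat \<Rightarrow> 'k::field_char_0) \<Rightarrow> 'k U3 list \<Rightarrow> 'k pt list" where
  "points_at m y as = map (\<lambda>i. (lambda_at m y i, fibre (lambda_at m y i) (as ! i))) [0..<m]"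

lemma length_points_at [simp]: "length (points_at m y as) = m"
  by (simp add: points_at_def)

lemma nth_points_at [simp]: "i < m \<Longrightarrow> points_at m y as ! i = (lambda_at m y i, fibre (lambda_at m y i) (as ! i))"
  by (simp add: points_at_def)

lemma lambda_sum_nth: "lambda_sum L = (\<Sum>i<length L. fst (L ! i))"
  by (simp add: lambda_sum_def sum_list_sum_nth atLeast0LessThan)

lemma lambda_sum_points_at: "m \<ge> 1 \<Longrightarrow> lambda_sum (points_at m y as) = 0"
proof -
  assume "m \<ge> 1"
  then obtain k where "m = Suc k" by (cases m) auto
  then show ?thesis by (simp add: lambda_sum_nth lambda_at_def)
qed

lemma points_at_update:
  "length as = m \<Longrightarrow> i < m \<Longrightarrow> points_at m y (as[i := a]) = (points_at m y as)[i := (lambda_at m y i, fibre (lambda_at m y i) a)]"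
  by (rule nth_equalityI) (auto simp: nth_list_update)

lemma polyfun_lambda_at: "polyfun (\<lambda>y. lambda_at m y i)"
proof (cases "Suc i < m")
  case False
  have "polyfun (\<lambda>y. - (\<Sum>j<m - 1. y j))" by (intro polyfam_uminus polyfam_sum polyfun_coord)
  then show ?thesis using False by (simp add: lambda_at_def)
qed (simp add: lambda_at_def)

lemma meval_del_factor: "i < m \<Longrightarrow> meval y (U3.del_factor m i) = - lambda_at m y i"
  by (auto simp: U3.del_factor_def lambda_at_def)

definition represents :: "nat \<Rightarrow> ('k::field_char_0 U3 list \<Rightarrow> 'k mpoly) \<Rightarrow> ('k pt list \<Rightarrow> 'k) \<Rightarrow> bool" where
  "represents m \<phi> F \<longleftrightarrow> (\<forall>as y. length as = m \<longrightarrow> meval y (\<phi> as) = F (points_at m y as))"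

definition realize :: "('k::field_char_0 U3 list \<Rightarrow> 'k mpoly) \<Rightarrow> 'k pt list \<Rightarrow> 'k" where
  "realize \<phi> L = meval (\<lambda>i. fst (L ! i)) (\<phi> (map (\<lambda>s. lift (snd s)) L))"

text \<open>
  The arguments are replaced one after the other by the lifts of their fibres, which does not change the value by
  \<open>functional_lift_fibre\<close>.
\<close>

lemma represents_realize:
  assumes \<phi>: "\<phi> \<in> U3.cochains m"
  shows "represents m \<phi> (realize \<phi>)"
  unfolding represents_def
proof (intro allI impI)
  fix as :: "'a U3 list" and y assume len: "length as = m"
  define bs where "bs k = map (\<lambda>i. if i < k then lift (fibre (lambda_at m y i) (as ! i)) else as ! i) [0..<m]" for k
  have step: "meval y (\<phi> (bs (Suc k))) = meval y (\<phi> (bs k))" if k: "k < m" for k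
  proof -
    have len_bs: "length (bs k) = m" by (simp add: bs_def)
    have "bs (Suc k) = (bs k)[k := lift (fibre (lambda_at m y k) (bs k ! k))]"
      by (rule nth_equalityI) (use k in \<open>auto simp: bs_def nth_list_update less_Suc_eq\<close>)
    moreover have "meval y (\<phi> ((bs k)[k := lift (fibre (lambda_at m y k) (bs k ! k))])) = meval y (\<phi> ((bs k)[k := bs k ! k]))"
      by (rule functional_lift_fibre[of "\<lambda>a. meval y (\<phi> ((bs k)[k := a]))"])
        (simp_all add: U3.cochain_add[OF \<phi> len_bs k] U3.cochain_scale[OF \<phi> len_bs k]
          U3.cochain_del_factor[OF \<phi> len_bs k] meval_del_factor[OF k])
    ultimately show ?thesis by simp
  qed
  have "meval y (\<phi> (bs k)) = meval y (\<phi> (bs 0))" if "k \<le> m" for k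
    using that by (induction k) (simp_all add: step)
  from this[of m] have "meval y (\<phi> (bs m)) = meval y (\<phi> (bs 0))" by simp
  moreover have "bs 0 = as" by (rule nth_equalityI) (auto simp: bs_def len)
  moreover have "bs m = map (\<lambda>s. lift (snd s)) (points_at m y as)" by (rule nth_equalityI) (auto simp: bs_def)
  ultimately have "meval y (\<phi> as) = meval y (\<phi> (map (\<lambda>s. lift (snd s)) (points_at m y as)))" by simp
  also have "\<dots> = realize \<phi> (points_at m y as)"
    unfolding realize_def
  proof (rule meval_cong)
    fix k assume "k \<in> mvars (\<phi> (map (\<lambda>s. lift (snd s)) (points_at m y as)))"
    then have "k < m - 1" using U3.cochain_mvars[OF \<phi>] by blast
    then show "y k = fst (points_at m y as ! k)" by (simp add: lambda_at_def)
  qed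
  finally show "meval y (\<phi> as) = realize \<phi> (points_at m y as)" .
qed

lemma multilinear_sum_list:
  assumes F: "multilinear n F" and n: "length A + length Q + 1 = n"
  shows "F (A @ (l, \<Sum>(g, c)\<leftarrow>es. fscale (g x) c) # Q) = (\<Sum>(g, c)\<leftarrow>es. g x * F (A @ (l, c) # Q))"
proof -
  have upd: "A @ (l, a) # Q = (A @ (l, 0) # Q)[length A := (l, a)]" for a by simp
  have lin: "F (A @ (l, a + b) # Q) = F (A @ (l, a) # Q) + F (A @ (l, b) # Q)"
    "F (A @ (l, fscale c a) # Q) = c * F (A @ (l, a) # Q)" for a b c
    using multilinearD[OF F, of "A @ (l, 0) # Q" "length A" l] n by simp_all
  have "F (A @ (l, 0) # Q) = 0" using lin(1)[of 0 0] by simp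
  then show ?thesis by (induction es) (auto simp: lin)
qed

text \<open>
  A family of fibres is a finite combination of constant fibres with polynomial coefficients, so multilinearity
  reduces smoothness to families in which only the \<open>\<lambda>\<close> vary. The arguments are treated one at a time,
  starting from the last one.
\<close>

lemma smooth_from_constant_fibres:
  assumes F: "multilinear n F"
    and const: "\<And>qs. length qs = n \<Longrightarrow> (\<forall>(l, a)\<in>set qs. polyfun l) \<Longrightarrow> polyfun (\<lambda>x. F (map (\<lambda>(l, a). (l x, a)) qs))"
  shows "smooth n (\<lambda>x. F)"
proof -
  have "polyfun (\<lambda>x. F (map (\<lambda>s. s x) ps @ map (\<lambda>(l, a). (l x, a)) qs))"
    if "length ps + length qs = n" "\<forall>s\<in>set ps. plot s" "\<forall>(l, a)\<in>set qs. polyfun l" for ps qs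
    using that
  proof (induction ps arbitrary: qs rule: rev_induct)
    case Nil
    then show ?case using const by simp
  next
    case (snoc p ps)
    have p: "polyfun (\<lambda>x. fst (p x))" "polyfam (\<lambda>a. [:a:]) (\<lambda>x. fst (snd (p x)))"
      "polyfam (\<lambda>a. [:[:a:]:]) (\<lambda>x. snd (snd (p x)))" using snoc.prems(2) by (auto simp: plot_def)
    obtain gs where gs: "\<forall>(g, c)\<in>set gs. polyfun g" "\<forall>x. fst (snd (p x)) = (\<Sum>(g, c)\<leftarrow>gs. [:g x:] * c)"
      using polyfam_expand[OF _ p(2)] by auto
    obtain hs where hs: "\<forall>(g, c)\<in>set hs. polyfun g" "\<forall>x. snd (snd (p x)) = (\<Sum>(g, c)\<leftarrow>hs. [:[:g x:]:] * c)"
      using polyfam_expand[OF _ p(3)] by auto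
    define es :: "(((nat \<Rightarrow> 'a) \<Rightarrow> 'a) \<times> 'a fibre) list"
      where "es = map (\<lambda>(g, c). (g, (c, 0))) gs @ map (\<lambda>(g, c). (g, (0, c))) hs"
    have sum1: "(\<Sum>(g, c)\<leftarrow>map (\<lambda>(g, c). (g, (c, 0 :: 'a poly poly))) as. fscale (g x) c) = (\<Sum>(g, c)\<leftarrow>as. [:g x:] * c, 0)"
      for x and as :: "(((nat \<Rightarrow> 'a) \<Rightarrow> 'a) \<times> 'a poly) list"
      by (induction as) (auto simp: fscale_def zero_prod_def)
    have sum2: "(\<Sum>(g, c)\<leftarrow>map (\<lambda>(g, c). (g, (0 :: 'a poly, c))) as. fscale (g x) c) = (0, \<Sum>(g, c)\<leftarrow>as. [:[:g x:]:] * c)"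
      for x and as :: "(((nat \<Rightarrow> 'a) \<Rightarrow> 'a) \<times> 'a poly poly) list"
      by (induction as) (auto simp: fscale_def zero_prod_def)
    have p_eq: "p x = (fst (p x), \<Sum>(g, c)\<leftarrow>es. fscale (g x) c)" for x
      using gs(2) hs(2) unfolding es_def map_append sum_list_append sum1 sum2 by (simp add: prod_eq_iff del: mult_pCons_left)
    have es: "\<forall>(g, c)\<in>set es. polyfun g" using gs(1) hs(1) by (auto simp: es_def)
    have "F (map (\<lambda>s. s x) (ps @ [p]) @ map (\<lambda>(l, a). (l x, a)) qs) =
        (\<Sum>(g, c)\<leftarrow>es. g x * F (map (\<lambda>s. s x) ps @ map (\<lambda>(l, a). (l x, a)) ((\<lambda>x. fst (p x), c) # qs)))" for x
      using multilinear_sum_list[OF F, of "map (\<lambda>s. s x) ps" "map (\<lambda>(l, a). (l x, a)) qs" "fst (p x)" x es] snoc.prems(1)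
      by (simp flip: p_eq)
    moreover have "polyfun (\<lambda>x. F (map (\<lambda>s. s x) ps @ map (\<lambda>(l, a). (l x, a)) ((\<lambda>x. fst (p x), c) # qs)))" for c
      using snoc.IH[of "(\<lambda>x. fst (p x), c) # qs"] snoc.prems p(1) by simp
    then have "polyfun (\<lambda>x. \<Sum>(g, c)\<leftarrow>es. g x * F (map (\<lambda>s. s x) ps @ map (\<lambda>(l, a). (l x, a)) ((\<lambda>x. fst (p x), c) # qs)))"
      using es by (induction es) (auto intro!: polyfam.const polyfam.add polyfam.mult)
    ultimately show ?case by simp
  qed
  from this[of _ "[]"] show ?thesis by (simp add: smooth_def)
qed

lemma cochain_realize:
  assumes \<phi>: "\<phi> \<in> U3.cochains m"
  shows "cochain m (realize \<phi>)"
proof -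
  have lin: "multilinear m (realize \<phi>)"
    unfolding multilinear_def
  proof (intro conjI allI impI)
    fix L :: "'a pt list" and i l a b c assume L: "length L = m" "i < m"
    let ?as = "map (\<lambda>s. lift (snd s)) L" and ?y = "\<lambda>j. fst (L[i := (l, 0 :: 'a fibre)] ! j)"
    have y: "(\<lambda>j. fst (L[i := (l, a)] ! j)) = ?y" for a :: "'a fibre"
      using L by (auto simp: fun_eq_iff nth_list_update)
    have val: "realize \<phi> (L[i := (l, a)]) = meval ?y (\<phi> (?as[i := lift a]))" for a
    proof -
      have "realize \<phi> (L[i := (l, a)]) = meval (\<lambda>j. fst (L[i := (l, a)] ! j)) (\<phi> (?as[i := lift a]))"
        by (simp only: realize_def map_update snd_conv)
      then show ?thesis by (simp only: y[of a])
    qed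
    have len: "length ?as = m" using L by simp
    show "realize \<phi> (L[i := (l, a + b)]) = realize \<phi> (L[i := (l, a)]) + realize \<phi> (L[i := (l, b)])"
      "realize \<phi> (L[i := (l, fscale c a)]) = c * realize \<phi> (L[i := (l, a)])"
      by (simp_all only: val lift_add lift_fscale U3.cochain_add[OF \<phi> len L(2)] U3.cochain_scale[OF \<phi> len L(2)] meval_simps)
  qed
  moreover have "smooth m (\<lambda>x. realize \<phi>)"
  proof (rule smooth_from_constant_fibres[OF lin])
    fix qs :: "(((nat \<Rightarrow> 'a) \<Rightarrow> 'a) \<times> 'a fibre) list"
    assume qs: "length qs = m" "\<forall>(l, a)\<in>set qs. polyfun l"
    let ?P = "\<phi> (map (\<lambda>(l, a). lift a) qs)"
    let ?g = "\<lambda>i. if i < m then fst (qs ! i) else (\<lambda>x. 0)"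
    have "realize \<phi> (map (\<lambda>(l, a). (l x, a)) qs) = meval (\<lambda>i. ?g i x) ?P" for x
    proof -
      have "map (\<lambda>s. lift (snd s)) (map (\<lambda>(l, a). (l x, a)) qs) = map (\<lambda>(l, a). lift a) qs" by auto
      moreover have "meval (\<lambda>i. fst (map (\<lambda>(l, a). (l x, a)) qs ! i)) ?P = meval (\<lambda>i. ?g i x) ?P"
      proof (rule meval_cong)
        fix k assume "k \<in> mvars ?P"
        then have "k < m - 1" using U3.cochain_mvars[OF \<phi>] by blast
        then show "fst (map (\<lambda>(l, a). (l x, a)) qs ! k) = ?g k x" using qs(1) by (simp add: case_prod_unfold)
      qed
      ultimately show ?thesis by (simp only: realize_def)
    qed
    moreover have "polyfun (\<lambda>x. meval (\<lambda>i. ?g i x) ?P)"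
      by (rule polyfun_meval) (use qs in \<open>auto intro: polyfam.const dest!: nth_mem\<close>)
    ultimately show "polyfun (\<lambda>x. realize \<phi> (map (\<lambda>(l, a). (l x, a)) qs))" by simp
  qed
  ultimately show ?thesis by (simp add: cochain_def)
qed

lemma bar_sum: "bar F L = (\<Sum>i<length L - 1. (-1) ^ i * F (merge_args i (L ! i \<odot> L ! Suc i) L))"
proof (induction L arbitrary: F rule: induct_list012)
  case (3 s t r)
  have "bar F (s # t # r) = F (s \<odot> t # r) + (\<Sum>i<length r. (-1) ^ Suc i * F (s # merge_args i ((t # r) ! i \<odot> r ! i) (t # r)))"
    using 3(2)[of "\<lambda>r. F (s # r)"] by (simp add: sum_negf)
  also have "\<dots> = (\<Sum>i<Suc (length r). (-1) ^ i * F (merge_args i ((s # t # r) ! i \<odot> (t # r) ! i) (s # t # r)))"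
    by (subst sum.lessThan_Suc_shift) (simp add: merge_args_def)
  finally show ?case by simp
qed simp_all

lemma lambda_at_merge:
  assumes "i < m" "k < m"
  shows "lambda_at m (\<lambda>k. meval y (merge_vars i k)) k =
    (if k < i then lambda_at (Suc m) y k else if k = i then lambda_at (Suc m) y i + lambda_at (Suc m) y (Suc i) else lambda_at (Suc m) y (Suc k))"
proof -
  have sum: "(\<Sum>j<n. meval y (merge_vars i j)) = (if i < n then \<Sum>j<Suc n. y j else \<Sum>j<n. y j)" for n
    using arg_cong[OF sum_merge_vars[of i n], of "meval y"] by (simp del: sum.lessThan_Suc)
  obtain n where n: "m = Suc n" using assms by (cases m) auto
  show ?thesis
  proof (cases "k < n")
    case True
    then show ?thesis by (simp add: lambda_at_def n merge_vars_def)
  next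
    case False
    then have k: "k = n" using assms n by simp
    show ?thesis
    proof (cases "i < n")
      case True
      then show ?thesis by (simp add: lambda_at_def n k sum)
    next
      case False
      then have "i = n" using assms n by simp
      then show ?thesis using sum[of n] by (simp add: lambda_at_def n k)
    qed
  qed
qed

text \<open>
  Merging two arguments by the \<open>\<lambda>\<close>-product at \<open>\<lambda>\<^sub>i\<close>, with the variables merged accordingly, is merging the two
  points.
\<close>

lemma meval_coface:
  fixes y :: "nat \<Rightarrow> 'k::field_char_0"
  assumes \<phi>: "\<phi> \<in> U3.cochains m" and rep: "represents m \<phi> F" and xs: "length xs = Suc m" and i: "i < m"
  defines "p \<equiv> points_at (Suc m) y xs"
  shows "meval y (U3.coface i \<phi> xs) = F (merge_args i (p ! i \<odot> p ! Suc i) p)"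
proof -
  let ?q = "U3_lprod (xs ! i) (xs ! Suc i)" and ?y = "\<lambda>k. meval y (merge_vars i k)"
  define X where "X = (\<Sum>j\<le>degree ?q. U3_scale (y i ^ j) (coeff ?q j))"
  define \<psi> where "\<psi> x = meval ?y (\<phi> (merge_args i x xs))" for x
  have "Suc i < length xs" using xs i by simp
  note val = merge_args_value[OF this]
  have len: "length (merge_args i 0 xs) = m" using xs i by simp
  have \<psi>_add: "\<psi> (a + b) = \<psi> a + \<psi> b" for a b
    unfolding \<psi>_def by (subst (1 2 3) val) (simp only: U3.cochain_add[OF \<phi> len i] meval_simps)
  have \<psi>_scale: "\<psi> (U3_scale r a) = r * \<psi> a" for r a
    unfolding \<psi>_def by (subst (1 2) val) (simp only: U3.cochain_scale[OF \<phi> len i] meval_simps)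
  have "\<psi> 0 = 0" using \<psi>_add[of 0 0] by simp
  then have \<psi>_sum: "\<psi> (sum f A) = (\<Sum>a\<in>A. \<psi> (f a))" for f :: "nat \<Rightarrow> 'k U3" and A
    by (induction A rule: infinite_finite_induct) (simp_all add: \<psi>_add)
  have "meval y (U3.coface i \<phi> xs) = \<psi> X"
    by (simp add: U3.coface_def extend_eval_def meval_msubst X_def \<psi>_sum \<psi>_scale) (simp add: \<psi>_def)
  also have "\<dots> = F (points_at m ?y (merge_args i X xs))"
    using rep xs i by (simp add: represents_def \<psi>_def)
  also have "points_at m ?y (merge_args i X xs) = merge_args i (p ! i \<odot> p ! Suc i) p"
  proof (rule nth_equalityI)
    show "length (points_at m ?y (merge_args i X xs)) = length (merge_args i (p ! i \<odot> p ! Suc i) p)"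
      using i by (simp add: p_def)
    fix k assume "k < length (points_at m ?y (merge_args i X xs))"
    then have k: "k < m" by simp
    have "p ! i \<odot> p ! Suc i = (lambda_at (Suc m) y i + lambda_at (Suc m) y (Suc i), fibre (lambda_at (Suc m) y i + lambda_at (Suc m) y (Suc i)) X)"
    proof -
      have "lambda_at (Suc m) y i = y i" using i by (simp add: lambda_at_def)
      then show ?thesis
        using fibre_lprod[of "y i" "lambda_at (Suc m) y (Suc i)" "xs ! i" "xs ! Suc i"] i by (simp add: p_def X_def)
    qed
    then show "points_at m ?y (merge_args i X xs) ! k = merge_args i (p ! i \<odot> p ! Suc i) p ! k"
      using k i xs by (simp add: nth_merge_args lambda_at_merge[OF i k] p_def)
  qed
  finally show ?thesis .
qed

lemma meval_differential:
  assumes \<phi>: "\<phi> \<in> U3.cochains m" and rep: "represents m \<phi> F" and xs: "length xs = Suc m"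
  shows "meval y (U3.differential m \<phi> xs) = - bar F (points_at (Suc m) y xs)"
  using xs by (simp add: U3.differential_def bar_sum meval_coface[OF \<phi> rep xs] sum_negf)

text \<open>
  The values at all parameters determine a polynomial, and sesquilinearity holds since \<open>\<partial>\<close> acts on the fibre at \<open>\<lambda>\<close> by
  \<open>-\<lambda>\<close>.
\<close>

lemma cochain_of_points:
  assumes G: "cochain m G" and m: "m \<ge> 1"
  obtains \<eta> where "\<eta> \<in> U3.cochains m" "represents m \<eta> G"
proof -
  have ex: "\<exists>P. mvars P \<subseteq> {..<m - 1} \<and> (\<forall>y. meval y P = G (points_at m y as))" for as
  proof (rule polyfun_mpoly_vars)
    let ?ss = "map (\<lambda>i y. (lambda_at m y i, fibre (lambda_at m y i) (as ! i))) [0..<m]"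
    have "polyfun (\<lambda>y. G (map (\<lambda>s. s y) ?ss))"
      by (rule smoothD[of m "\<lambda>x. G"]) (use G in \<open>auto simp: cochain_def intro: plot_fibre polyfun_lambda_at\<close>)
    then show "polyfun (\<lambda>y. G (points_at m y as))" by (simp add: points_at_def comp_def)
    fix y :: "nat \<Rightarrow> 'a"
    have "lambda_at m (\<lambda>k. if k < m - 1 then y k else 0) = lambda_at m y" by (auto simp: lambda_at_def fun_eq_iff)
    then show "G (points_at m (\<lambda>k. if k < m - 1 then y k else 0) as) = G (points_at m y as)" by (simp add: points_at_def)
  qed
  define \<eta> where "\<eta> as = (if length as = m then SOME P. mvars P \<subseteq> {..<m - 1} \<and> (\<forall>y. meval y P = G (points_at m y as)) else 0)" for as
  have \<eta>: "mvars (\<eta> as) \<subseteq> {..<m - 1}" "meval y (\<eta> as) = G (points_at m y as)" if "length as = m" for as y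
    using someI_ex[OF ex[of as]] that by (auto simp: \<eta>_def)
  have lin: "multilinear m G" using G by (simp add: cochain_def)
  have "\<eta> \<in> U3.cochains m"
  proof (rule U3.cochainsI)
    fix as :: "'a U3 list" and i assume as: "length as = m" "i < m"
    show "\<eta> (as[i := x + z]) = \<eta> (as[i := x]) + \<eta> (as[i := z])" for x z
      by (rule meval_eqI) (use as in \<open>simp add: \<eta> points_at_update fibre_simps multilinearD[OF lin]\<close>)
    show "\<eta> (as[i := U3_scale r x]) = mconst r * \<eta> (as[i := x])" for r x
      by (rule meval_eqI) (use as in \<open>simp add: \<eta> points_at_update fibre_simps multilinearD[OF lin]\<close>)
    show "\<eta> (as[i := U3_del x]) = U3.del_factor m i * \<eta> (as[i := x])" for x
      by (rule meval_eqI) (use as in \<open>simp add: \<eta> points_at_update fibre_simps multilinearD[OF lin] meval_del_factor\<close>)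
  qed (use \<eta>(1) in \<open>auto simp: \<eta>_def\<close>)
  moreover have "represents m \<eta> G" by (simp add: represents_def \<eta>(2))
  ultimately show thesis by (rule that)
qed

text \<open>
  All lists of points with sum zero arise from arguments in \<open>U(3)\<close>.
\<close>

lemma points_at_lift:
  assumes "length L = Suc n" "lambda_sum L = 0"
  shows "points_at (Suc n) (\<lambda>i. fst (L ! i)) (map (\<lambda>s. lift (snd s)) L) = L"
proof (rule nth_equalityI)
  fix i assume "i < length (points_at (Suc n) (\<lambda>i. fst (L ! i)) (map (\<lambda>s. lift (snd s)) L))"
  then have i: "i < Suc n" by simp
  have "lambda_at (Suc n) (\<lambda>i. fst (L ! i)) i = fst (L ! i)"
    using assms i by (auto simp: lambda_at_def lambda_sum_nth less_Suc_eq add_eq_0_iff)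
  then show "points_at (Suc n) (\<lambda>i. fst (L ! i)) (map (\<lambda>s. lift (snd s)) L) ! i = L ! i"
    using assms i by simp
qed (simp add: assms)

text \<open>
  Realised on points, the cocycle is \<open>bar G\<close> by \<open>bar_exact\<close>. The differential of the complex is \<open>-bar\<close> on points, hence the primitive
  is built from \<open>-G\<close>.
\<close>

theorem theorem4p14:
  fixes n :: nat
  assumes "n \<ge> 4"
  shows "U3.cohomology n =
    ({U3.coboundaries n} :: ('k::field_char_0 U3 list \<Rightarrow> 'k mpoly) set set)"
  unfolding U3.cohomology_zero_iff
proof
  fix \<phi> :: "'k U3 list \<Rightarrow> 'k mpoly" assume "\<phi> \<in> U3.cocycles n"
  then have \<phi>: "\<phi> \<in> U3.cochains n" and cocycle: "U3.differential n \<phi> = (\<lambda>_. 0)"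
    by (auto simp: U3.cocycles_def)
  define m where "m = n - 1"
  have n: "n = Suc m" "m \<ge> 1" using assms by (auto simp: m_def)
  note rep = represents_realize[OF \<phi>]
  have "bar (realize \<phi>) L = 0" if L: "length L = Suc n" "lambda_sum L = 0" for L
    using meval_differential[OF \<phi> rep, of "map (\<lambda>s. lift (snd s)) L" "\<lambda>i. fst (L ! i)"] L
    by (simp add: cocycle points_at_lift)
  then obtain G where G: "cochain m G" "\<And>L. length L = n \<Longrightarrow> lambda_sum L = 0 \<Longrightarrow> realize \<phi> L = bar G L"
    using bar_exact[OF cochain_realize[OF \<phi>] assms] unfolding m_def by blast
  have "cochain m (\<lambda>L. 0 - G L)"
    by (intro cochain_diff G) (simp add: cochain_def multilinear_def smooth_def polyfam.const)
  then obtain \<eta> where \<eta>: "\<eta> \<in> U3.cochains m" "represents m \<eta> (\<lambda>L. 0 - G L)"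
    by (rule cochain_of_points[OF _ n(2)])
  have "U3.differential m \<eta> = \<phi>"
  proof
    fix xs :: "'k U3 list"
    show "U3.differential m \<eta> xs = \<phi> xs"
    proof (cases "length xs = Suc m")
      case True
      show ?thesis
      proof (rule meval_eqI)
        fix y
        have "bar (\<lambda>L. 0 - G L) (points_at n y xs) = - bar G (points_at n y xs)" by (simp only: bar_diff bar_zero) simp
        then have "meval y (U3.differential m \<eta> xs) = bar G (points_at n y xs)"
          using meval_differential[OF \<eta> True, of y] by (simp add: n)
        also have "\<dots> = realize \<phi> (points_at n y xs)" using G(2)[of "points_at n y xs"] n by (simp add: lambda_sum_points_at)
        also have "\<dots> = meval y (\<phi> xs)" using rep True n by (simp add: represents_def)
        finally show "meval y (U3.differential m \<eta> xs) = meval y (\<phi> xs)" .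
      qed
    next
      case False
      then show ?thesis using U3.cochain_length[OF \<phi>, of xs] by (simp add: U3.differential_def n)
    qed
  qed
  then show "\<phi> \<in> U3.coboundaries n" using \<eta>(1) by (auto simp: U3.coboundaries_def n)
qed

end
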